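(* The left ideal $\mathcal I=\{D\in\mathcal D: D\,{}_2\phi_1=0\}$ of $\mathcal D$ is generated (as a left ideal) by \begin{align*} P_a&=(1-a)A-1+aZ,\\ P_b&=(1-b)B-1+bZ,\\ P_c&=z(c-b)(c-a)C+(c-1)(c^2+abz-(a+b)cz)-(c-1)c(c-abz)Z,\\ Q_a&=(-cq+ac+aq-a^2z)+a(abz-c)Z+q(c-a)A^{-1},\\ Q_b&=(-cq+bc+bq-b^2z)+b(abz-c)Z+q(c-b)B^{-1},\\ Q_c&=-q+cZ+(q-c)C^{-1},\\ R_z&=-(c+q-az-bz)+(q-z)Z^{-1}+(c-abz)Z. \end{align*}
   Context: Throughout $q$ is a complex number with $0<|q|<1$. Put $(x;q)_\infty=\prod_{j\ge 0}(1-xq^j)$, $(x;q)_k=(x;q)_\infty/(xq^k;q)_\infty$, $(a_1,\dots,a_s;q)_k=\prod_j(a_j;q)_k$. The function ${}_2\phi_1(a,b;c;q,z)=\sum_{k\ge 0}\frac{(a,b;q)_k}{(q,c;q)_k}z^k$ for $|z|<1$; the same symbol denotes its meromorphic continuation in $(a,b,c,z)$. $\mathcal M$ is the field of meromorphic functions of $(a,b,c,z,q)$ with $a,b,c,z\in\mathbb C^*$, $0<|q|<1$; $\mathcal R=\mathbb C(a,b,c,q,z)\subset\mathcal M$. $N\cong\mathbb Z^4$ is the abelian group of elements $M_{k_a,k_b,k_c,k_z}$ ($k_a,k_b,k_c,k_z\in\mathbb Z$) acting on functions by $M_{k_a,k_b,k_c,k_z}f(a,b,c,q,z)=f(aq^{k_a},bq^{k_b},cq^{k_c},q,zq^{k_z})$.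 $A=M_{1,0,0,0}$, $B=M_{0,1,0,0}$, $C=M_{0,0,1,0}$, $Z=M_{0,0,0,1}$. The ring of $q$-difference operators is the smash product $\mathcal D=\mathcal R\# N$: its elements are finite sums $\sum_k r_kP_k$ ($r_k\in\mathcal R$, $P_k\in N$) with multiplication $(\sum_k r_kP_k)(\sum_j s_jQ_j)=\sum_{k,j}r_kP_k(s_j)P_kQ_j$. It acts on $\mathcal M$ by $(\sum_k r_kP_k)f=\sum_k r_kP_k(f)$. *)

theory Defs
  imports "HOL-Complex_Analysis.Complex_Analysis" "HOL-Library.Poly_Mapping"
begin

section \<open>Holomorphic and meromorphic functions of several variables\<close>

no_notation fps_nth (infixl \<open>$\<close> 75)

text \<open>Complex differentiability in several variables: the real Frechet derivative is
  complex-linear. Only used for open sets.\<close>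

definition cholomorphic_on :: "(complex^'n \<Rightarrow> complex) \<Rightarrow> (complex^'n) set \<Rightarrow> bool" where
  "cholomorphic_on f U \<longleftrightarrow>
     (\<forall>x\<in>U. \<exists>f'. (f has_derivative f') (at x) \<and> (\<forall>t v. f' (t *s v) = t * f' v))"

lemma cholomorphic_on_subset: "cholomorphic_on f U \<Longrightarrow> V \<subseteq> U \<Longrightarrow> cholomorphic_on f V"
  unfolding cholomorphic_on_def by blast

lemma cholomorphic_on_const [simp]: "cholomorphic_on (\<lambda>_. k) U"
  unfolding cholomorphic_on_def by (auto intro!: exI[of _ "\<lambda>_. 0"])

lemma cholomorphic_on_nth: "cholomorphic_on (\<lambda>x. x $ i) U"
  unfolding cholomorphic_on_def
  by (auto intro!: exI[of _ "\<lambda>x. x $ i"] bounded_linear_imp_has_derivative bounded_linear_vec_nth)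

lemma cholomorphic_on_add:
  assumes "cholomorphic_on f U" "cholomorphic_on g U"
  shows "cholomorphic_on (\<lambda>x. f x + g x) U"
  unfolding cholomorphic_on_def
proof
  fix x assume "x \<in> U"
  then obtain f' g' where "(f has_derivative f') (at x)" "\<forall>t v. f' (t *s v) = t * f' v"
    "(g has_derivative g') (at x)" "\<forall>t v. g' (t *s v) = t * g' v"
    using assms unfolding cholomorphic_on_def by meson
  then show "\<exists>h'. ((\<lambda>x. f x + g x) has_derivative h') (at x) \<and> (\<forall>t v. h' (t *s v) = t * h' v)"
    by (intro exI[of _ "\<lambda>v. f' v + g' v"]) (auto intro!: derivative_eq_intros simp: algebra_simps)
qed

lemma cholomorphic_on_mult:
  assumes "cholomorphic_on f U" "cholomorphic_on g U"
  shows "cholomorphic_on (\<lambda>x. f x * g x) U"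
  unfolding cholomorphic_on_def
proof
  fix x assume "x \<in> U"
  then obtain f' g' where "(f has_derivative f') (at x)" "\<forall>t v. f' (t *s v) = t * f' v"
    "(g has_derivative g') (at x)" "\<forall>t v. g' (t *s v) = t * g' v"
    using assms unfolding cholomorphic_on_def by meson
  then show "\<exists>h'. ((\<lambda>x. f x * g x) has_derivative h') (at x) \<and> (\<forall>t v. h' (t *s v) = t * h' v)"
    by (intro exI[of _ "\<lambda>v. f x * g' v + f' v * g x"]) (auto intro!: derivative_eq_intros simp: algebra_simps)
qed

lemma cholomorphic_on_imp_continuous_on:
  "cholomorphic_on f U \<Longrightarrow> continuous_on U f"
  unfolding cholomorphic_on_def
  by (meson continuous_at_imp_continuous_on has_derivative_continuous)

lemma bounded_linear_axis: "bounded_linear (axis i :: complex \<Rightarrow> complex^'n)"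
  unfolding linear_conv_bounded_linear[symmetric]
  by (rule linearI) (auto simp: vec_eq_iff axis_def)

lemma vec_axis_expansion: "(x::complex^'n) = (\<Sum>i\<in>UNIV. axis i (x $ i))"
  by (simp add: vec_eq_iff axis_def sum_component)

lemma cholomorphic_on_compose:
  fixes \<Phi> :: "complex^'n \<Rightarrow> complex^'m"
  assumes \<Phi>: "\<And>i. cholomorphic_on (\<lambda>x. \<Phi> x $ i) V"
    and f: "cholomorphic_on f U" and V: "\<And>x. x \<in> V \<Longrightarrow> \<Phi> x \<in> U"
  shows "cholomorphic_on (\<lambda>x. f (\<Phi> x)) V"
  unfolding cholomorphic_on_def
proof
  fix x assume x: "x \<in> V"
  have "\<forall>i. \<exists>d. ((\<lambda>x. \<Phi> x $ i) has_derivative d) (at x) \<and> (\<forall>t v. d (t *s v) = t * d v)"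
    using \<Phi> x unfolding cholomorphic_on_def by blast
  then obtain d where d: "\<And>i. ((\<lambda>x. \<Phi> x $ i) has_derivative d i) (at x)"
    and dl: "\<And>i t v. d i (t *s v) = t * d i v"
    by metis
  obtain f' where f': "(f has_derivative f') (at (\<Phi> x))" "\<And>t v. f' (t *s v) = t * f' v"
    using f V[OF x] unfolding cholomorphic_on_def by blast
  have "((\<lambda>x. \<Sum>i\<in>UNIV. axis i (\<Phi> x $ i)) has_derivative (\<lambda>v. \<Sum>i\<in>UNIV. axis i (d i v))) (at x)"
    by (intro has_derivative_sum bounded_linear.has_derivative[OF bounded_linear_axis] d)
  then have D: "(\<Phi> has_derivative (\<lambda>v. \<Sum>i\<in>UNIV. axis i (d i v))) (at x)"
    by (simp flip: vec_axis_expansion)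
  have "(\<Sum>i\<in>UNIV. axis i (d i (t *s v))) = t *s (\<Sum>i\<in>UNIV. axis i (d i v))" for t v
    by (simp add: dl vec_eq_iff sum_component axis_def)
  with diff_chain_at[OF D f'(1)] f'(2)
  show "\<exists>h'. ((\<lambda>x. f (\<Phi> x)) has_derivative h') (at x) \<and> (\<forall>t v. h' (t *s v) = t * h' v)"
    by (intro exI[of _ "f' \<circ> (\<lambda>v. \<Sum>i\<in>UNIV. axis i (d i v))"]) (auto simp: o_def)
qed

lemma cholomorphic_on_holomorphic_compose:
  assumes f: "f holomorphic_on S" "open S" and g: "cholomorphic_on g U" and "\<And>x. x \<in> U \<Longrightarrow> g x \<in> S"
  shows "cholomorphic_on (\<lambda>x. f (g x)) U"
  unfolding cholomorphic_on_def
proof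
  fix x assume x: "x \<in> U"
  obtain d where d: "(f has_field_derivative d) (at (g x))"
    using assms x by (metis holomorphic_on_imp_differentiable_at field_differentiable_def)
  obtain g' where g': "(g has_derivative g') (at x)" "\<And>t v. g' (t *s v) = t * g' v"
    using g x unfolding cholomorphic_on_def by blast
  show "\<exists>h'. ((\<lambda>x. f (g x)) has_derivative h') (at x) \<and> (\<forall>t v. h' (t *s v) = t * h' v)"
    using diff_chain_at[OF g'(1) d[unfolded has_field_derivative_def]] g'(2)
    by (intro exI[of _ "(*) d \<circ> g'"]) (auto simp: o_def)
qed

definition vec_upd :: "complex^'n \<Rightarrow> 'n \<Rightarrow> complex \<Rightarrow> complex^'n" where
  "vec_upd x i t = (\<chi> j. if j = i then t else x $ j)"

lemma cholomorphic_on_slice: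
  assumes f: "cholomorphic_on f U" and D: "\<And>t. t \<in> D \<Longrightarrow> vec_upd x i t \<in> U"
  shows "(\<lambda>t. f (vec_upd x i t)) holomorphic_on D"
  unfolding holomorphic_on_def
proof
  fix t assume t: "t \<in> D"
  obtain f' where f': "(f has_derivative f') (at (vec_upd x i t))" "\<And>t v. f' (t *s v) = t * f' v"
    using f D[OF t] unfolding cholomorphic_on_def by blast
  have eq: "vec_upd x i = (\<lambda>t. axis i t + (x - axis i (x $ i)))"
    by (rule ext) (simp add: vec_upd_def vec_eq_iff axis_def)
  have "(vec_upd x i has_derivative axis i) (at t)"
    unfolding eq
    by (rule has_derivative_add_const[OF bounded_linear_imp_has_derivative[OF bounded_linear_axis]])
  from diff_chain_at[OF this f'(1)]
  have "((\<lambda>t. f (vec_upd x i t)) has_derivative (\<lambda>t. f' (axis i t))) (at t)"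
    unfolding o_def .
  moreover obtain c where c: "c = f' (axis i 1)" by blast
  have "f' (axis i t) = c * t" for t
  proof -
    have "axis i t = t *s axis i 1" by (simp add: vec_eq_iff axis_def)
    then have "f' (axis i t) = f' (t *s axis i 1)" by (rule arg_cong)
    also have "\<dots> = c * t" by (simp only: f'(2) c mult.commute)
    finally show ?thesis .
  qed
  ultimately have "((\<lambda>t. f (vec_upd x i t)) has_field_derivative c) (at t)"
    unfolding has_field_derivative_def by simp
  then show "(\<lambda>t. f (vec_upd x i t)) field_differentiable at t within D"
    unfolding field_differentiable_def by (auto intro: has_field_derivative_at_within)
qed

definition polydisc :: "complex^'n \<Rightarrow> real \<Rightarrow> (complex^'n) set" where
  "polydisc p r = {x. \<forall>i. dist (p $ i) (x $ i) < r}"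

lemma open_polydisc: "open (polydisc p r)"
proof -
  have "polydisc p r = (\<Inter>i\<in>UNIV. (\<lambda>x. x $ i) -` ball (p $ i) r)"
    by (auto simp: polydisc_def)
  moreover have "open (\<Inter>i\<in>UNIV. (\<lambda>x. x $ i) -` ball (p $ i) r)"
    by (intro open_INT finite ballI open_vimage open_ball continuous_on_component continuous_on_id)
  ultimately show ?thesis by simp
qed

lemma polydisc_centre: "r > 0 \<Longrightarrow> p \<in> polydisc p r"
  by (simp add: polydisc_def)

lemma open_contains_polydisc:
  assumes "open U" "p \<in> U"
  obtains r where "r > 0" "polydisc p r \<subseteq> U"
proof -
  obtain e where e: "e > 0" "ball p e \<subseteq> U" using assms by (meson open_contains_ball)
  let ?r = "e / real CARD('a)"
  have "polydisc p ?r \<subseteq> ball p e"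
  proof
    fix x assume x: "x \<in> polydisc p ?r"
    have "dist p x \<le> (\<Sum>i\<in>UNIV. dist (p $ i) (x $ i))"
      unfolding dist_vec_def by (rule L2_set_le_sum) auto
    also have "\<dots> < (\<Sum>i\<in>(UNIV::'a set). ?r)"
      using x by (intro sum_strict_mono) (auto simp: polydisc_def)
    finally show "x \<in> ball p e" by simp
  qed
  with e show ?thesis by (intro that[of ?r]) auto
qed

lemma cholomorphic_polydisc_identity:
  assumes f: "cholomorphic_on f (polydisc p r)" and W: "open W" "W \<noteq> {}" "W \<subseteq> polydisc p r"
    and 0: "\<And>x. x \<in> W \<Longrightarrow> f x = 0" and x: "x \<in> polydisc p r"
  shows "f x = 0"
proof -
  obtain w where w: "w \<in> W" using W by auto
  obtain s where s: "s > 0" "polydisc w s \<subseteq> W" using open_contains_polydisc[OF W(1) w] .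
  have "finite S \<Longrightarrow> \<forall>x\<in>polydisc p r. (\<forall>i. i \<notin> S \<longrightarrow> dist (w $ i) (x $ i) < s) \<longrightarrow> f x = 0" for S
  proof (induction S rule: finite_induct)
    case empty
    then show ?case using s 0 by (auto simp: polydisc_def)
  next
    case (insert i S)
    show ?case
    proof (intro ballI impI)
      fix x assume x: "x \<in> polydisc p r" and xs: "\<forall>j. j \<notin> insert i S \<longrightarrow> dist (w $ j) (x $ j) < s"
      let ?D = "ball (p $ i) r" and ?D' = "ball (p $ i) r \<inter> ball (w $ i) s"
      have up: "vec_upd x i t \<in> polydisc p r" if "t \<in> ?D" for t
        using x that by (auto simp: polydisc_def vec_upd_def)
      have hol: "(\<lambda>t. f (vec_upd x i t)) holomorphic_on ?D"
        using cholomorphic_on_slice[OF f] up by blast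
      have zero: "f (vec_upd x i t) = 0" if "t \<in> ?D'" for t
        using insert.IH up[of t] that xs by (auto simp: vec_upd_def)
      have ne: "w $ i \<in> ?D'" using w W s by (auto simp: polydisc_def)
      have xi: "x $ i \<in> ?D" using x by (auto simp: polydisc_def)
      have ne': "?D' \<noteq> {}" using ne by blast
      have "f (vec_upd x i (x $ i)) = 0"
        by (rule analytic_continuation_open[of ?D' ?D "\<lambda>t. f (vec_upd x i t)" "\<lambda>_. 0" "x $ i"])
           (intro open_Int open_ball ne' convex_connected convex_ball Int_lower1 hol holomorphic_on_const xi
              | rule zero; assumption)+
      moreover have "vec_upd x i (x $ i) = x" by (auto simp: vec_upd_def vec_eq_iff)
      ultimately show "f x = 0" by simp
    qed
  qed
  from this[of UNIV] x show ?thesis by auto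
qed

text \<open>A meromorphic function of several variables is locally a quotient of holomorphic
  functions whose denominator does not vanish identically on any nonempty open set. The values of
  the representing function where the denominator vanishes are irrelevant.\<close>

definition cmeromorphic_on :: "(complex^'n \<Rightarrow> complex) \<Rightarrow> (complex^'n) set \<Rightarrow> bool" where
  "cmeromorphic_on f \<Omega> \<longleftrightarrow>
     (\<forall>p\<in>\<Omega>. \<exists>U g h. open U \<and> p \<in> U \<and> cholomorphic_on g U \<and> cholomorphic_on h U \<and>
        U \<subseteq> closure {x\<in>U. h x \<noteq> 0} \<and> (\<forall>x\<in>U. h x \<noteq> 0 \<longrightarrow> f x = g x / h x))"

text \<open>Two meromorphic functions are identified if their representing functions agree on a
  dense open subset.\<close>

definition generically :: "(complex^'n) set \<Rightarrow> (complex^'n \<Rightarrow> bool) \<Rightarrow> bool" where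
  "generically \<Omega> P \<longleftrightarrow> \<Omega> \<subseteq> closure (interior {x. P x})"

lemma open_dense_iff: "open U \<Longrightarrow> U \<subseteq> closure S \<longleftrightarrow> (\<forall>W. open W \<longrightarrow> W \<noteq> {} \<longrightarrow> W \<subseteq> U \<longrightarrow> W \<inter> S \<noteq> {})"
  for U :: "'a::topological_space set"
proof (intro iffI allI impI)
  fix W assume "U \<subseteq> closure S" "open W" "W \<noteq> {}" "W \<subseteq> U"
  then obtain x where "x \<in> W" "x \<in> closure S" by blast
  with \<open>open W\<close> show "W \<inter> S \<noteq> {}" by (metis open_Int_closure_eq_empty disjoint_iff)
next
  assume U: "open U" and h: "\<forall>W. open W \<longrightarrow> W \<noteq> {} \<longrightarrow> W \<subseteq> U \<longrightarrow> W \<inter> S \<noteq> {}"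
  have "open (U - closure S)" "U - closure S \<subseteq> U" "(U - closure S) \<inter> S = {}"
    using U closure_subset[of S] by (auto simp: open_Diff)
  then have "U - closure S = {}" using h by meson
  then show "U \<subseteq> closure S" by blast
qed

lemma generically_iff:
  assumes "open \<Omega>"
  shows "generically \<Omega> P \<longleftrightarrow>
    (\<forall>W. open W \<longrightarrow> W \<noteq> {} \<longrightarrow> W \<subseteq> \<Omega> \<longrightarrow> (\<exists>V. open V \<and> V \<noteq> {} \<and> V \<subseteq> W \<and> (\<forall>x\<in>V. P x)))"
  (is "_ \<longleftrightarrow> ?R")
proof -
  have "(W \<inter> interior {x. P x} \<noteq> {}) \<longleftrightarrow> (\<exists>V. open V \<and> V \<noteq> {} \<and> V \<subseteq> W \<and> (\<forall>x\<in>V. P x))" if "open W" for W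
  proof
    assume "W \<inter> interior {x. P x} \<noteq> {}"
    then show "\<exists>V. open V \<and> V \<noteq> {} \<and> V \<subseteq> W \<and> (\<forall>x\<in>V. P x)"
      using that interior_subset[of "{x. P x}"]
      by (intro exI[of _ "W \<inter> interior {x. P x}"] conjI open_Int open_interior) (assumption | blast)+
  next
    assume "\<exists>V. open V \<and> V \<noteq> {} \<and> V \<subseteq> W \<and> (\<forall>x\<in>V. P x)"
    then obtain V where V: "open V" "V \<noteq> {}" "V \<subseteq> W" "V \<subseteq> {x. P x}" by auto
    then have "V \<subseteq> interior {x. P x}" by (intro interior_maximal)
    with V show "W \<inter> interior {x. P x} \<noteq> {}" by auto
  qed
  then have "(\<forall>W. open W \<longrightarrow> W \<noteq> {} \<longrightarrow> W \<subseteq> \<Omega> \<longrightarrow> W \<inter> interior {x. P x} \<noteq> {}) \<longleftrightarrow> ?R"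
    by (intro all_cong1 imp_cong refl)
  then show ?thesis
    unfolding generically_def open_dense_iff[OF assms] .
qed

lemma genericallyD:
  assumes "open \<Omega>" "generically \<Omega> P" "open W" "W \<noteq> {}" "W \<subseteq> \<Omega>"
  obtains V where "open V" "V \<noteq> {}" "V \<subseteq> W" "\<forall>x\<in>V. P x"
proof -
  have "\<exists>V. open V \<and> V \<noteq> {} \<and> V \<subseteq> W \<and> (\<forall>x\<in>V. P x)"
    by (rule assms(2)[unfolded generically_iff[OF assms(1)], rule_format, OF assms(3-5)])
  then show ?thesis by (elim exE conjE) (rule that)
qed

lemma generically_conj:
  assumes "open \<Omega>" "generically \<Omega> P" "generically \<Omega> Q"
  shows "generically \<Omega> (\<lambda>x. P x \<and> Q x)"
  unfolding generically_iff[OF assms(1)]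
proof (intro allI impI)
  fix W :: "(complex^'a) set" assume W: "open W" "W \<noteq> {}" "W \<subseteq> \<Omega>"
  obtain V where V: "open V" "V \<noteq> {}" "V \<subseteq> W" "\<forall>x\<in>V. P x"
    using genericallyD[OF assms(1,2) W] .
  with W have "V \<subseteq> \<Omega>" by blast
  obtain V' where V': "open V'" "V' \<noteq> {}" "V' \<subseteq> V" "\<forall>x\<in>V'. Q x"
    using genericallyD[OF assms(1,3) V(1,2) \<open>V \<subseteq> \<Omega>\<close>] .
  then have "open V' \<and> V' \<noteq> {} \<and> V' \<subseteq> W \<and> (\<forall>x\<in>V'. P x \<and> Q x)"
    using V(3,4) by blast
  then show "\<exists>V. open V \<and> V \<noteq> {} \<and> V \<subseteq> W \<and> (\<forall>x\<in>V. P x \<and> Q x)" ..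
qed

lemma generically_mono:
  assumes "generically \<Omega> P" "\<And>x. P x \<Longrightarrow> Q x"
  shows "generically \<Omega> Q"
proof -
  have "closure (interior {x. P x}) \<subseteq> closure (interior {x. Q x})"
    using assms(2) by (intro closure_mono interior_mono) auto
  then show ?thesis using assms(1) unfolding generically_def by blast
qed

lemma generically_True: "(\<And>x. P x) \<Longrightarrow> generically \<Omega> P"
  by (simp add: generically_def)

lemma nonvanishing_dense_iff:
  assumes "open U"
  shows "U \<subseteq> closure {x\<in>U. h x \<noteq> 0} \<longleftrightarrow>
    (\<forall>W. open W \<longrightarrow> W \<noteq> {} \<longrightarrow> W \<subseteq> U \<longrightarrow> (\<exists>x\<in>W. h x \<noteq> (0::complex)))"
  unfolding open_dense_iff[OF assms] by (intro all_cong1 imp_cong refl) auto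

lemma open_nonvanishing:
  assumes "cholomorphic_on h U" "open W" "W \<subseteq> U"
  shows "open {x\<in>W. h x \<noteq> 0}"
proof -
  have "continuous_on W h"
    using assms cholomorphic_on_imp_continuous_on continuous_on_subset by blast
  then have "open (W \<inter> h -` (- {0}))"
    using continuous_open_preimage[OF _ assms(2), of h "- {0}"] by auto
  moreover have "W \<inter> h -` (- {0}) = {x\<in>W. h x \<noteq> 0}" by auto
  ultimately show ?thesis by simp
qed

lemma nonvanishing_dense_subset:
  assumes "open U" "U \<subseteq> closure {x\<in>U. h x \<noteq> (0::complex)}" "open V" "V \<subseteq> U"
  shows "V \<subseteq> closure {x\<in>V. h x \<noteq> 0}"
  using assms(2,4) unfolding nonvanishing_dense_iff[OF assms(1)] nonvanishing_dense_iff[OF assms(3)]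
  by (meson order_trans)

lemma nonvanishing_dense_mult:
  assumes U: "open U" and h: "cholomorphic_on h U"
    and hd: "U \<subseteq> closure {x\<in>U. h x \<noteq> 0}" and kd: "U \<subseteq> closure {x\<in>U. k x \<noteq> 0}"
  shows "U \<subseteq> closure {x\<in>U. h x * k x \<noteq> 0}"
  unfolding nonvanishing_dense_iff[OF U]
proof (intro allI impI)
  fix W assume W: "open W" "W \<noteq> {}" "W \<subseteq> U"
  have ne: "{x\<in>W. h x \<noteq> 0} \<noteq> {}"
    using hd W unfolding nonvanishing_dense_iff[OF U] by blast
  have "{x\<in>W. h x \<noteq> 0} \<subseteq> U" using W by blast
  then obtain x where "x \<in> W" "h x \<noteq> 0" "k x \<noteq> 0"
    using kd[unfolded nonvanishing_dense_iff[OF U], rule_format, OF open_nonvanishing[OF h W(1,3)] ne] by blast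
  then show "\<exists>x\<in>W. h x * k x \<noteq> 0" by auto
qed

lemma cmeromorphic_onE:
  assumes "cmeromorphic_on f \<Omega>" "p \<in> \<Omega>" "open \<Omega>"
  obtains r g h where "r > 0" "polydisc p r \<subseteq> \<Omega>"
    "cholomorphic_on g (polydisc p r)" "cholomorphic_on h (polydisc p r)"
    "polydisc p r \<subseteq> closure {x\<in>polydisc p r. h x \<noteq> 0}"
    "\<forall>x\<in>polydisc p r. h x \<noteq> 0 \<longrightarrow> f x = g x / h x"
proof -
  obtain U g h where U: "open U" "p \<in> U" "cholomorphic_on g U" "cholomorphic_on h U"
    "U \<subseteq> closure {x\<in>U. h x \<noteq> 0}" "\<forall>x\<in>U. h x \<noteq> 0 \<longrightarrow> f x = g x / h x"
    using assms(1,2) unfolding cmeromorphic_on_def by meson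
  obtain r where r: "r > 0" "polydisc p r \<subseteq> U \<inter> \<Omega>"
    by (rule open_contains_polydisc[of "U \<inter> \<Omega>" p]) (use U assms in auto)
  show ?thesis
  proof (rule that[of r g h])
    show "polydisc p r \<subseteq> closure {x\<in>polydisc p r. h x \<noteq> 0}"
      by (rule nonvanishing_dense_subset[OF U(1,5)]) (use r open_polydisc in auto)
  qed (use r U cholomorphic_on_subset in auto)
qed

lemma local_fractionI:
  assumes "open U" "p \<in> U" "cholomorphic_on g U" "cholomorphic_on h U"
    "U \<subseteq> closure {x\<in>U. h x \<noteq> 0}" "\<forall>x\<in>U. h x \<noteq> 0 \<longrightarrow> f x = g x / h x"
  shows "\<exists>U g h. open U \<and> p \<in> U \<and> cholomorphic_on g U \<and> cholomorphic_on h U \<and>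
        U \<subseteq> closure {x\<in>U. h x \<noteq> 0} \<and> (\<forall>x\<in>U. h x \<noteq> 0 \<longrightarrow> f x = g x / h x)"
  using assms by meson

lemma cmeromorphic_onI:
  assumes "\<And>p. p \<in> \<Omega> \<Longrightarrow> \<exists>U g h. open U \<and> p \<in> U \<and> cholomorphic_on g U \<and> cholomorphic_on h U \<and>
        U \<subseteq> closure {x\<in>U. h x \<noteq> 0} \<and> (\<forall>x\<in>U. h x \<noteq> 0 \<longrightarrow> f x = g x / h x)"
  shows "cmeromorphic_on f \<Omega>"
  using assms unfolding cmeromorphic_on_def by blast

lemma cholomorphic_imp_cmeromorphic_on:
  assumes "open \<Omega>" "cholomorphic_on f \<Omega>"
  shows "cmeromorphic_on f \<Omega>"
proof (rule cmeromorphic_onI)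
  fix p assume "p \<in> \<Omega>"
  moreover have "{x\<in>\<Omega>. (1::complex) \<noteq> 0} = \<Omega>" by simp
  ultimately show "\<exists>U g h. open U \<and> p \<in> U \<and> cholomorphic_on g U \<and> cholomorphic_on h U \<and>
        U \<subseteq> closure {x\<in>U. h x \<noteq> 0} \<and> (\<forall>x\<in>U. h x \<noteq> 0 \<longrightarrow> f x = g x / h x)"
    using assms closure_subset[of \<Omega>]
    by (intro local_fractionI[of \<Omega> p f "\<lambda>_. 1"]) auto
qed

lemma cmeromorphic_on_binop:
  fixes \<Omega> :: "(complex^'n) set"
  assumes \<Omega>: "open \<Omega>" and f: "cmeromorphic_on f1 \<Omega>" "cmeromorphic_on f2 \<Omega>"
    and num: "\<And>g1 h1 g2 h2 (U :: (complex^'n) set). cholomorphic_on g1 U \<Longrightarrow> cholomorphic_on h1 U \<Longrightarrow>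
      cholomorphic_on g2 U \<Longrightarrow> cholomorphic_on h2 U \<Longrightarrow> cholomorphic_on (\<lambda>x. num (g1 x) (h1 x) (g2 x) (h2 x)) U"
    and F: "\<And>x a b c d. b \<noteq> 0 \<Longrightarrow> d \<noteq> 0 \<Longrightarrow> f1 x = a / b \<Longrightarrow> f2 x = c / d \<Longrightarrow> F x = num a b c d / (b * d)"
  shows "cmeromorphic_on F \<Omega>"
proof (rule cmeromorphic_onI)
  fix p assume p: "p \<in> \<Omega>"
  obtain r1 g1 h1 where 1: "r1 > 0" "polydisc p r1 \<subseteq> \<Omega>"
    "cholomorphic_on g1 (polydisc p r1)" "cholomorphic_on h1 (polydisc p r1)"
    "polydisc p r1 \<subseteq> closure {x\<in>polydisc p r1. h1 x \<noteq> 0}"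
    "\<forall>x\<in>polydisc p r1. h1 x \<noteq> 0 \<longrightarrow> f1 x = g1 x / h1 x"
    by (rule cmeromorphic_onE[OF f(1) p \<Omega>])
  obtain r2 g2 h2 where 2: "r2 > 0" "polydisc p r2 \<subseteq> \<Omega>"
    "cholomorphic_on g2 (polydisc p r2)" "cholomorphic_on h2 (polydisc p r2)"
    "polydisc p r2 \<subseteq> closure {x\<in>polydisc p r2. h2 x \<noteq> 0}"
    "\<forall>x\<in>polydisc p r2. h2 x \<noteq> 0 \<longrightarrow> f2 x = g2 x / h2 x"
    by (rule cmeromorphic_onE[OF f(2) p \<Omega>])
  define U where "U = polydisc p r1 \<inter> polydisc p r2"
  have U: "open U" "p \<in> U" "U \<subseteq> polydisc p r1" "U \<subseteq> polydisc p r2"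
    using 1(1) 2(1) open_polydisc polydisc_centre by (auto simp: U_def)
  note hol = cholomorphic_on_subset[OF 1(3) U(3)] cholomorphic_on_subset[OF 1(4) U(3)]
    cholomorphic_on_subset[OF 2(3) U(4)] cholomorphic_on_subset[OF 2(4) U(4)]
  have "U \<subseteq> closure {x\<in>U. h1 x * h2 x \<noteq> 0}"
    by (intro nonvanishing_dense_mult U hol nonvanishing_dense_subset[OF open_polydisc 1(5)]
          nonvanishing_dense_subset[OF open_polydisc 2(5)])
  moreover have "F x = num (g1 x) (h1 x) (g2 x) (h2 x) / (h1 x * h2 x)"
    if "x \<in> U" "h1 x * h2 x \<noteq> 0" for x
    using that U 1(6) 2(6) by (intro F) auto
  ultimately show "\<exists>U g h. open U \<and> p \<in> U \<and> cholomorphic_on g U \<and> cholomorphic_on h U \<and>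
        U \<subseteq> closure {x\<in>U. h x \<noteq> 0} \<and> (\<forall>x\<in>U. h x \<noteq> 0 \<longrightarrow> F x = g x / h x)"
    by (intro local_fractionI[OF U(1,2) num[OF hol] cholomorphic_on_mult[OF hol(2,4)]]) auto
qed

lemma cmeromorphic_on_add:
  assumes "open \<Omega>" "cmeromorphic_on f \<Omega>" "cmeromorphic_on g \<Omega>"
  shows "cmeromorphic_on (\<lambda>x. f x + g x) \<Omega>"
  by (rule cmeromorphic_on_binop[OF assms, where num = "\<lambda>a b c d. a * d + c * b"])
     (intro cholomorphic_on_add cholomorphic_on_mult, assumption+, simp add: field_simps)

lemma cmeromorphic_on_mult:
  assumes "open \<Omega>" "cmeromorphic_on f \<Omega>" "cmeromorphic_on g \<Omega>"
  shows "cmeromorphic_on (\<lambda>x. f x * g x) \<Omega>"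
  by (rule cmeromorphic_on_binop[OF assms, where num = "\<lambda>a b c d. a * c"])
     (intro cholomorphic_on_mult, assumption+, simp)

lemma cmeromorphic_on_const: "open \<Omega> \<Longrightarrow> cmeromorphic_on (\<lambda>_. c) \<Omega>"
  by (simp add: cholomorphic_imp_cmeromorphic_on)

lemma cmeromorphic_on_uminus:
  assumes "open \<Omega>" "cmeromorphic_on f \<Omega>"
  shows "cmeromorphic_on (\<lambda>x. - f x) \<Omega>"
  using cmeromorphic_on_mult[OF assms(1) cmeromorphic_on_const[OF assms(1), of "-1"] assms(2)] by simp

lemma polydisc_dichotomy:
  assumes "cholomorphic_on g (polydisc p r)"
  shows "(\<forall>x\<in>polydisc p r. g x = 0) \<or> polydisc p r \<subseteq> closure {x\<in>polydisc p r. g x \<noteq> 0}"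
  unfolding nonvanishing_dense_iff[OF open_polydisc]
  using cholomorphic_polydisc_identity[OF assms] by blast

lemma cmeromorphic_on_inverse:
  assumes \<Omega>: "open \<Omega>" and f: "cmeromorphic_on f \<Omega>"
  shows "cmeromorphic_on (\<lambda>x. inverse (f x)) \<Omega>"
proof (rule cmeromorphic_onI)
  fix p assume p: "p \<in> \<Omega>"
  obtain r g h where gh: "r > 0" "polydisc p r \<subseteq> \<Omega>"
    "cholomorphic_on g (polydisc p r)" "cholomorphic_on h (polydisc p r)"
    "polydisc p r \<subseteq> closure {x\<in>polydisc p r. h x \<noteq> 0}"
    "\<forall>x\<in>polydisc p r. h x \<noteq> 0 \<longrightarrow> f x = g x / h x"
    by (rule cmeromorphic_onE[OF f p \<Omega>])
  let ?U = "polydisc p r"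
  show "\<exists>U g h. open U \<and> p \<in> U \<and> cholomorphic_on g U \<and> cholomorphic_on h U \<and>
        U \<subseteq> closure {x\<in>U. h x \<noteq> 0} \<and> (\<forall>x\<in>U. h x \<noteq> 0 \<longrightarrow> inverse (f x) = g x / h x)"
  proof (cases "\<forall>x\<in>?U. g x = 0")
    case True
    have "\<forall>x\<in>?U. h x \<noteq> 0 \<longrightarrow> inverse (f x) = 0 / h x"
      using True gh(6) by auto
    then show ?thesis
      by (rule local_fractionI[OF open_polydisc polydisc_centre[OF gh(1)] cholomorphic_on_const gh(4,5)])
  next
    case False
    then have "?U \<subseteq> closure {x\<in>?U. g x \<noteq> 0}" using polydisc_dichotomy[OF gh(3)] by blast
    then have "?U \<subseteq> closure {x\<in>?U. g x * h x \<noteq> 0}"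
      by (intro nonvanishing_dense_mult gh open_polydisc)
    moreover have "\<forall>x\<in>?U. g x * h x \<noteq> 0 \<longrightarrow> inverse (f x) = h x * h x / (g x * h x)"
      using gh(6) by auto
    ultimately show ?thesis
      by (rule local_fractionI[OF open_polydisc polydisc_centre[OF gh(1)]
            cholomorphic_on_mult[OF gh(4,4)] cholomorphic_on_mult[OF gh(3,4)]])
  qed
qed

lemma cmeromorphic_identity:
  assumes \<Omega>: "open \<Omega>" "connected \<Omega>" and f: "cmeromorphic_on f \<Omega>"
    and V: "open V" "V \<noteq> {}" "V \<subseteq> \<Omega>" "\<And>x. x \<in> V \<Longrightarrow> f x = 0"
  shows "generically \<Omega> (\<lambda>x. f x = 0)"
proof -
  let ?I = "interior {x. f x = 0}"
  let ?E = "\<Omega> \<inter> closure ?I"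
  have "open ?E"
  proof (rule Topological_Spaces.openI)
    fix p assume "p \<in> ?E"
    then have p: "p \<in> \<Omega>" "p \<in> closure ?I" by auto
    obtain r g h where gh: "r > 0" "polydisc p r \<subseteq> \<Omega>"
      "cholomorphic_on g (polydisc p r)" "cholomorphic_on h (polydisc p r)"
      "polydisc p r \<subseteq> closure {x\<in>polydisc p r. h x \<noteq> 0}"
      "\<forall>x\<in>polydisc p r. h x \<noteq> 0 \<longrightarrow> f x = g x / h x"
      by (rule cmeromorphic_onE[OF f p(1) \<Omega>(1)])
    let ?U = "polydisc p r"
    let ?W = "?U \<inter> ?I"
    have "?W \<noteq> {}"
      using p(2) open_polydisc polydisc_centre[OF gh(1)] open_Int_closure_eq_empty[OF open_polydisc, of p r ?I]
      by blast
    moreover have "open ?W" "?W \<subseteq> ?U" by (auto intro: open_polydisc)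
    ultimately have "\<exists>x\<in>?W. h x \<noteq> 0"
      using gh(5)[unfolded nonvanishing_dense_iff[OF open_polydisc], rule_format, of ?W] by simp
    then have ne: "{x\<in>?W. h x \<noteq> 0} \<noteq> {}" by blast
    have op: "open {x\<in>?W. h x \<noteq> 0}"
      by (rule open_nonvanishing[OF gh(4)]) (auto intro: open_polydisc)
    have z: "g x = 0" if "x \<in> {x\<in>?W. h x \<noteq> 0}" for x
      using that gh(6) interior_subset[of "{x. f x = 0}"] by auto
    have sub: "{x\<in>?W. h x \<noteq> 0} \<subseteq> ?U" by auto
    have g0: "g x = 0" if "x \<in> ?U" for x
      by (rule cholomorphic_polydisc_identity[OF gh(3) op ne sub z that])
    have "{x\<in>?U. h x \<noteq> 0} \<subseteq> ?I"
      by (rule interior_maximal) (use gh(6) g0 open_nonvanishing[OF gh(4) open_polydisc] in auto)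
    then have "?U \<subseteq> closure ?I" using gh(5) by (meson closure_mono order_trans)
    then have "?U \<subseteq> ?E" using gh(2) by simp
    then show "\<exists>T. open T \<and> p \<in> T \<and> T \<subseteq> ?E"
      using open_polydisc polydisc_centre[OF gh(1)] by (intro exI[of _ ?U] conjI)
  qed
  moreover from calculation have "openin (top_of_set \<Omega>) ?E"
    by (intro open_openin_trans \<Omega>(1) Int_lower1)
  moreover have "closedin (top_of_set \<Omega>) ?E"
    by (simp add: closedin_closed_Int)
  moreover have "?E \<noteq> {}"
  proof -
    have "V \<subseteq> ?I" using V by (intro interior_maximal) auto
    then show ?thesis using V closure_subset[of ?I] by blast
  qed
  ultimately have "?E = \<Omega>" using \<Omega>(2)[unfolded connected_clopen, rule_format, of ?E] by simp
  then show ?thesis unfolding generically_def by blast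
qed

lemma cmeromorphic_mult_inverse:
  assumes \<Omega>: "open \<Omega>" "connected \<Omega>" and f: "cmeromorphic_on f \<Omega>"
    and nz: "\<not> generically \<Omega> (\<lambda>x. f x = 0)"
  shows "generically \<Omega> (\<lambda>x. inverse (f x) * f x = 1)"
  unfolding generically_iff[OF \<Omega>(1)]
proof (intro allI impI)
  fix W assume W: "open W" "W \<noteq> {}" "W \<subseteq> \<Omega>"
  then obtain p where p: "p \<in> W" by blast
  then have p\<Omega>: "p \<in> W" "cmeromorphic_on f W"
    using W f unfolding cmeromorphic_on_def by blast+
  obtain r g h where gh: "r > 0" "polydisc p r \<subseteq> W"
    "cholomorphic_on g (polydisc p r)" "cholomorphic_on h (polydisc p r)"
    "polydisc p r \<subseteq> closure {x\<in>polydisc p r. h x \<noteq> 0}"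
    "\<forall>x\<in>polydisc p r. h x \<noteq> 0 \<longrightarrow> f x = g x / h x"
    by (rule cmeromorphic_onE[OF p\<Omega>(2,1) W(1)])
  let ?U = "polydisc p r"
  have ne: "?U \<noteq> {}" using polydisc_centre[OF gh(1)] by blast
  have "?U \<subseteq> closure {x\<in>?U. g x \<noteq> 0}"
  proof (rule ccontr)
    assume "\<not> ?thesis"
    then have "\<forall>x\<in>?U. g x = 0" using polydisc_dichotomy[OF gh(3)] by blast
    then have *: "f x = 0" if "x \<in> {x\<in>?U. h x \<noteq> 0}" for x using gh(6) that by auto
    have "{x\<in>?U. h x \<noteq> 0} \<noteq> {}"
      using gh(5) ne by (metis closure_empty subset_empty)
    with * nz show False
      using cmeromorphic_identity[OF \<Omega> f open_nonvanishing[OF gh(4) open_polydisc subset_refl]] gh(2) W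
      by blast
  qed
  then have "?U \<subseteq> closure {x\<in>?U. g x * h x \<noteq> 0}"
    by (intro nonvanishing_dense_mult gh open_polydisc)
  then have ne': "{x\<in>?U. g x * h x \<noteq> 0} \<noteq> {}" using ne by (metis closure_empty subset_empty)
  have "open {x\<in>?U. g x * h x \<noteq> 0}"
    by (rule open_nonvanishing[OF cholomorphic_on_mult[OF gh(3,4)] open_polydisc subset_refl])
  moreover have "\<forall>x\<in>{x\<in>?U. g x * h x \<noteq> 0}. inverse (f x) * f x = 1"
    using gh(6) by auto
  moreover have "{x\<in>?U. g x * h x \<noteq> 0} \<subseteq> W" using gh(2) by auto
  ultimately show "\<exists>V. open V \<and> V \<noteq> {} \<and> V \<subseteq> W \<and> (\<forall>x\<in>V. inverse (f x) * f x = 1)"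
    using ne' by (intro exI[of _ "{x\<in>?U. g x * h x \<noteq> 0}"] conjI)
qed

section \<open>The field of meromorphic functions and the shifts\<close>

datatype qvar = Va | Vb | Vc | Vq | Vz

lemma UNIV_qvar: "UNIV = {Va, Vb, Vc, Vq, Vz}"
  using qvar.exhaust by auto

instance qvar :: finite
  by standard (simp add: UNIV_qvar)

type_synonym qpoint = "complex^qvar"

definition qdomain :: "qpoint set" where
  "qdomain = {x. x $ Va \<noteq> 0 \<and> x $ Vb \<noteq> 0 \<and> x $ Vc \<noteq> 0 \<and> x $ Vz \<noteq> 0 \<and> x $ Vq \<noteq> 0 \<and> norm (x $ Vq) < 1}"

definition qdomain_coord :: "qvar \<Rightarrow> complex set" where
  "qdomain_coord i = (if i = Vq then ball 0 1 - {0} else - {0})"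

lemma qdomain_altdef: "x \<in> qdomain \<longleftrightarrow> (\<forall>i. x $ i \<in> qdomain_coord i)"
proof -
  have "(\<forall>i. P i) \<longleftrightarrow> P Va \<and> P Vb \<and> P Vc \<and> P Vq \<and> P Vz" for P
    by (metis qvar.exhaust)
  then show ?thesis by (auto simp: qdomain_def qdomain_coord_def)
qed

lemma open_qdomain: "open qdomain"
proof -
  have "qdomain = (\<Inter>i\<in>UNIV. (\<lambda>x. x $ i) -` qdomain_coord i)"
    by (auto simp: qdomain_altdef)
  moreover have "open (qdomain_coord i)" for i
    by (auto simp: qdomain_coord_def)
  then have "open (\<Inter>i\<in>UNIV. (\<lambda>x::qpoint. x $ i) -` qdomain_coord i)"
    by (intro open_INT finite ballI open_vimage continuous_on_component continuous_on_id)
  ultimately show ?thesis by simp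
qed

lemma connected_qdomain: "connected qdomain"
proof (rule path_connected_imp_connected, unfold path_connected_def, intro ballI)
  fix x y assume xy: "x \<in> qdomain" "y \<in> qdomain"
  have "path_connected (qdomain_coord i)" for i
    by (auto simp: qdomain_coord_def path_connected_punctured_universe path_connected_punctured_ball)
  then have "\<exists>g. path g \<and> path_image g \<subseteq> qdomain_coord i \<and> pathstart g = x $ i \<and> pathfinish g = y $ i" for i
    using xy unfolding path_connected_def qdomain_altdef by blast
  then obtain g where g: "\<And>i. path (g i)" "\<And>i. path_image (g i) \<subseteq> qdomain_coord i"
    "\<And>i. pathstart (g i) = x $ i" "\<And>i. pathfinish (g i) = y $ i" by metis
  define G where "G = (\<lambda>t. \<chi> i. g i t)"
  have "path G"
    using g(1) unfolding path_def G_def by (intro continuous_on_vec_lambda) auto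
  moreover have "path_image G \<subseteq> qdomain"
    using g(2) by (fastforce simp: path_image_def qdomain_altdef G_def image_subset_iff)
  moreover have "pathstart G = x" "pathfinish G = y"
    using g(3,4) by (auto simp: pathstart_def pathfinish_def G_def vec_eq_iff)
  ultimately show "\<exists>g. path g \<and> path_image g \<subseteq> qdomain \<and> pathstart g = x \<and> pathfinish g = y"
    by blast
qed

lemma qdomain_nonempty: "qdomain \<noteq> {}"
proof -
  have "(\<chi> i. 1 / 2) \<in> qdomain" by (simp add: qdomain_def)
  then show ?thesis by blast
qed

definition mero_rel :: "(qpoint \<Rightarrow> complex) \<Rightarrow> (qpoint \<Rightarrow> complex) \<Rightarrow> bool" where
  "mero_rel f g \<longleftrightarrow> cmeromorphic_on f qdomain \<and> cmeromorphic_on g qdomain \<and>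
     generically qdomain (\<lambda>x. f x = g x)"

lemma generically_qdomain_conj:
  "generically qdomain P \<Longrightarrow> generically qdomain Q \<Longrightarrow> (\<And>x. P x \<Longrightarrow> Q x \<Longrightarrow> R x) \<Longrightarrow> generically qdomain R"
  using generically_mono[OF generically_conj[OF open_qdomain]] by blast

quotient_type mero = "qpoint \<Rightarrow> complex" / partial: mero_rel
proof (rule part_equivpI)
  show "\<exists>f. mero_rel f f"
    by (rule exI[of _ "\<lambda>_. 0"])
       (simp add: mero_rel_def cmeromorphic_on_const open_qdomain generically_True)
  show "symp mero_rel"
    by (rule sympI) (auto simp: mero_rel_def eq_commute)
  show "transp mero_rel"
  proof (rule transpI)
    fix f g h assume "mero_rel f g" "mero_rel g h"
    then show "mero_rel f h"
      unfolding mero_rel_def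
      by (auto intro: generically_qdomain_conj[of "\<lambda>x. f x = g x" "\<lambda>x. g x = h x"])
  qed
qed

lemma mero_rel_refl_iff: "mero_rel f f \<longleftrightarrow> cmeromorphic_on f qdomain"
  by (simp add: mero_rel_def generically_True)

instantiation mero :: field
begin

lift_definition zero_mero :: mero is "\<lambda>_. 0"
  by (simp add: mero_rel_refl_iff cmeromorphic_on_const open_qdomain)

lift_definition one_mero :: mero is "\<lambda>_. 1"
  by (simp add: mero_rel_refl_iff cmeromorphic_on_const open_qdomain)

lift_definition plus_mero :: "mero \<Rightarrow> mero \<Rightarrow> mero" is "\<lambda>f g x. f x + g x"
  unfolding mero_rel_def
  by (intro conjI cmeromorphic_on_add open_qdomain; (elim conjE, assumption)?)
     (elim conjE, rule generically_qdomain_conj, assumption+, simp)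

lift_definition times_mero :: "mero \<Rightarrow> mero \<Rightarrow> mero" is "\<lambda>f g x. f x * g x"
  unfolding mero_rel_def
  by (intro conjI cmeromorphic_on_mult open_qdomain; (elim conjE, assumption)?)
     (elim conjE, rule generically_qdomain_conj, assumption+, simp)

lift_definition uminus_mero :: "mero \<Rightarrow> mero" is "\<lambda>f x. - f x"
  unfolding mero_rel_def
  by (intro conjI cmeromorphic_on_uminus open_qdomain; (elim conjE, assumption)?)
     (elim conjE, rule generically_mono, assumption, simp)

lift_definition inverse_mero :: "mero \<Rightarrow> mero" is "\<lambda>f x. inverse (f x)"
  unfolding mero_rel_def
  by (intro conjI cmeromorphic_on_inverse open_qdomain; (elim conjE, assumption)?)
     (elim conjE, rule generically_mono, assumption, simp)

definition "f - g = f + - g" for f g :: mero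

definition "f div g = f * inverse g" for f g :: mero

lemma mero_relI:
  "mero_rel f f \<Longrightarrow> (\<And>x. f x = g x) \<Longrightarrow> mero_rel f g"
  using ext[of f g] by metis

instance
proof
  fix f g h :: mero
  show "f + g + h = f + (g + h)"
    by transfer (simp add: mero_rel_refl_iff cmeromorphic_on_add open_qdomain add.assoc)
  show "f + g = g + f"
    by transfer (simp add: mero_rel_refl_iff cmeromorphic_on_add open_qdomain add.commute)
  show "0 + f = f"
    by transfer (simp add: mero_rel_refl_iff)
  show "- f + f = 0"
    by transfer (simp add: mero_rel_refl_iff cmeromorphic_on_const open_qdomain)
  show "f - g = f + - g" by (fact minus_mero_def)
  show "f * g * h = f * (g * h)"
    by transfer (simp add: mero_rel_refl_iff cmeromorphic_on_mult open_qdomain mult.assoc)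
  show "f * g = g * f"
    by transfer (simp add: mero_rel_refl_iff cmeromorphic_on_mult open_qdomain mult.commute)
  show "1 * f = f"
    by transfer (simp add: mero_rel_refl_iff)
  show "(f + g) * h = f * h + g * h"
    by transfer (simp add: mero_rel_refl_iff cmeromorphic_on_mult cmeromorphic_on_add open_qdomain distrib_right)
  show "(0::mero) \<noteq> 1"
  proof transfer
    show "\<not> mero_rel (\<lambda>_. 0) (\<lambda>_. 1)"
      using qdomain_nonempty by (simp add: mero_rel_def generically_def)
  qed
  show "f div g = f * inverse g" by (fact divide_mero_def)
  show "inverse (0::mero) = 0"
    by transfer (simp add: mero_rel_refl_iff cmeromorphic_on_const open_qdomain)
  show "f \<noteq> 0 \<Longrightarrow> inverse f * f = 1"
  proof transfer
    fix f assume f: "mero_rel f f" and "\<not> mero_rel f (\<lambda>_. 0)"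
    then have "\<not> generically qdomain (\<lambda>x. f x = 0)"
      by (auto simp: mero_rel_def cmeromorphic_on_const open_qdomain)
    then show "mero_rel (\<lambda>x. inverse (f x) * f x) (\<lambda>_. 1)"
      using f cmeromorphic_mult_inverse[OF open_qdomain connected_qdomain, of f]
      by (simp add: mero_rel_def cmeromorphic_on_const cmeromorphic_on_mult cmeromorphic_on_inverse open_qdomain)
  qed
qed

end

lift_definition mero_const :: "complex \<Rightarrow> mero" is "\<lambda>k _. k"
  by (simp add: mero_rel_refl_iff cmeromorphic_on_const open_qdomain)

lift_definition mero_var :: "qvar \<Rightarrow> mero" is "\<lambda>i x. x $ i"
  by (simp add: mero_rel_refl_iff cholomorphic_imp_cmeromorphic_on open_qdomain cholomorphic_on_nth)

text \<open>The group \<open>N\<close>, with \<open>(ka, kb, kc, kz)\<close> standing for \<open>M\<close> with these four indices;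
  it acts on meromorphic functions by \<open>mero_shift\<close> below.\<close>

type_synonym qshift = "int \<times> int \<times> int \<times> int"

fun shift_exponent :: "qshift \<Rightarrow> qvar \<Rightarrow> int" where
  "shift_exponent (ka, kb, kc, kz) Va = ka"
| "shift_exponent (ka, kb, kc, kz) Vb = kb"
| "shift_exponent (ka, kb, kc, kz) Vc = kc"
| "shift_exponent (ka, kb, kc, kz) Vq = 0"
| "shift_exponent (ka, kb, kc, kz) Vz = kz"

definition shift_point :: "qshift \<Rightarrow> qpoint \<Rightarrow> qpoint" where
  "shift_point k x = (\<chi> i. x $ i * (x $ Vq) powi (shift_exponent k i))"

lemma shift_exponent_simps [simp]:
  "shift_exponent 0 i = 0" "shift_exponent (k + l) i = shift_exponent k i + shift_exponent l i"
  "shift_exponent (- k) i = - shift_exponent k i" "shift_exponent k Vq = 0"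
  by (cases k; cases l; cases i; simp add: zero_prod_def)+

lemma shift_point_0 [simp]: "shift_point 0 x = x"
  by (simp add: shift_point_def vec_eq_iff)

lemma shift_point_add: "x \<in> qdomain \<Longrightarrow> shift_point k (shift_point l x) = shift_point (k + l) x"
  by (simp add: shift_point_def vec_eq_iff power_int_add qdomain_def)

lemma shift_point_in_qdomain: "x \<in> qdomain \<Longrightarrow> shift_point k x \<in> qdomain"
  by (simp add: shift_point_def qdomain_def)

lemma cholomorphic_on_powi: "cholomorphic_on (\<lambda>x. (x $ Vq) powi n) qdomain"
proof -
  have "(\<lambda>t. t powi n) holomorphic_on - {0}"
    by (intro holomorphic_intros) auto
  then show ?thesis
    by (rule cholomorphic_on_holomorphic_compose[OF _ _ cholomorphic_on_nth]) (auto simp: qdomain_def)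
qed

lemma cholomorphic_on_shift_point: "cholomorphic_on (\<lambda>x. shift_point k x $ i) qdomain"
  using cholomorphic_on_mult[OF cholomorphic_on_nth cholomorphic_on_powi]
  by (simp add: shift_point_def)

lemma continuous_on_shift_point: "continuous_on qdomain (shift_point k)"
proof -
  have "continuous_on qdomain (\<lambda>x. \<chi> i. shift_point k x $ i)"
    by (intro continuous_on_vec_lambda cholomorphic_on_imp_continuous_on cholomorphic_on_shift_point)
  then show ?thesis by simp
qed

lemma open_shift_preimage: "open W \<Longrightarrow> open {x\<in>qdomain. shift_point k x \<in> W}"
  using continuous_open_preimage[OF continuous_on_shift_point open_qdomain, of W k]
  by (simp add: vimage_def Int_def)

lemma dense_shift:
  assumes "\<And>W. open W \<Longrightarrow> W \<noteq> {} \<Longrightarrow> W \<subseteq> U \<Longrightarrow> \<exists>V. open V \<and> V \<noteq> {} \<and> V \<subseteq> W \<and> (\<forall>x\<in>V. P x)"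
    and W: "open W" "W \<noteq> {}" "W \<subseteq> {x\<in>qdomain. shift_point k x \<in> U}"
  shows "\<exists>V. open V \<and> V \<noteq> {} \<and> V \<subseteq> W \<and> (\<forall>x\<in>V. P (shift_point k x))"
proof -
  let ?W = "{y\<in>qdomain. shift_point (-k) y \<in> W}"
  have inv1: "shift_point k (shift_point (-k) y) = y" if "y \<in> qdomain" for y
    using shift_point_add[OF that, of k "-k"] by simp
  have inv2: "shift_point (-k) (shift_point k y) = y" if "y \<in> qdomain" for y
    using shift_point_add[OF that, of "-k" k] by simp
  obtain w where w: "w \<in> W" using W by blast
  with W have wq: "w \<in> qdomain" by blast
  have "shift_point k w \<in> ?W" using w inv2[OF wq] shift_point_in_qdomain[OF wq, of k] by simp
  then have ne: "?W \<noteq> {}" by blast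
  have "?W \<subseteq> U"
  proof
    fix y assume y: "y \<in> ?W"
    then have "shift_point k (shift_point (-k) y) \<in> U" using W by blast
    then show "y \<in> U" using y inv1[of y] by simp
  qed
  then obtain V where V: "open V" "V \<noteq> {}" "V \<subseteq> ?W" "\<forall>x\<in>V. P x"
    using assms(1)[OF open_shift_preimage[OF W(1)] ne] by auto
  let ?V = "{x\<in>qdomain. shift_point k x \<in> V}"
  obtain v where v: "v \<in> V" using V by blast
  with V have vq: "v \<in> qdomain" by blast
  have "shift_point (-k) v \<in> ?V" using v inv1[OF vq] shift_point_in_qdomain[OF vq, of "-k"] by simp
  moreover have "?V \<subseteq> W"
  proof
    fix x assume x: "x \<in> ?V"
    then have "shift_point (-k) (shift_point k x) \<in> W" using V by blast
    then show "x \<in> W" using x inv2[of x] by simp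
  qed
  ultimately show ?thesis
    using V(4) open_shift_preimage[OF V(1), of k] by (intro exI[of _ ?V] conjI) blast+
qed

lemma generically_shift:
  assumes "generically qdomain P"
  shows "generically qdomain (\<lambda>x. P (shift_point k x))"
  unfolding generically_iff[OF open_qdomain]
proof (intro allI impI)
  fix W assume W: "open W" "W \<noteq> {}" "W \<subseteq> qdomain"
  show "\<exists>V. open V \<and> V \<noteq> {} \<and> V \<subseteq> W \<and> (\<forall>x\<in>V. P (shift_point k x))"
  proof (rule dense_shift[of qdomain])
    show "W \<subseteq> {x \<in> qdomain. shift_point k x \<in> qdomain}"
      using W shift_point_in_qdomain by blast
  qed (use W assms[unfolded generically_iff[OF open_qdomain]] in blast)+
qed

lemma cmeromorphic_on_shift:
  assumes f: "cmeromorphic_on f qdomain"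
  shows "cmeromorphic_on (\<lambda>x. f (shift_point k x)) qdomain"
proof (rule cmeromorphic_onI)
  fix p assume p: "p \<in> qdomain"
  obtain r g h where gh: "r > 0" "polydisc (shift_point k p) r \<subseteq> qdomain"
      "cholomorphic_on g (polydisc (shift_point k p) r)" "cholomorphic_on h (polydisc (shift_point k p) r)"
      "polydisc (shift_point k p) r \<subseteq> closure {x\<in>polydisc (shift_point k p) r. h x \<noteq> 0}"
      "\<forall>x\<in>polydisc (shift_point k p) r. h x \<noteq> 0 \<longrightarrow> f x = g x / h x"
    by (rule cmeromorphic_onE[OF f shift_point_in_qdomain[OF p] open_qdomain])
  let ?U = "polydisc (shift_point k p) r"
  let ?V = "{x\<in>qdomain. shift_point k x \<in> ?U}"
  have V: "open ?V" by (rule open_shift_preimage[OF open_polydisc])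
  have hol: "cholomorphic_on (\<lambda>x. u (shift_point k x)) ?V" if "cholomorphic_on u ?U" for u
    by (rule cholomorphic_on_compose[OF cholomorphic_on_subset[OF cholomorphic_on_shift_point] that]) auto
  have dense: "?V \<subseteq> closure {x\<in>?V. h (shift_point k x) \<noteq> 0}"
    unfolding nonvanishing_dense_iff[OF V]
  proof (intro allI impI)
    fix W assume W: "open W" "W \<noteq> {}" "W \<subseteq> ?V"
    have "\<exists>V. open V \<and> V \<noteq> {} \<and> V \<subseteq> W \<and> (\<forall>x\<in>V. h (shift_point k x) \<noteq> 0)"
    proof (rule dense_shift[OF _ W])
      fix W' assume W': "open W'" "W' \<noteq> {}" "W' \<subseteq> ?U"
      have "\<exists>x\<in>W'. h x \<noteq> 0"
        by (rule gh(5)[unfolded nonvanishing_dense_iff[OF open_polydisc], rule_format, OF W'])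
      then show "\<exists>V. open V \<and> V \<noteq> {} \<and> V \<subseteq> W' \<and> (\<forall>x\<in>V. h x \<noteq> 0)"
        using open_nonvanishing[OF gh(4) W'(1,3)] by (intro exI[of _ "{x\<in>W'. h x \<noteq> 0}"]) auto
    qed
    then show "\<exists>x\<in>W. h (shift_point k x) \<noteq> 0" by auto
  qed
  show "\<exists>U g h. open U \<and> p \<in> U \<and> cholomorphic_on g U \<and> cholomorphic_on h U \<and>
        U \<subseteq> closure {x\<in>U. h x \<noteq> 0} \<and> (\<forall>x\<in>U. h x \<noteq> 0 \<longrightarrow> f (shift_point k x) = g x / h x)"
    by (rule local_fractionI[OF V _ hol[OF gh(3)] hol[OF gh(4)] dense])
       (use p polydisc_centre[OF gh(1)] gh(6) in auto)
qed

lift_definition mero_shift :: "qshift \<Rightarrow> mero \<Rightarrow> mero" is "\<lambda>k f x. f (shift_point k x)"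
  unfolding mero_rel_def
  by (intro conjI cmeromorphic_on_shift; (elim conjE, assumption)?) (elim conjE, rule generically_shift)

lemma generically_qdomainI: "(\<And>x. x \<in> qdomain \<Longrightarrow> P x) \<Longrightarrow> generically qdomain P"
  unfolding generically_iff[OF open_qdomain] by blast

lemma mero_shift_0 [simp]: "mero_shift 0 f = f"
  by transfer (simp add: mero_rel_refl_iff)

lemma mero_shift_shift: "mero_shift k (mero_shift l f) = mero_shift (k + l) f"
proof transfer
  fix k l f assume "mero_rel f f"
  then have f: "cmeromorphic_on f qdomain" by (simp only: mero_rel_refl_iff)
  show "mero_rel (\<lambda>x. f (shift_point l (shift_point k x))) (\<lambda>x. f (shift_point (k + l) x))"
    unfolding mero_rel_def
  proof (intro conjI generically_qdomainI)
    fix x assume "x \<in> qdomain"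
    then show "f (shift_point l (shift_point k x)) = f (shift_point (k + l) x)"
      by (simp only: shift_point_add add.commute[of k l])
  qed (intro cmeromorphic_on_shift f cmeromorphic_on_shift[of "\<lambda>x. f (shift_point l x)"])+
qed

lemma mero_shift_add [simp]: "mero_shift k (f + g) = mero_shift k f + mero_shift k g"
  by transfer (simp add: mero_rel_refl_iff cmeromorphic_on_shift cmeromorphic_on_add open_qdomain)

lemma mero_shift_mult [simp]: "mero_shift k (f * g) = mero_shift k f * mero_shift k g"
  by transfer (simp add: mero_rel_refl_iff cmeromorphic_on_shift cmeromorphic_on_mult open_qdomain)

lemma mero_shift_inverse [simp]: "mero_shift k (inverse f) = inverse (mero_shift k f)"
  by transfer (simp add: mero_rel_refl_iff cmeromorphic_on_shift cmeromorphic_on_inverse open_qdomain)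

lemma mero_shift_const [simp]: "mero_shift k (mero_const r) = mero_const r"
  by transfer (simp add: mero_rel_refl_iff cmeromorphic_on_const open_qdomain)

lemma mero_const_simps: "mero_const 0 = 0" "mero_const 1 = 1" "mero_const (- r) = - mero_const r"
  by (transfer, simp add: mero_rel_refl_iff cmeromorphic_on_const open_qdomain)+

lift_definition mero_qpow :: "int \<Rightarrow> mero" is "\<lambda>n x. (x $ Vq) powi n"
  by (simp add: mero_rel_refl_iff cholomorphic_imp_cmeromorphic_on open_qdomain cholomorphic_on_powi)

lemma mero_qpow_nat: "mero_qpow (int n) = mero_var Vq ^ n"
proof (induction n)
  case 0
  show ?case
    by simp (transfer, simp add: mero_rel_refl_iff cmeromorphic_on_const open_qdomain)
next
  case (Suc n)
  have "mero_qpow (1 + int n) = mero_var Vq * mero_qpow (int n)"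
  proof transfer
    fix n
    have "(x $ Vq) powi (1 + int n) = x $ Vq * (x $ Vq) powi int n" if "x \<in> qdomain" for x
      using that by (simp add: power_int_add qdomain_def)
    then show "mero_rel (\<lambda>x. (x $ Vq) powi (1 + int n)) (\<lambda>x. x $ Vq * (x $ Vq) powi int n)"
      unfolding mero_rel_def
      by (intro conjI cmeromorphic_on_mult open_qdomain cholomorphic_imp_cmeromorphic_on
            cholomorphic_on_nth cholomorphic_on_powi generically_qdomainI)
  qed
  with Suc show ?case by simp
qed

lemma mero_qpow_eq: "mero_qpow n = mero_var Vq powi n"
proof (cases n)
  case (nonneg m)
  then show ?thesis by (simp add: mero_qpow_nat)
next
  case (neg m)
  have "mero_qpow (- k) = inverse (mero_qpow k)" for k
    by transfer
       (simp add: mero_rel_refl_iff power_int_minus cmeromorphic_on_inverse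
         open_qdomain cholomorphic_imp_cmeromorphic_on cholomorphic_on_powi)
  then have "mero_qpow (- int (Suc m)) = inverse (mero_var Vq ^ Suc m)"
    by (simp only: mero_qpow_nat)
  then show ?thesis
    by (simp only: neg power_int_minus power_int_of_nat)
qed

lemma mero_shift_var:
  "mero_shift k (mero_var i) = mero_var i * mero_var Vq powi shift_exponent k i"
  unfolding mero_qpow_eq[symmetric]
  by transfer
     (simp add: shift_point_def mero_rel_refl_iff cmeromorphic_on_mult open_qdomain
       cholomorphic_imp_cmeromorphic_on cholomorphic_on_nth cholomorphic_on_powi)

section \<open>Rational functions and q-difference operators\<close>

text \<open>The field \<open>C(a, b, c, q, z)\<close>: the subfield of \<^typ>\<open>mero\<close> generated by the constants and
  the coordinate functions.\<close>

inductive_set rational_functions :: "mero set" where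
  const: "mero_const k \<in> rational_functions"
| var: "mero_var i \<in> rational_functions"
| add: "f \<in> rational_functions \<Longrightarrow> g \<in> rational_functions \<Longrightarrow> f + g \<in> rational_functions"
| mult: "f \<in> rational_functions \<Longrightarrow> g \<in> rational_functions \<Longrightarrow> f * g \<in> rational_functions"
| inverse: "f \<in> rational_functions \<Longrightarrow> inverse f \<in> rational_functions"

lemma rational_functions_0: "0 \<in> rational_functions"
  using rational_functions.const[of 0] by (simp add: mero_const_simps)

lemma rational_functions_1: "1 \<in> rational_functions"
  using rational_functions.const[of 1] by (simp add: mero_const_simps)

lemma rational_functions_uminus: "f \<in> rational_functions \<Longrightarrow> - f \<in> rational_functions"
  using rational_functions.mult[OF rational_functions.const[of "-1"]]
  by (simp add: mero_const_simps)

lemma rational_functions_power: "f \<in> rational_functions \<Longrightarrow> f ^ n \<in> rational_functions"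
  by (induction n) (auto intro: rational_functions.mult rational_functions_1)

lemma rational_functions_powi: "f \<in> rational_functions \<Longrightarrow> f powi n \<in> rational_functions"
  by (auto simp: power_int_def intro: rational_functions_power rational_functions.inverse)

lemma rational_functions_shift:
  "f \<in> rational_functions \<Longrightarrow> mero_shift k f \<in> rational_functions"
  by (induction rule: rational_functions.induct)
     (simp_all add: mero_shift_var rational_functions.intros rational_functions_powi)

typedef ratfun = rational_functions
  morphisms mero_of_ratfun Abs_ratfun
  using rational_functions_0 by blast

setup_lifting type_definition_ratfun

instantiation ratfun :: field
begin

lift_definition zero_ratfun :: ratfun is 0 by (fact rational_functions_0)
lift_definition one_ratfun :: ratfun is 1 by (fact rational_functions_1)
lift_definition plus_ratfun :: "ratfun \<Rightarrow> ratfun \<Rightarrow> ratfun" is "(+)" by (fact rational_functions.add)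
lift_definition times_ratfun :: "ratfun \<Rightarrow> ratfun \<Rightarrow> ratfun" is "(*)" by (fact rational_functions.mult)
lift_definition uminus_ratfun :: "ratfun \<Rightarrow> ratfun" is uminus by (fact rational_functions_uminus)
lift_definition inverse_ratfun :: "ratfun \<Rightarrow> ratfun" is inverse by (fact rational_functions.inverse)
definition "r - s = r + - s" for r s :: ratfun
definition "r div s = r * inverse s" for r s :: ratfun

instance
proof
  fix r s t :: ratfun
  show "r + s + t = r + (s + t)" "r + s = s + r" "0 + r = r" "- r + r = 0"
    "r * s * t = r * (s * t)" "r * s = s * r" "1 * r = r" "(r + s) * t = r * t + s * t"
    by (simp_all add: mero_of_ratfun_inject[symmetric] plus_ratfun.rep_eq times_ratfun.rep_eq
        zero_ratfun.rep_eq one_ratfun.rep_eq uminus_ratfun.rep_eq algebra_simps)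
  show "(0::ratfun) \<noteq> 1" "inverse (0::ratfun) = 0" "r \<noteq> 0 \<Longrightarrow> inverse r * r = 1"
    by (simp_all add: mero_of_ratfun_inject[symmetric] times_ratfun.rep_eq
        zero_ratfun.rep_eq one_ratfun.rep_eq inverse_ratfun.rep_eq)
qed (simp_all add: minus_ratfun_def divide_ratfun_def)

end

lift_definition ratfun_var :: "qvar \<Rightarrow> ratfun" is mero_var by (fact rational_functions.var)

lift_definition ratfun_shift :: "qshift \<Rightarrow> ratfun \<Rightarrow> ratfun" is mero_shift
  by (fact rational_functions_shift)

lemma mero_shift_0_right [simp]: "mero_shift k 0 = 0"
  using mero_shift_const[of k 0] by (simp add: mero_const_simps)

lemma mero_shift_1 [simp]: "mero_shift k 1 = 1"
  using mero_shift_const[of k 1] by (simp add: mero_const_simps)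

lemma ratfun_shift_simps [simp]:
  "ratfun_shift 0 r = r" "ratfun_shift k 0 = 0" "ratfun_shift k 1 = 1"
  "ratfun_shift k (r + s) = ratfun_shift k r + ratfun_shift k s"
  "ratfun_shift k (r * s) = ratfun_shift k r * ratfun_shift k s"
  "ratfun_shift k (ratfun_shift l r) = ratfun_shift (k + l) r"
  by (simp_all add: mero_of_ratfun_inject[symmetric] plus_ratfun.rep_eq times_ratfun.rep_eq
      zero_ratfun.rep_eq one_ratfun.rep_eq ratfun_shift.rep_eq mero_shift_shift)

text \<open>The smash product of \<^typ>\<open>ratfun\<close> with the group \<open>N\<close>: a finite sum of terms \<open>r\<^sub>k P\<^sub>k\<close> is
  stored as the finitely supported function \<open>P\<^sub>k \<mapsto> r\<^sub>k\<close>. A type of its own is needed because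
  \<^typ>\<open>qshift \<Rightarrow>\<^sub>0 ratfun\<close> already carries the untwisted multiplication.\<close>

typedef qdo = "UNIV :: (qshift \<Rightarrow>\<^sub>0 ratfun) set"
  morphisms qdo_coeffs Qdo ..

setup_lifting type_definition_qdo

definition smash_mult ::
  "(qshift \<Rightarrow>\<^sub>0 ratfun) \<Rightarrow> (qshift \<Rightarrow>\<^sub>0 ratfun) \<Rightarrow> (qshift \<Rightarrow>\<^sub>0 ratfun)" where
  "smash_mult D E = (\<Sum>k\<in>Poly_Mapping.keys D. \<Sum>j\<in>Poly_Mapping.keys E.
     Poly_Mapping.single (k + j)
       (Poly_Mapping.lookup D k * ratfun_shift k (Poly_Mapping.lookup E j)))"

lemma smash_mult_add_left: "smash_mult (D + D') E = smash_mult D E + smash_mult D' E"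
  unfolding smash_mult_def
  by (rule setsum_keys_plus_distrib) (simp_all add: distrib_right single_add sum.distrib)

lemma smash_mult_add_right: "smash_mult D (E + E') = smash_mult D E + smash_mult D E'"
proof -
  have "(\<Sum>j\<in>Poly_Mapping.keys (E + E'). Poly_Mapping.single (k + j)
       (Poly_Mapping.lookup D k * ratfun_shift k (Poly_Mapping.lookup (E + E') j))) =
     (\<Sum>j\<in>Poly_Mapping.keys E. Poly_Mapping.single (k + j)
       (Poly_Mapping.lookup D k * ratfun_shift k (Poly_Mapping.lookup E j))) +
     (\<Sum>j\<in>Poly_Mapping.keys E'. Poly_Mapping.single (k + j)
       (Poly_Mapping.lookup D k * ratfun_shift k (Poly_Mapping.lookup E' j)))" for k
    by (rule setsum_keys_plus_distrib) (simp_all add: distrib_left single_add)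
  then show ?thesis
    unfolding smash_mult_def by (simp add: sum.distrib)
qed

lemma smash_mult_0 [simp]: "smash_mult 0 E = 0" "smash_mult D 0 = 0"
  by (simp_all add: smash_mult_def)

lemma smash_mult_single:
  "smash_mult (Poly_Mapping.single k r) (Poly_Mapping.single j s) =
     Poly_Mapping.single (k + j) (r * ratfun_shift k s)"
  by (cases "r = 0"; cases "s = 0") (simp_all add: smash_mult_def)

lemma poly_mapping_additive_induct [case_names zero single add]:
  assumes "P 0" "\<And>k r. P (Poly_Mapping.single k r)" "\<And>D E. P D \<Longrightarrow> P E \<Longrightarrow> P (D + E)"
  shows "P (D :: 'a \<Rightarrow>\<^sub>0 'b::comm_monoid_add)"
proof (induction D rule: update_induct)
  case (update D k r)
  then have "Poly_Mapping.update k r D = D + Poly_Mapping.single k r"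
    by (intro poly_mapping_eqI)
       (auto simp: lookup_update lookup_add lookup_single when_def in_keys_iff)
  with update assms show ?case by simp
qed (use assms in auto)

lemma smash_mult_assoc: "smash_mult (smash_mult D E) F = smash_mult D (smash_mult E F)"
proof (induction D rule: poly_mapping_additive_induct)
  case (single k r)
  show ?case
  proof (induction E rule: poly_mapping_additive_induct)
    case (single j s)
    show ?case
      by (induction F rule: poly_mapping_additive_induct)
         (simp_all add: smash_mult_single smash_mult_add_right add.assoc mult.assoc)
  qed (simp_all add: smash_mult_add_left smash_mult_add_right)
qed (simp_all add: smash_mult_add_left)

lemma smash_mult_1:
  "smash_mult (Poly_Mapping.single 0 1) D = D" "smash_mult D (Poly_Mapping.single 0 1) = D"
proof -
  show "smash_mult (Poly_Mapping.single 0 1) D = D"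
    by (induction D rule: poly_mapping_additive_induct)
       (simp_all add: smash_mult_single smash_mult_add_right del: single_one)
  show "smash_mult D (Poly_Mapping.single 0 1) = D"
    by (induction D rule: poly_mapping_additive_induct)
       (simp_all add: smash_mult_single smash_mult_add_left del: single_one)
qed

instantiation qdo :: ring_1
begin

lift_definition zero_qdo :: qdo is 0 .
lift_definition one_qdo :: qdo is "Poly_Mapping.single 0 1" .
lift_definition plus_qdo :: "qdo \<Rightarrow> qdo \<Rightarrow> qdo" is "(+)" .
lift_definition minus_qdo :: "qdo \<Rightarrow> qdo \<Rightarrow> qdo" is "(-)" .
lift_definition uminus_qdo :: "qdo \<Rightarrow> qdo" is uminus .
lift_definition times_qdo :: "qdo \<Rightarrow> qdo \<Rightarrow> qdo" is smash_mult .

instance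
proof
  show "(0::qdo) \<noteq> 1" by transfer (metis lookup_single_eq lookup_zero zero_neq_one)
qed (transfer; simp add: smash_mult_assoc smash_mult_1 smash_mult_add_left smash_mult_add_right algebra_simps del: single_one)+

end

definition qdo_monom :: "ratfun \<Rightarrow> qshift \<Rightarrow> qdo" where
  "qdo_monom r k = Qdo (Poly_Mapping.single k r)"

lemma qdo_coeffs_monom: "qdo_coeffs (qdo_monom r k) = Poly_Mapping.single k r"
  by (simp add: qdo_monom_def Qdo_inverse)

lemma qdo_monom_mult: "qdo_monom r k * qdo_monom s j = qdo_monom (r * ratfun_shift k s) (k + j)"
  by (simp add: qdo_monom_def times_qdo.abs_eq smash_mult_single)

definition qdo_act :: "qdo \<Rightarrow> mero \<Rightarrow> mero" where
  "qdo_act D F = (\<Sum>k\<in>Poly_Mapping.keys (qdo_coeffs D).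
     mero_of_ratfun (Poly_Mapping.lookup (qdo_coeffs D) k) * mero_shift k F)"

lemma qdo_act_add_left: "qdo_act (D + E) F = qdo_act D F + qdo_act E F"
  unfolding qdo_act_def plus_qdo.rep_eq
  by (rule setsum_keys_plus_distrib) (simp_all add: distrib_right zero_ratfun.rep_eq plus_ratfun.rep_eq)

lemma qdo_act_add_right: "qdo_act D (F + G) = qdo_act D F + qdo_act D G"
  by (simp add: qdo_act_def distrib_left sum.distrib)

lemma qdo_act_0: "qdo_act 0 F = 0"
  by (simp add: qdo_act_def zero_qdo.rep_eq)

lemma qdo_act_monom: "qdo_act (qdo_monom r k) F = mero_of_ratfun r * mero_shift k F"
  by (cases "r = 0") (simp_all add: qdo_act_def qdo_coeffs_monom zero_ratfun.rep_eq)

lemma qdo_additive_induct [case_names zero monom add]: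
  assumes "P 0" "\<And>r k. P (qdo_monom r k)" "\<And>D E. P D \<Longrightarrow> P E \<Longrightarrow> P (D + E)"
  shows "P D"
proof -
  have "P (Qdo d)" for d
  proof (induction d rule: poly_mapping_additive_induct)
    case zero
    then show ?case using assms(1) by (simp add: zero_qdo.abs_eq)
  next
    case (single k r)
    then show ?case using assms(2) by (simp add: flip: qdo_monom_def)
  next
    case (add d e)
    then show ?case using assms(3)[of "Qdo d" "Qdo e"] by (simp add: plus_qdo.abs_eq)
  qed
  from this[of "qdo_coeffs D"] show ?thesis by (simp add: qdo_coeffs_inverse)
qed

lemma qdo_act_mult: "qdo_act (D * E) F = qdo_act D (qdo_act E F)"
proof (induction D rule: qdo_additive_induct)
  case (monom r k)
  show ?case
  proof (induction E rule: qdo_additive_induct)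
    case (monom s j)
    show ?case
      by (simp add: qdo_monom_mult qdo_act_monom times_ratfun.rep_eq ratfun_shift.rep_eq
          mero_shift_shift mult.assoc)
  qed (simp_all add: distrib_left qdo_act_add_left qdo_act_add_right qdo_act_0 qdo_act_monom)
qed (simp_all add: distrib_right qdo_act_add_left qdo_act_0)

definition left_ideal :: "'r::ring_1 set \<Rightarrow> bool" where
  "left_ideal J \<longleftrightarrow> 0 \<in> J \<and> (\<forall>x\<in>J. \<forall>y\<in>J. x + y \<in> J) \<and> (\<forall>r. \<forall>x\<in>J. r * x \<in> J)"

lemma left_ideal_hull: "left_ideal (left_ideal hull S)"
  by (rule hull_in) (auto simp: left_ideal_def)

definition annihilator :: "mero \<Rightarrow> qdo set" where
  "annihilator F = {D. qdo_act D F = 0}"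

lemma left_ideal_annihilator: "left_ideal (annihilator F)"
  by (auto simp: left_ideal_def annihilator_def qdo_act_0 qdo_act_add_left qdo_act_mult qdo_act_def[of _ 0])

section \<open>The basic hypergeometric function\<close>

definition qpochhammer_inf :: "complex \<Rightarrow> complex \<Rightarrow> complex" where
  "qpochhammer_inf x q = prodinf (\<lambda>j. 1 - x * q ^ j)"

text \<open>For a nonnegative index the quotient \<open>(x;q)\<^sub>\<infinity> / (xq\<^sup>k;q)\<^sub>\<infinity>\<close> is this finite product; unlike the
  quotient, it is also meaningful when both infinite products vanish.\<close>

definition qpochhammer :: "complex \<Rightarrow> complex \<Rightarrow> nat \<Rightarrow> complex" where
  "qpochhammer x q k = (\<Prod>j<k. 1 - x * q ^ j)"

lemma qpochhammer_eq_quotient: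
  assumes "norm q < 1" "\<And>j. x * q ^ j \<noteq> 1"
  shows "qpochhammer x q k = qpochhammer_inf x q / qpochhammer_inf (x * q ^ k) q"
proof -
  have conv: "convergent_prod (\<lambda>j. 1 - y * q ^ j)" for y
  proof (intro abs_convergent_prod_imp_convergent_prod summable_imp_abs_convergent_prod)
    have "summable (\<lambda>j. norm y * norm q ^ j)"
      using assms(1) by (intro summable_mult summable_geometric) auto
    then show "summable (\<lambda>j. norm (1 - y * q ^ j - 1))" by (simp add: norm_mult norm_power)
  qed
  have nz: "1 - x * q ^ j \<noteq> 0" for j using assms(2)[of j] by simp
  have "qpochhammer_inf x q = prodinf (\<lambda>j. 1 - x * q ^ (j + k)) * qpochhammer x q k"
    unfolding qpochhammer_inf_def qpochhammer_def
    by (rule prodinf_split_initial_segment[OF conv nz])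
  also have "prodinf (\<lambda>j. 1 - x * q ^ (j + k)) = qpochhammer_inf (x * q ^ k) q"
    by (simp add: qpochhammer_inf_def power_add mult_ac)
  finally have "qpochhammer_inf x q = qpochhammer_inf (x * q ^ k) q * qpochhammer x q k" .
  moreover have "qpochhammer_inf (x * q ^ k) q \<noteq> 0"
    unfolding qpochhammer_inf_def
    using conv[of "x * q ^ k"] nz[of "k + _"] by (intro prodinf_nonzero) (auto simp: power_add mult_ac)
  ultimately show ?thesis by simp
qed

definition phi21_series :: "complex \<Rightarrow> complex \<Rightarrow> complex \<Rightarrow> complex \<Rightarrow> complex \<Rightarrow> complex" where
  "phi21_series a b c q z =
     (suminf (\<lambda>k. qpochhammer a q k * qpochhammer b q k / (qpochhammer q q k * qpochhammer c q k) * z ^ k))"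

text \<open>The series makes sense for \<open>|z| < 1\<close> as long as no denominator \<open>(c;q)\<^sub>k\<close> vanishes.\<close>

definition continues_phi21 :: "mero \<Rightarrow> bool" where
  "continues_phi21 F \<longleftrightarrow> (\<exists>f. cmeromorphic_on f qdomain \<and> F = abs_mero f \<and>
     (\<forall>x\<in>qdomain. norm (x $ Vz) < 1 \<longrightarrow> (\<forall>k. x $ Vc * (x $ Vq) ^ k \<noteq> 1) \<longrightarrow>
        f x = phi21_series (x $ Va) (x $ Vb) (x $ Vc) (x $ Vq) (x $ Vz)))"

text \<open>The meromorphic continuation; it is unique by \<open>continues_phi21_unique\<close> below.\<close>

definition phi21 :: mero where
  "phi21 = (THE F. continues_phi21 F)"

lemma continues_phi21_unique:
  assumes "continues_phi21 F" "continues_phi21 G"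
  shows "F = G"
proof -
  obtain f g where f: "cmeromorphic_on f qdomain" "F = abs_mero f"
    "\<And>x. x\<in>qdomain \<Longrightarrow> norm (x $ Vz) < 1 \<Longrightarrow> (\<And>k. x $ Vc * (x $ Vq) ^ k \<noteq> 1) \<Longrightarrow>
        f x = phi21_series (x $ Va) (x $ Vb) (x $ Vc) (x $ Vq) (x $ Vz)"
    and g: "cmeromorphic_on g qdomain" "G = abs_mero g"
    "\<And>x. x\<in>qdomain \<Longrightarrow> norm (x $ Vz) < 1 \<Longrightarrow> (\<And>k. x $ Vc * (x $ Vq) ^ k \<noteq> 1) \<Longrightarrow>
        g x = phi21_series (x $ Va) (x $ Vb) (x $ Vc) (x $ Vq) (x $ Vz)"
    using assms unfolding continues_phi21_def by blast
  let ?V = "qdomain \<inter> {x. norm (x $ Vz) < 1} \<inter> {x. norm (x $ Vc) < 1}"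
  have "open ?V"
    by (intro open_Int open_qdomain open_Collect_less continuous_intros continuous_on_component)
  moreover have "(\<chi> i. 1 / 2) \<in> ?V" by (simp add: qdomain_def)
  then have "?V \<noteq> {}" by blast
  moreover have "f x + - g x = 0" if x: "x \<in> ?V" for x
  proof -
    have "x $ Vc * (x $ Vq) ^ k \<noteq> 1" for k
    proof -
      have "norm (x $ Vq) ^ k \<le> 1" using x by (intro power_le_one) (auto simp: qdomain_def)
      then have "norm (x $ Vc) * norm (x $ Vq) ^ k \<le> norm (x $ Vc) * 1" by (intro mult_left_mono) auto
      also have "\<dots> < 1" using x by simp
      finally have "norm (x $ Vc * (x $ Vq) ^ k) < 1" by (simp add: norm_mult norm_power)
      then show ?thesis by (metis norm_one less_irrefl)
    qed
    then show ?thesis using x f(3)[of x] g(3)[of x] by simp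
  qed
  moreover have "cmeromorphic_on (\<lambda>x. f x + - g x) qdomain"
    by (intro cmeromorphic_on_add cmeromorphic_on_uminus open_qdomain f g)
  ultimately have "generically qdomain (\<lambda>x. f x + - g x = 0)"
    by (intro cmeromorphic_identity[OF open_qdomain connected_qdomain, of _ ?V]) auto
  then have "mero_rel f g" using f g by (simp add: mero_rel_def)
  then show ?thesis unfolding f g by (metis Quotient3_mero Quotient3_rel)
qed

section \<open>The operators\<close>

abbreviation op_a :: qdo ("\<a>") where "\<a> \<equiv> qdo_monom (ratfun_var Va) 0"
abbreviation op_b :: qdo ("\<b>") where "\<b> \<equiv> qdo_monom (ratfun_var Vb) 0"
abbreviation op_c :: qdo ("\<c>") where "\<c> \<equiv> qdo_monom (ratfun_var Vc) 0"
abbreviation op_q :: qdo ("\<q>") where "\<q> \<equiv> qdo_monom (ratfun_var Vq) 0"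
abbreviation op_z :: qdo ("\<z>") where "\<z> \<equiv> qdo_monom (ratfun_var Vz) 0"

abbreviation op_M :: "int \<Rightarrow> int \<Rightarrow> int \<Rightarrow> int \<Rightarrow> qdo" where
  "op_M ka kb kc kz \<equiv> qdo_monom 1 (ka, kb, kc, kz)"

abbreviation op_A :: qdo ("\<A>") where "\<A> \<equiv> op_M 1 0 0 0"
abbreviation op_B :: qdo ("\<B>") where "\<B> \<equiv> op_M 0 1 0 0"
abbreviation op_C :: qdo ("\<C>") where "\<C> \<equiv> op_M 0 0 1 0"
abbreviation op_Z :: qdo ("\<Z>") where "\<Z> \<equiv> op_M 0 0 0 1"
abbreviation op_A_inv :: qdo ("\<A>\<inverse>") where "\<A>\<inverse> \<equiv> op_M (-1) 0 0 0"
abbreviation op_B_inv :: qdo ("\<B>\<inverse>") where "\<B>\<inverse> \<equiv> op_M 0 (-1) 0 0"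
abbreviation op_C_inv :: qdo ("\<C>\<inverse>") where "\<C>\<inverse> \<equiv> op_M 0 0 (-1) 0"
abbreviation op_Z_inv :: qdo ("\<Z>\<inverse>") where "\<Z>\<inverse> \<equiv> op_M 0 0 0 (-1)"

definition P_a :: qdo where
  "P_a = (1 - \<a>) * \<A> - 1 + \<a> * \<Z>"

definition P_b :: qdo where
  "P_b = (1 - \<b>) * \<B> - 1 + \<b> * \<Z>"

definition P_c :: qdo where
  "P_c = \<z> * (\<c> - \<b>) * (\<c> - \<a>) * \<C>
     + (\<c> - 1) * (\<c>^2 + \<a> * \<b> * \<z> - (\<a> + \<b>) * \<c> * \<z>)
     - (\<c> - 1) * \<c> * (\<c> - \<a> * \<b> * \<z>) * \<Z>"

definition Q_a :: qdo where
  "Q_a = (- \<c> * \<q> + \<a> * \<c> + \<a> * \<q> - \<a>^2 * \<z>)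
     + \<a> * (\<a> * \<b> * \<z> - \<c>) * \<Z> + \<q> * (\<c> - \<a>) * \<A>\<inverse>"

definition Q_b :: qdo where
  "Q_b = (- \<c> * \<q> + \<b> * \<c> + \<b> * \<q> - \<b>^2 * \<z>)
     + \<b> * (\<a> * \<b> * \<z> - \<c>) * \<Z> + \<q> * (\<c> - \<b>) * \<B>\<inverse>"

definition Q_c :: qdo where
  "Q_c = - \<q> + \<c> * \<Z> + (\<q> - \<c>) * \<C>\<inverse>"

definition R_z :: qdo where
  "R_z = - (\<c> + \<q> - \<a> * \<z> - \<b> * \<z>) + (\<q> - \<z>) * \<Z>\<inverse> + (\<c> - \<a> * \<b> * \<z>) * \<Z>"

end

theory Submission
  imports Defs
begin

text \<open>
  Modulo the seven operators every operator is congruent to some \<open>r + s Z\<close> with rational \<open>r\<close>, \<open>s\<close>: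
  the operator \<open>R\<^sub>z\<close> expresses \<open>Z\<^sup>2\<close> and the inverse of \<open>Z\<close> through \<open>1\<close> and \<open>Z\<close>, and each of the other
  six does so for one of \<open>A\<close>, \<open>B\<close>, \<open>C\<close> and their inverses. Hence the quotient of the ring by the left ideal
  that they generate is spanned over the rational functions by the classes of \<open>1\<close> and \<open>Z\<close>
  (\<open>first_order_mod_eq_UNIV\<close>). As all seven annihilate \<open>\<phi>\<close>, an operator in the annihilator has a
  remainder \<open>r + s Z\<close> in the annihilator, and the theorem amounts to the linear independence of \<open>\<phi>(z)\<close> and
  \<open>\<phi>(qz)\<close> over the rational functions (\<open>phi21_independent\<close>).

  For the independence, clear denominators in \<open>r \<phi>(z) + s \<phi>(qz) = 0\<close> and compare coefficients of powers
  of \<open>z\<close>. Let \<open>\<rho>\<^sub>i\<close> and \<open>\<sigma>\<^sub>i\<close> be the coefficients of \<open>r\<close> and \<open>s\<close>, polynomials in \<open>c\<close>, and suppose that those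
  of smaller index vanish. For \<open>k \<ge> 1\<close> the coefficient of \<open>z\<^sup>k\<close> in \<open>\<phi>\<close> has a pole at \<open>c = q\<^bsup>1-k\<^esup>\<close> which no
  earlier coefficient has, so \<open>\<rho>\<^sub>i + q\<^sup>k \<sigma>\<^sub>i\<close> vanishes there; for \<open>k = 0\<close> one gets \<open>\<rho>\<^sub>i + \<sigma>\<^sub>i = 0\<close> identically. Thus
  \<open>\<sigma>\<^sub>i\<close> has infinitely many zeros (\<open>no_polynomial_relation\<close>).

  That the seven operators annihilate \<open>\<phi>\<close> is a comparison of coefficients on an open set on which the series
  converges, extended by the identity theorem. It presupposes that the meromorphic continuation exists.
  Multiplied by \<open>(c;q)\<^sub>\<infinity> (q;q)\<^sub>\<infinity>\<close> the series has no poles in \<open>c\<close>; multiplied also by \<open>(z;q)\<^sub>\<infinity>\<close> it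
  satisfies a recurrence \<open>h(z) = \<alpha> h(qz) - \<beta> h(q\<^sup>2z)\<close> in which \<open>\<alpha>\<close> and \<open>\<beta>\<close> are polynomials
  in \<open>z\<close>, and which therefore extends it holomorphically from \<open>|z| < 1\<close> to all \<open>z\<close> (\<open>phi21_eq\<close>).
\<close>

section \<open>Series of holomorphic functions of several variables\<close>

lemma norm_vector_smult: "norm (t *s (v :: complex^'n)) = norm t * norm v"
proof -
  have "norm (t *s v) = L2_set (\<lambda>i. norm t * norm (v $ i)) UNIV"
    by (simp add: norm_vec_def norm_mult)
  also have "\<dots> = norm t * norm v"
    by (simp add: norm_vec_def L2_set_right_distrib)
  finally show ?thesis .
qed

text \<open>Cauchy's estimate on the complex line through \<open>x\<close> in direction \<open>v\<close>: the disc of radius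
  \<open>r / (4 |v|)\<close> in the line parameter stays inside the ball.\<close>

lemma cholomorphic_derivative_bound:
  fixes f :: "complex^'n \<Rightarrow> complex"
  assumes f: "cholomorphic_on f (ball p r)" and M: "\<And>x. x \<in> ball p r \<Longrightarrow> norm (f x) \<le> M"
    and x: "x \<in> ball p (r / 2)" and r: "r > 0"
    and D: "(f has_derivative f') (at x)" and lin: "\<And>t v. f' (t *s v) = t * f' v"
  shows "norm (f' v) \<le> M * (4 / r) * norm v"
proof (cases "v = 0")
  case True
  then show ?thesis using lin[of 0 0] by simp
next
  case False
  define s where "s = r / (4 * norm v)"
  have s: "s > 0" using r False by (simp add: s_def)
  have inb: "x + t *s v \<in> ball p r" if "norm t \<le> s" for t
  proof -
    have "norm t * norm v \<le> s * norm v" by (intro mult_right_mono that) auto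
    also have "\<dots> = r / 4" using False by (simp add: s_def)
    finally have "norm (t *s v) \<le> r / 4" by (simp add: norm_vector_smult)
    moreover have "dist p (x + t *s v) \<le> dist p x + norm (t *s v)"
      by (metis dist_add_cancel dist_triangle add.right_neutral dist_0_norm)
    ultimately show ?thesis using x r by simp
  qed
  have lv: "bounded_linear (\<lambda>t. t *s v)"
    unfolding linear_conv_bounded_linear[symmetric]
    by (rule linearI) (auto simp: vec_eq_iff algebra_simps)
  have der: "((\<lambda>t. f (x + t *s v)) has_field_derivative f'' v) (at t)"
    if "(f has_derivative f'') (at (x + t *s v))" "\<And>t v. f'' (t *s v) = t * f'' v" for t f''
  proof -
    have "((\<lambda>t. x + t *s v) has_derivative (\<lambda>t. t *s v)) (at t)"
      using has_derivative_add[OF has_derivative_const bounded_linear_imp_has_derivative[OF lv], of x] by simp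
    from diff_chain_at[OF this that(1)] show ?thesis
      unfolding has_field_derivative_def by (simp add: o_def that(2) mult_commute_abs)
  qed
  have fd: "(\<lambda>t. f (x + t *s v)) field_differentiable at t" if t: "norm t \<le> s" for t
  proof -
    obtain f'' where "(f has_derivative f'') (at (x + t *s v))" "\<forall>t v. f'' (t *s v) = t * f'' v"
      using f inb[OF t] unfolding cholomorphic_on_def by blast
    with der[of f'' t] show ?thesis unfolding field_differentiable_def by blast
  qed
  have hol: "(\<lambda>t. f (x + t *s v)) holomorphic_on cball 0 s"
    unfolding holomorphic_on_def using fd by (auto intro: field_differentiable_at_within)
  have "norm ((deriv ^^ 1) (\<lambda>t. f (x + t *s v)) 0) \<le> fact 1 * M / s ^ 1"
  proof (rule Cauchy_inequality)
    show "(\<lambda>t. f (x + t *s v)) holomorphic_on ball 0 s"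
      using hol ball_subset_cball by (rule holomorphic_on_subset)
    show "continuous_on (cball 0 s) (\<lambda>t. f (x + t *s v))"
      using hol by (rule holomorphic_on_imp_continuous_on)
    show "norm (f (x + t *s v)) \<le> M" if "norm (0 - t) = s" for t
      using that by (intro M inb) auto
  qed (use s in auto)
  moreover have "deriv (\<lambda>t. f (x + t *s v)) 0 = f' v"
    by (rule DERIV_imp_deriv[OF der]) (use D lin in auto)
  ultimately show ?thesis using r False by (simp add: s_def field_simps)
qed

text \<open>Weierstrass' theorem. By Cauchy's estimate the summable bounds for the terms are, up to a factor, also
  bounds for their derivatives, so the series may be differentiated term by term.\<close>

lemma cholomorphic_on_suminf:
  fixes f :: "nat \<Rightarrow> complex^'n \<Rightarrow> complex"
  assumes hol: "\<And>k. cholomorphic_on (f k) U"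
    and M: "\<And>p. p \<in> U \<Longrightarrow> \<exists>r>0. ball p r \<subseteq> U \<and>
      (\<exists>M. summable M \<and> (\<forall>k. \<forall>x\<in>ball p r. norm (f k x) \<le> M k))"
  shows "cholomorphic_on (\<lambda>x. suminf (\<lambda>k. f k x)) U"
  unfolding cholomorphic_on_def
proof
  fix p assume p: "p \<in> U"
  obtain r M where r: "r > 0" "ball p r \<subseteq> U" and M: "summable M"
    "\<And>k x. x\<in>ball p r \<Longrightarrow> norm (f k x) \<le> M k"
    using M[OF p] by blast
  let ?S = "ball p (r / 2)"
  have SU: "?S \<subseteq> U" using r by (intro order.trans[OF subset_ball r(2)]) auto
  have "\<forall>k. \<forall>x\<in>U. \<exists>f'. (f k has_derivative f') (at x) \<and> (\<forall>t v. f' (t *s v) = t * f' v)"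
    using hol unfolding cholomorphic_on_def by blast
  then obtain f' where D: "\<And>k x. x \<in> U \<Longrightarrow> (f k has_derivative f' k x) (at x)"
    and lin: "\<And>k x t v. x \<in> U \<Longrightarrow> f' k x (t *s v) = t * f' k x v"
    by metis
  define K where "K = 4 / r"
  have K: "K > 0" using r by (simp add: K_def)
  have bd: "norm (f' k x v) \<le> M k * K * norm v" if "x \<in> ?S" for k x v
    unfolding K_def
    by (rule cholomorphic_derivative_bound[OF cholomorphic_on_subset[OF hol r(2)] M(2) that r(1) D lin])
       (use that SU in auto)
  have sM: "summable (\<lambda>k. M k * c)" for c using M(1) by (rule summable_mult2)
  have sf': "summable (\<lambda>k. f' k x v)" if "x \<in> ?S" for x v
    by (rule summable_comparison_test'[OF sM, of 0 _ "K * norm v"]) (use bd[OF that] in \<open>auto simp: mult.assoc\<close>)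
  define g' where "g' x v = (suminf (\<lambda>k. f' k x v))" for x v
  have "\<exists>g. \<forall>x\<in>?S. (\<lambda>k. f k x) sums g x \<and> (g has_derivative g' x) (at x within ?S)"
  proof (rule has_derivative_series)
    fix k x assume "x \<in> ?S"
    then show "(f k has_derivative f' k x) (at x within ?S)" using D SU by (blast intro: has_derivative_at_withinI)
  next
    fix e :: real assume e: "e > 0"
    have "\<forall>\<^sub>F n in sequentially. dist (\<Sum>k<n. M k) (suminf M) < e / K"
      using summable_LIMSEQ[OF M(1)] e K by (intro tendstoD) auto
    then show "\<forall>\<^sub>F n in sequentially. \<forall>x\<in>?S. \<forall>h. norm ((\<Sum>i<n. f' i x h) - g' x h) \<le> e * norm h"
    proof (rule eventually_mono, intro ballI allI)
      fix n x h assume n: "dist (\<Sum>k<n. M k) (suminf M) < e / K" and x: "x \<in> ?S"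
      have "(\<Sum>i<n. f' i x h) - g' x h = - (suminf (\<lambda>i. f' (i + n) x h))"
        unfolding g'_def using suminf_split_initial_segment[OF sf'[OF x, of h], of n] by simp
      also have "norm \<dots> \<le> (suminf (\<lambda>i. M (i + n) * (K * norm h)))"
        unfolding norm_minus_cancel
        by (rule norm_suminf_le[OF _ summable_ignore_initial_segment[OF sM]])
           (use bd[OF x] in \<open>auto simp: mult.assoc\<close>)
      also have "\<dots> = (suminf (\<lambda>i. M (i + n))) * (K * norm h)"
        by (rule suminf_mult2[symmetric]) (rule summable_ignore_initial_segment[OF M(1)])
      also have "(suminf (\<lambda>i. M (i + n))) = suminf M - (\<Sum>k<n. M k)"
        using suminf_split_initial_segment[OF M(1), of n] by simp
      also have "(suminf M - (\<Sum>k<n. M k)) * (K * norm h) \<le> (e / K) * (K * norm h)"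
        using n K by (intro mult_right_mono) (auto simp: dist_norm)
      finally show "norm ((\<Sum>i<n. f' i x h) - g' x h) \<le> e * norm h" using K by simp
    qed
  next
    show "p \<in> ?S" using r by simp
    show "(\<lambda>k. f k p) sums (suminf (\<lambda>k. f k p))"
      by (rule summable_sums[OF summable_comparison_test'[OF M(1), of 0]]) (use M(2) r in auto)
  qed auto
  then obtain g where g: "\<And>x. x \<in> ?S \<Longrightarrow> (\<lambda>k. f k x) sums g x"
    "\<And>x. x \<in> ?S \<Longrightarrow> (g has_derivative g' x) (at x within ?S)" by blast
  have pS: "p \<in> ?S" using r by simp
  have "(g has_derivative g' p) (at p)"
    using g(2)[OF pS] at_within_open[OF pS open_ball] by simp
  then have "((\<lambda>x. suminf (\<lambda>k. f k x)) has_derivative g' p) (at p)"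
    by (rule has_derivative_transform_within_open[OF _ open_ball pS]) (use g(1) sums_unique in blast)
  moreover have "g' p (t *s v) = t * g' p v" for t v
    unfolding g'_def lin[OF p] by (rule suminf_mult[OF sf'[OF pS]])
  ultimately show "\<exists>f'. ((\<lambda>x. suminf (\<lambda>k. f k x)) has_derivative f') (at p) \<and> (\<forall>t v. f' (t *s v) = t * f' v)"
    by blast
qed

lemma cholomorphic_on_uminus: "cholomorphic_on f U \<Longrightarrow> cholomorphic_on (\<lambda>x. - f x) U"
  using cholomorphic_on_mult[OF cholomorphic_on_const[of "-1"]] by simp

lemma cholomorphic_on_diff:
  "cholomorphic_on f U \<Longrightarrow> cholomorphic_on g U \<Longrightarrow> cholomorphic_on (\<lambda>x. f x - g x) U"
  using cholomorphic_on_add[OF _ cholomorphic_on_uminus] by simp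

lemma cholomorphic_on_power: "cholomorphic_on f U \<Longrightarrow> cholomorphic_on (\<lambda>x. f x ^ n) U"
  by (induction n) (auto intro: cholomorphic_on_mult)

lemma cholomorphic_on_prod:
  "(\<And>i. i \<in> I \<Longrightarrow> cholomorphic_on (f i) U) \<Longrightarrow> cholomorphic_on (\<lambda>x. \<Prod>i\<in>I. f i x) U"
  by (induction I rule: infinite_finite_induct) (auto intro: cholomorphic_on_mult)

lemma cholomorphic_on_divide:
  assumes "cholomorphic_on f U" "cholomorphic_on g U" "\<And>x. x \<in> U \<Longrightarrow> g x \<noteq> 0"
  shows "cholomorphic_on (\<lambda>x. f x / g x) U"
proof -
  have "inverse holomorphic_on (- {0 :: complex})"
    by (rule holomorphic_on_inverse[OF holomorphic_on_ident]) auto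
  then have "cholomorphic_on (\<lambda>x. inverse (g x)) U"
    by (rule cholomorphic_on_holomorphic_compose[OF _ _ assms(2)]) (use assms(3) in auto)
  then show ?thesis
    unfolding divide_inverse by (rule cholomorphic_on_mult[OF assms(1)])
qed

lemma cholomorphic_on_cong_open:
  assumes f: "cholomorphic_on f U" and U: "open U" and eq: "\<And>x. x \<in> U \<Longrightarrow> g x = f x"
  shows "cholomorphic_on g U"
  unfolding cholomorphic_on_def
proof
  fix x assume x: "x \<in> U"
  then obtain f' where f': "(f has_derivative f') (at x)" "\<forall>t v. f' (t *s v) = t * f' v"
    using f unfolding cholomorphic_on_def by blast
  have "(g has_derivative f') (at x)"
    by (rule has_derivative_transform_within_open[OF f'(1) U x]) (simp add: eq)
  with f' show "\<exists>f'. (g has_derivative f') (at x) \<and> (\<forall>t v. f' (t *s v) = t * f' v)" by blast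
qed

lemmas cholomorphic_intros = cholomorphic_on_const cholomorphic_on_nth cholomorphic_on_add
  cholomorphic_on_diff cholomorphic_on_mult cholomorphic_on_power cholomorphic_on_prod

section \<open>Infinite q-shifted factorials\<close>

lemma qpochhammer_0 [simp]: "qpochhammer x q 0 = 1"
  by (simp add: qpochhammer_def)

lemma qpochhammer_Suc: "qpochhammer x q (Suc k) = qpochhammer x q k * (1 - x * q ^ k)"
  by (simp add: qpochhammer_def)

lemma qpochhammer_Suc_shift: "qpochhammer x q (Suc k) = (1 - x) * qpochhammer (x * q) q k"
  unfolding qpochhammer_def prod.lessThan_Suc_shift by (simp add: mult.assoc)

lemma convergent_prod_qpochhammer:
  assumes "norm q < 1"
  shows "convergent_prod (\<lambda>j. 1 - x * q ^ j :: complex)"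
proof (intro abs_convergent_prod_imp_convergent_prod summable_imp_abs_convergent_prod)
  have "summable (\<lambda>j. norm x * norm q ^ j)"
    using assms by (intro summable_mult summable_geometric) auto
  then show "summable (\<lambda>j. norm (1 - x * q ^ j - 1))" by (simp add: norm_mult norm_power)
qed

lemma qpochhammer_inf_LIMSEQ:
  assumes "norm q < 1"
  shows "qpochhammer x q \<longlonglongrightarrow> qpochhammer_inf x q"
  using convergent_prod_LIMSEQ[OF convergent_prod_qpochhammer[OF assms, of x]]
  unfolding qpochhammer_inf_def qpochhammer_def[abs_def]
  by (subst LIMSEQ_lessThan_iff_atMost)

lemma qpochhammer_inf_step:
  assumes "norm q < 1"
  shows "qpochhammer_inf x q = (1 - x) * qpochhammer_inf (x * q) q"
proof (rule LIMSEQ_unique)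
  show "(\<lambda>k. qpochhammer x q (Suc k)) \<longlonglongrightarrow> qpochhammer_inf x q"
    using qpochhammer_inf_LIMSEQ[OF assms] by (rule LIMSEQ_Suc)
  show "(\<lambda>k. qpochhammer x q (Suc k)) \<longlonglongrightarrow> (1 - x) * qpochhammer_inf (x * q) q"
    unfolding qpochhammer_Suc_shift
    by (intro tendsto_mult tendsto_const qpochhammer_inf_LIMSEQ assms)
qed

lemma qpochhammer_inf_split:
  assumes "norm q < 1"
  shows "qpochhammer_inf x q = qpochhammer x q k * qpochhammer_inf (x * q ^ k) q"
proof (induction k)
  case (Suc k)
  then show ?case
    using qpochhammer_inf_step[OF assms, of "x * q ^ k"] by (simp add: qpochhammer_Suc mult_ac)
qed simp

lemma qpochhammer_inf_nonzero:
  assumes "norm q < 1" "\<And>j. x * q ^ j \<noteq> 1"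
  shows "qpochhammer_inf x q \<noteq> 0"
  unfolding qpochhammer_inf_def
  by (rule prodinf_nonzero[OF convergent_prod_qpochhammer[OF assms(1)]]) (metis assms(2) eq_iff_diff_eq_0)

text \<open>Each factor is at most \<open>exp (R \<rho>\<^sup>j)\<close>, and the exponents form a geometric series. The bound is uniform
  in \<open>k\<close>, \<open>x\<close> and \<open>q\<close>, as the convergence tests require.\<close>

lemma norm_qpochhammer_le:
  assumes "norm x \<le> R" "norm q \<le> \<rho>" "\<rho> < 1"
  shows "norm (qpochhammer x q k) \<le> exp (R / (1 - \<rho>))"
proof -
  have R: "0 \<le> R" "0 \<le> \<rho>" using assms norm_ge_zero order_trans by blast+
  have "norm (qpochhammer x q k) = (\<Prod>j<k. norm (1 - x * q ^ j))"
    by (simp add: qpochhammer_def prod_norm)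
  also have "\<dots> \<le> (\<Prod>j<k. exp (R * \<rho> ^ j))"
  proof (intro prod_mono conjI norm_ge_zero)
    fix j
    have "norm (1 - x * q ^ j) \<le> 1 + norm x * norm q ^ j"
      by (metis norm_mult norm_power norm_triangle_ineq4 norm_one)
    also have "\<dots> \<le> 1 + R * \<rho> ^ j"
      using assms R by (intro add_left_mono mult_mono power_mono) auto
    also have "\<dots> \<le> exp (R * \<rho> ^ j)" by (rule exp_ge_add_one_self)
    finally show "norm (1 - x * q ^ j) \<le> exp (R * \<rho> ^ j)" .
  qed
  also have "\<dots> = exp (\<Sum>j<k. R * \<rho> ^ j)" by (simp add: exp_sum)
  also have "\<dots> \<le> exp (R / (1 - \<rho>))"
  proof -
    have sm: "(\<lambda>j. R * \<rho> ^ j) sums (R * (1 / (1 - \<rho>)))"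
      using R assms by (intro sums_mult geometric_sums) auto
    have "(\<Sum>j<k. R * \<rho> ^ j) \<le> (suminf (\<lambda>j. R * \<rho> ^ j))"
      using R by (intro sum_le_suminf sums_summable[OF sm]) auto
    also have "\<dots> = R / (1 - \<rho>)" using sums_unique[OF sm] by simp
    finally show ?thesis by simp
  qed
  finally show ?thesis .
qed

lemma norm_qpochhammer_inf_le:
  assumes "norm x \<le> R" "norm q \<le> \<rho>" "\<rho> < 1"
  shows "norm (qpochhammer_inf x q) \<le> exp (R / (1 - \<rho>))"
proof -
  have "(\<lambda>k. norm (qpochhammer x q k)) \<longlonglongrightarrow> norm (qpochhammer_inf x q)"
    using assms by (intro tendsto_norm qpochhammer_inf_LIMSEQ) auto
  then show ?thesis
    by (rule Lim_bounded[where M = 0]) (use norm_qpochhammer_le[OF assms] in auto)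
qed

text \<open>Telescoping the partial products turns the infinite product into a series, so that its holomorphy in
  both arguments together follows from the theorem for series.\<close>

lemma qpochhammer_inf_eq_suminf:
  assumes "norm q < 1"
  shows "qpochhammer_inf x q = 1 + (suminf (\<lambda>k. - (qpochhammer x q k * (x * q ^ k))))"
proof -
  have "(\<lambda>k. qpochhammer x q (Suc k) - qpochhammer x q k) sums (qpochhammer_inf x q - qpochhammer x q 0)"
    by (rule telescope_sums[OF qpochhammer_inf_LIMSEQ[OF assms]])
  then have "(\<lambda>k. - (qpochhammer x q k * (x * q ^ k))) sums (qpochhammer_inf x q - 1)"
    by (simp add: qpochhammer_Suc algebra_simps)
  note eq = sums_unique[OF this, symmetric]
  show ?thesis unfolding eq by simp
qed

lemma local_norm_bound:
  fixes u :: "'a::metric_space \<Rightarrow> complex"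
  assumes "continuous_on U u" "open U" "p \<in> U" "norm (u p) < B"
  obtains r where "r > 0" "ball p r \<subseteq> U" "\<And>x. x \<in> ball p r \<Longrightarrow> norm (u x) \<le> B"
proof -
  have "open (U \<inter> (\<lambda>x. norm (u x)) -` {..<B})"
    using assms by (intro continuous_open_preimage continuous_intros) auto
  moreover have "p \<in> U \<inter> (\<lambda>x. norm (u x)) -` {..<B}" using assms by auto
  ultimately obtain r where "r > 0" "ball p r \<subseteq> U \<inter> (\<lambda>x. norm (u x)) -` {..<B}"
    by (meson open_contains_ball)
  then show ?thesis by (intro that[of r]) (auto intro: less_imp_le)
qed

lemma cholomorphic_on_qpochhammer:
  assumes "cholomorphic_on u U" "cholomorphic_on v U"
  shows "cholomorphic_on (\<lambda>x. qpochhammer (u x) (v x) k) U"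
  unfolding qpochhammer_def by (intro cholomorphic_intros assms)

lemma cholomorphic_on_qpochhammer_inf:
  assumes U: "open U" and u: "cholomorphic_on u U" and v: "cholomorphic_on v U"
    and v1: "\<And>x. x \<in> U \<Longrightarrow> norm (v x) < 1"
  shows "cholomorphic_on (\<lambda>x. qpochhammer_inf (u x) (v x)) U"
proof -
  have "cholomorphic_on (\<lambda>x. 1 + (suminf (\<lambda>k. - (qpochhammer (u x) (v x) k * (u x * v x ^ k))))) U"
  proof (intro cholomorphic_intros cholomorphic_on_suminf cholomorphic_on_uminus
      cholomorphic_on_qpochhammer u v)
    fix p assume p: "p \<in> U"
    define R where "R = norm (u p) + 1"
    obtain r1 where r1: "r1 > 0" "ball p r1 \<subseteq> U" "\<And>x. x \<in> ball p r1 \<Longrightarrow> norm (u x) \<le> R"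
      by (rule local_norm_bound[OF cholomorphic_on_imp_continuous_on[OF u] U p, of R]) (auto simp: R_def)
    obtain \<rho> where \<rho>: "norm (v p) < \<rho>" "\<rho> < 1" using v1[OF p] dense by blast
    obtain r2 where r2: "r2 > 0" "ball p r2 \<subseteq> U" "\<And>x. x \<in> ball p r2 \<Longrightarrow> norm (v x) \<le> \<rho>"
      by (rule local_norm_bound[OF cholomorphic_on_imp_continuous_on[OF v] U p \<rho>(1)]) auto
    have pos: "0 \<le> R" "0 \<le> \<rho>" using less_imp_le[OF order.strict_trans1[OF norm_ge_zero \<rho>(1)]] by (auto simp: R_def)
    show "\<exists>r>0. ball p r \<subseteq> U \<and> (\<exists>M. summable M \<and>
       (\<forall>k. \<forall>x\<in>ball p r. norm (- (qpochhammer (u x) (v x) k * (u x * v x ^ k))) \<le> M k))"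
    proof (intro exI[of _ "min r1 r2"] conjI exI[of _ "\<lambda>k. exp (R / (1 - \<rho>)) * (R * \<rho> ^ k)"] allI ballI)
      show "summable (\<lambda>k. exp (R / (1 - \<rho>)) * (R * \<rho> ^ k))"
        using \<rho> pos by (intro summable_mult summable_geometric) auto
      fix k x assume "x \<in> ball p (min r1 r2)"
      then have "norm (u x) \<le> R" "norm (v x) \<le> \<rho>" using r1 r2 by auto
      then show "norm (- (qpochhammer (u x) (v x) k * (u x * v x ^ k))) \<le> exp (R / (1 - \<rho>)) * (R * \<rho> ^ k)"
        unfolding norm_minus_cancel norm_mult norm_power using \<rho> pos
        by (intro mult_mono norm_qpochhammer_le power_mono) auto
    qed (use r1 r2 in auto)
  qed
  moreover have "qpochhammer_inf (u x) (v x) = 1 + (suminf (\<lambda>k. - (qpochhammer (u x) (v x) k * (u x * v x ^ k))))"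
    if "x \<in> U" for x using qpochhammer_inf_eq_suminf[OF v1[OF that]] .
  ultimately show ?thesis
    using U by (auto intro: cholomorphic_on_cong_open)
qed

section \<open>The series without its poles in c\<close>

text \<open>The coefficients of the series multiplied by \<open>(c;q)\<^sub>\<infinity> (q;q)\<^sub>\<infinity>\<close>: these factors cancel the
  denominators \<open>(c;q)\<^sub>k\<close> and \<open>(q;q)\<^sub>k\<close> and leave infinite products in their place, so the coefficients are
  holomorphic in all parameters and bounded in \<open>k\<close>.\<close>

definition phi21_reg_coeff :: "complex \<Rightarrow> complex \<Rightarrow> complex \<Rightarrow> complex \<Rightarrow> nat \<Rightarrow> complex" where
  "phi21_reg_coeff a b c q k = qpochhammer a q k * qpochhammer b q k *
     qpochhammer_inf (c * q ^ k) q * qpochhammer_inf (q * q ^ k) q"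

definition phi21_reg :: "complex \<Rightarrow> complex \<Rightarrow> complex \<Rightarrow> complex \<Rightarrow> complex \<Rightarrow> complex" where
  "phi21_reg a b c q z = suminf (\<lambda>k. phi21_reg_coeff a b c q k * z ^ k)"

lemma norm_phi21_reg_coeff_le:
  assumes "norm a \<le> Ra" "norm b \<le> Rb" "norm c \<le> Rc" "norm q \<le> \<rho>" "\<rho> < 1"
  shows "norm (phi21_reg_coeff a b c q k) \<le>
    exp (Ra / (1 - \<rho>)) * exp (Rb / (1 - \<rho>)) * exp (Rc / (1 - \<rho>)) * exp (1 / (1 - \<rho>))"
proof -
  have q: "norm q ^ k \<le> 1" using assms by (intro power_le_one) auto
  have "norm (c * q ^ k) \<le> norm c * 1"
    unfolding norm_mult norm_power using q by (intro mult_left_mono) auto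
  then have c: "norm (c * q ^ k) \<le> Rc" using assms by simp
  have "norm (q * q ^ k) \<le> 1 * 1"
    unfolding norm_mult norm_power using q assms by (intro mult_mono) auto
  then have qk: "norm (q * q ^ k) \<le> 1" by simp
  show ?thesis
    unfolding phi21_reg_coeff_def norm_mult[of "_ * _ * _"] norm_mult[of "_ * _" "qpochhammer_inf _ _"]
      norm_mult[of "qpochhammer _ _ _"]
    by (intro mult_mono norm_qpochhammer_le norm_qpochhammer_inf_le assms c qk) auto
qed

lemma phi21_reg_sums:
  assumes "norm q < 1" "norm z < 1"
  shows "(\<lambda>k. phi21_reg_coeff a b c q k * z ^ k) sums phi21_reg a b c q z"
proof -
  define K where "K = exp (norm a / (1 - norm q)) * exp (norm b / (1 - norm q)) *
    exp (norm c / (1 - norm q)) * exp (1 / (1 - norm q))"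
  have "summable (\<lambda>k. K * norm z ^ k)"
    using assms by (intro summable_mult summable_geometric) auto
  then have "summable (\<lambda>k. phi21_reg_coeff a b c q k * z ^ k)"
  proof (rule summable_comparison_test'[of _ 0])
    fix k
    show "norm (phi21_reg_coeff a b c q k * z ^ k) \<le> K * norm z ^ k"
      unfolding norm_mult norm_power K_def
      using assms by (intro mult_right_mono norm_phi21_reg_coeff_le) auto
  qed
  then show ?thesis unfolding phi21_reg_def by (rule summable_sums)
qed

lemma cholomorphic_on_phi21_reg:
  assumes U: "open U" and h: "cholomorphic_on a U" "cholomorphic_on b U" "cholomorphic_on c U"
      "cholomorphic_on q U" "cholomorphic_on z U"
    and q1: "\<And>x. x \<in> U \<Longrightarrow> norm (q x) < 1" and z1: "\<And>x. x \<in> U \<Longrightarrow> norm (z x) < 1"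
  shows "cholomorphic_on (\<lambda>x. phi21_reg (a x) (b x) (c x) (q x) (z x)) U"
  unfolding phi21_reg_def
proof (rule cholomorphic_on_suminf)
  fix k
  show "cholomorphic_on (\<lambda>x. phi21_reg_coeff (a x) (b x) (c x) (q x) k * z x ^ k) U"
    unfolding phi21_reg_coeff_def
    by (intro cholomorphic_intros cholomorphic_on_qpochhammer cholomorphic_on_qpochhammer_inf U h q1)
next
  fix p assume p: "p \<in> U"
  note cont = cholomorphic_on_imp_continuous_on
  obtain \<rho> where \<rho>: "norm (q p) < \<rho>" "\<rho> < 1" using q1[OF p] dense by blast
  obtain \<sigma> where \<sigma>: "norm (z p) < \<sigma>" "\<sigma> < 1" using z1[OF p] dense by blast
  obtain ra where ra: "ra > 0" "ball p ra \<subseteq> U" "\<And>x. x \<in> ball p ra \<Longrightarrow> norm (a x) \<le> norm (a p) + 1"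
    by (rule local_norm_bound[OF cont[OF h(1)] U p, of "norm (a p) + 1"]) auto
  obtain rb where rb: "rb > 0" "ball p rb \<subseteq> U" "\<And>x. x \<in> ball p rb \<Longrightarrow> norm (b x) \<le> norm (b p) + 1"
    by (rule local_norm_bound[OF cont[OF h(2)] U p, of "norm (b p) + 1"]) auto
  obtain rc where rc: "rc > 0" "ball p rc \<subseteq> U" "\<And>x. x \<in> ball p rc \<Longrightarrow> norm (c x) \<le> norm (c p) + 1"
    by (rule local_norm_bound[OF cont[OF h(3)] U p, of "norm (c p) + 1"]) auto
  obtain rq where rq: "rq > 0" "ball p rq \<subseteq> U" "\<And>x. x \<in> ball p rq \<Longrightarrow> norm (q x) \<le> \<rho>"
    by (rule local_norm_bound[OF cont[OF h(4)] U p \<rho>(1)]) blast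
  obtain rz where rz: "rz > 0" "ball p rz \<subseteq> U" "\<And>x. x \<in> ball p rz \<Longrightarrow> norm (z x) \<le> \<sigma>"
    by (rule local_norm_bound[OF cont[OF h(5)] U p \<sigma>(1)]) blast
  define r where "r = min ra (min rb (min rc (min rq rz)))"
  define K where "K = exp ((norm (a p) + 1) / (1 - \<rho>)) * exp ((norm (b p) + 1) / (1 - \<rho>)) *
    exp ((norm (c p) + 1) / (1 - \<rho>)) * exp (1 / (1 - \<rho>))"
  have \<sigma>0: "0 \<le> \<sigma>" by (rule less_imp_le[OF order.strict_trans1[OF norm_ge_zero \<sigma>(1)]])
  show "\<exists>r>0. ball p r \<subseteq> U \<and> (\<exists>M. summable M \<and>
      (\<forall>k. \<forall>x\<in>ball p r. norm (phi21_reg_coeff (a x) (b x) (c x) (q x) k * z x ^ k) \<le> M k))"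
  proof (intro exI[of _ r] conjI exI[of _ "\<lambda>k. K * \<sigma> ^ k"] allI ballI)
    show "summable (\<lambda>k. K * \<sigma> ^ k)"
      using \<sigma> \<sigma>0 by (intro summable_mult summable_geometric) auto
    fix k x assume "x \<in> ball p r"
    then have "x \<in> ball p ra" "x \<in> ball p rb" "x \<in> ball p rc" "x \<in> ball p rq" "x \<in> ball p rz"
      by (auto simp: r_def)
    note bounds = ra(3)[OF this(1)] rb(3)[OF this(2)] rc(3)[OF this(3)] rq(3)[OF this(4)] rz(3)[OF this(5)]
    show "norm (phi21_reg_coeff (a x) (b x) (c x) (q x) k * z x ^ k) \<le> K * \<sigma> ^ k"
      unfolding norm_mult norm_power K_def
      by (intro mult_mono norm_phi21_reg_coeff_le bounds \<rho> power_mono) auto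
  qed (use ra rb rc rq rz in \<open>auto simp: r_def\<close>)
qed

lemma phi21_reg_eq_series:
  assumes "norm q < 1" "norm z < 1" "\<And>k. c * q ^ k \<noteq> 1"
  shows "phi21_reg a b c q z = qpochhammer_inf c q * qpochhammer_inf q q * phi21_series a b c q z"
proof -
  have q: "q * q ^ j \<noteq> 1" for j
    using power_Suc_less_one[of "norm q" j] assms(1) by (metis norm_ge_zero norm_one norm_power power_Suc less_irrefl power_0_Suc power_eq_0_iff norm_zero le_less)
  note nz = qpochhammer_inf_nonzero[OF assms(1,3)] qpochhammer_inf_nonzero[OF assms(1) q]
  have eq: "qpochhammer a q k * qpochhammer b q k / (qpochhammer q q k * qpochhammer c q k) * z ^ k =
      phi21_reg_coeff a b c q k * z ^ k / (qpochhammer_inf c q * qpochhammer_inf q q)" for k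
  proof -
    have split: "qpochhammer_inf c q = qpochhammer c q k * qpochhammer_inf (c * q ^ k) q"
      "qpochhammer_inf q q = qpochhammer q q k * qpochhammer_inf (q * q ^ k) q"
      by (rule qpochhammer_inf_split[OF assms(1)])+
    with nz have "qpochhammer c q k \<noteq> 0" "qpochhammer_inf (c * q ^ k) q \<noteq> 0"
        "qpochhammer q q k \<noteq> 0" "qpochhammer_inf (q * q ^ k) q \<noteq> 0" by auto
    then show ?thesis unfolding split phi21_reg_coeff_def by (simp add: field_simps)
  qed
  have "phi21_series a b c q z = phi21_reg a b c q z / (qpochhammer_inf c q * qpochhammer_inf q q)"
    unfolding phi21_series_def eq
    by (rule sums_unique[symmetric, OF sums_divide[OF phi21_reg_sums[OF assms(1,2)]]])
  then show ?thesis using nz by simp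
qed

lemma power_series_relation:
  fixes z :: complex
  assumes U: "(\<lambda>k. u k * z ^ k) sums U" and W: "(\<lambda>k. w k * z ^ k) sums W"
    and 0: "u 0 = 0" and Suc: "\<And>k. u (Suc k) = - w k"
  shows "U + z * W = 0"
proof -
  have "(\<lambda>k. u (Suc k) * z ^ Suc k) sums U"
    using U 0 by (subst sums_Suc_iff) simp
  moreover have "(\<lambda>k. - (z * (w k * z ^ k))) sums (- (z * W))"
    by (intro sums_minus sums_mult W)
  then have "(\<lambda>k. u (Suc k) * z ^ Suc k) sums (- (z * W))"
    by (simp add: Suc mult_ac)
  ultimately have "U = - (z * W)" by (rule sums_unique2)
  then show ?thesis by simp
qed

text \<open>The series at neighbouring parameters have coefficients that differ by simple factors, recorded in the
  next four lemmas. By these rules each relation below holds coefficientwise, once a factor \<open>z\<close> has been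
  turned into a shift of the index.\<close>

lemma phi21_reg_coeff_Suc:
  assumes "norm q < 1"
  shows "(1 - c * q ^ k) * (1 - q * q ^ k) * phi21_reg_coeff a b c q (Suc k) =
    (1 - a * q ^ k) * (1 - b * q ^ k) * phi21_reg_coeff a b c q k"
  using qpochhammer_inf_step[OF assms, of "c * q ^ k"] qpochhammer_inf_step[OF assms, of "q * q ^ k"]
  by (simp add: phi21_reg_coeff_def qpochhammer_Suc mult_ac)

lemma phi21_reg_coeff_c:
  assumes "norm q < 1"
  shows "phi21_reg_coeff a b c q k = (1 - c * q ^ k) * phi21_reg_coeff a b (c * q) q k"
  using qpochhammer_inf_step[OF assms, of "c * q ^ k"]
  by (simp add: phi21_reg_coeff_def mult_ac)

lemma phi21_reg_coeff_Suc_c: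
  assumes "norm q < 1"
  shows "(1 - q * q ^ k) * phi21_reg_coeff a b c q (Suc k) =
    (1 - a * q ^ k) * (1 - b * q ^ k) * phi21_reg_coeff a b (c * q) q k"
  using qpochhammer_inf_step[OF assms, of "q * q ^ k"]
  by (simp add: phi21_reg_coeff_def qpochhammer_Suc mult_ac)

lemma phi21_reg_coeff_a:
  "(1 - a) * phi21_reg_coeff (a * q) b c q k = (1 - a * q ^ k) * phi21_reg_coeff a b c q k"
proof -
  have "(1 - a) * qpochhammer (a * q) q k = qpochhammer a q k * (1 - a * q ^ k)"
    by (metis qpochhammer_Suc qpochhammer_Suc_shift)
  then show ?thesis by (simp add: phi21_reg_coeff_def mult_ac)
qed

lemma phi21_reg_dilate_sums:
  assumes "norm q < 1" "norm z < 1"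
  shows "(\<lambda>k. q ^ k * phi21_reg_coeff a b c q k * z ^ k) sums phi21_reg a b c q (z * q)"
    and "(\<lambda>k. q ^ k * q ^ k * phi21_reg_coeff a b c q k * z ^ k) sums phi21_reg a b c q (z * q * q)"
proof -
  have zq: "norm (w * q) < 1" if "norm w < 1" for w
    using that assms(1) mult_strict_mono'[of "norm w" 1 "norm q" 1] by (simp add: norm_mult)
  show "(\<lambda>k. q ^ k * phi21_reg_coeff a b c q k * z ^ k) sums phi21_reg a b c q (z * q)"
    using phi21_reg_sums[OF assms(1) zq[OF assms(2)], of a b c] by (simp add: power_mult_distrib mult_ac)
  show "(\<lambda>k. q ^ k * q ^ k * phi21_reg_coeff a b c q k * z ^ k) sums phi21_reg a b c q (z * q * q)"
    using phi21_reg_sums[OF assms(1) zq[OF zq[OF assms(2)]], of a b c] by (simp add: power_mult_distrib mult_ac)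
qed

lemma phi21_reg_rel_z:
  assumes q: "norm q < 1" and z: "norm z < 1"
  shows "q * (1 - z) * phi21_reg a b c q z - (c + q - (a + b) * q * z) * phi21_reg a b c q (z * q)
    + (c - a * b * q * z) * phi21_reg a b c q (z * q * q) = 0"
proof -
  let ?T = "phi21_reg_coeff a b c q"
  let ?u = "\<lambda>k. q * ?T k - (c + q) * (q ^ k * ?T k) + c * (q ^ k * q ^ k * ?T k)"
  let ?w = "\<lambda>k. - q * ?T k + (a + b) * q * (q ^ k * ?T k) - a * b * q * (q ^ k * q ^ k * ?T k)"
  note S = phi21_reg_sums[OF q z, of a b c] phi21_reg_dilate_sums[OF q z, of a b c]
  have U: "(\<lambda>k. ?u k * z ^ k) sums (q * phi21_reg a b c q z - (c + q) * phi21_reg a b c q (z * q)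
      + c * phi21_reg a b c q (z * q * q))"
    using sums_add[OF sums_diff[OF sums_mult[OF S(1), of q] sums_mult[OF S(2), of "c + q"]] sums_mult[OF S(3), of c]]
    by (rule back_subst[of "\<lambda>f. f sums _"]) (simp add: algebra_simps)
  have W: "(\<lambda>k. ?w k * z ^ k) sums (- q * phi21_reg a b c q z + (a + b) * q * phi21_reg a b c q (z * q)
      - a * b * q * phi21_reg a b c q (z * q * q))"
    using sums_diff[OF sums_add[OF sums_mult[OF S(1), of "- q"] sums_mult[OF S(2), of "(a + b) * q"]]
        sums_mult[OF S(3), of "a * b * q"]]
    by (rule back_subst[of "\<lambda>f. f sums _"]) (simp add: algebra_simps)
  have "?u (Suc k) = - ?w k" for k
  proof -
    have "?u (Suc k) = q * ((1 - c * q ^ k) * (1 - q * q ^ k) * ?T (Suc k))"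
      by (simp add: algebra_simps)
    also have "\<dots> = - ?w k" unfolding phi21_reg_coeff_Suc[OF q] by (simp add: algebra_simps)
    finally show ?thesis .
  qed
  from power_series_relation[OF U W _ this] show ?thesis by (simp add: algebra_simps)
qed

lemma phi21_reg_rel_a:
  assumes q: "norm q < 1" and z: "norm z < 1"
  shows "(1 - a) * phi21_reg (a * q) b c q z - phi21_reg a b c q z + a * phi21_reg a b c q (z * q) = 0"
proof -
  have "(\<lambda>k. (1 - a) * (phi21_reg_coeff (a * q) b c q k * z ^ k) - phi21_reg_coeff a b c q k * z ^ k
      + a * (q ^ k * phi21_reg_coeff a b c q k * z ^ k)) sums
      ((1 - a) * phi21_reg (a * q) b c q z - phi21_reg a b c q z + a * phi21_reg a b c q (z * q))"
    by (intro sums_add sums_diff sums_mult phi21_reg_sums phi21_reg_dilate_sums q z)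
  moreover have "(1 - a) * (phi21_reg_coeff (a * q) b c q k * z ^ k) - phi21_reg_coeff a b c q k * z ^ k
      + a * (q ^ k * phi21_reg_coeff a b c q k * z ^ k) = 0" for k
    unfolding mult.assoc[symmetric] phi21_reg_coeff_a by (simp add: algebra_simps)
  ultimately have "(\<lambda>_. 0) sums ((1 - a) * phi21_reg (a * q) b c q z - phi21_reg a b c q z + a * phi21_reg a b c q (z * q))"
    by (simp only:)
  then show ?thesis by (rule sums_unique2[OF _ sums_zero])
qed

lemma phi21_reg_rel_c_inverse:
  assumes q: "norm q < 1" and z: "norm z < 1"
  shows "phi21_reg a b (c * q) q z - c * phi21_reg a b (c * q) q (z * q) - phi21_reg a b c q z = 0"
proof -
  have "(\<lambda>k. phi21_reg_coeff a b (c * q) q k * z ^ k - c * (q ^ k * phi21_reg_coeff a b (c * q) q k * z ^ k)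
      - phi21_reg_coeff a b c q k * z ^ k) sums
      (phi21_reg a b (c * q) q z - c * phi21_reg a b (c * q) q (z * q) - phi21_reg a b c q z)"
    by (intro sums_add sums_diff sums_mult phi21_reg_sums phi21_reg_dilate_sums q z)
  moreover have "phi21_reg_coeff a b (c * q) q k * z ^ k - c * (q ^ k * phi21_reg_coeff a b (c * q) q k * z ^ k)
      - phi21_reg_coeff a b c q k * z ^ k = 0" for k
    unfolding phi21_reg_coeff_c[OF q, of a b c] by (simp add: algebra_simps)
  ultimately have "(\<lambda>_. 0) sums (phi21_reg a b (c * q) q z - c * phi21_reg a b (c * q) q (z * q) - phi21_reg a b c q z)"
    by (simp only:)
  then show ?thesis by (rule sums_unique2[OF _ sums_zero])
qed

lemma phi21_reg_rel_c:
  assumes q: "norm q < 1" and z: "norm z < 1"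
  shows "z * (c - b) * (c - a) * phi21_reg a b (c * q) q z
    - (c\<^sup>2 + a * b * z - (a + b) * c * z) * phi21_reg a b c q z
    + c * (c - a * b * z) * phi21_reg a b c q (z * q) = 0"
proof -
  let ?T = "phi21_reg_coeff a b c q" and ?T' = "phi21_reg_coeff a b (c * q) q"
  let ?u = "\<lambda>k. c\<^sup>2 * (q ^ k * ?T k) - c\<^sup>2 * ?T k"
  let ?w = "\<lambda>k. (c - b) * (c - a) * ?T' k + ((a + b) * c - a * b) * ?T k - a * b * c * (q ^ k * ?T k)"
  note S = phi21_reg_sums[OF q z, of a b c] phi21_reg_dilate_sums(1)[OF q z, of a b c]
    phi21_reg_sums[OF q z, of a b "c * q"]
  have U: "(\<lambda>k. ?u k * z ^ k) sums (c\<^sup>2 * phi21_reg a b c q (z * q) - c\<^sup>2 * phi21_reg a b c q z)"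
    using sums_diff[OF sums_mult[OF S(2), of "c\<^sup>2"] sums_mult[OF S(1), of "c\<^sup>2"]]
    by (rule back_subst[of "\<lambda>f. f sums _"]) (simp add: algebra_simps)
  have W: "(\<lambda>k. ?w k * z ^ k) sums ((c - b) * (c - a) * phi21_reg a b (c * q) q z
      + ((a + b) * c - a * b) * phi21_reg a b c q z - a * b * c * phi21_reg a b c q (z * q))"
    using sums_diff[OF sums_add[OF sums_mult[OF S(3), of "(c - b) * (c - a)"]
        sums_mult[OF S(1), of "(a + b) * c - a * b"]] sums_mult[OF S(2), of "a * b * c"]]
    by (rule back_subst[of "\<lambda>f. f sums _"]) (simp add: algebra_simps)
  have "?u (Suc k) = - ?w k" for k
  proof -
    have "?u (Suc k) = - (c\<^sup>2 * ((1 - q * q ^ k) * ?T (Suc k)))"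
      by (simp add: algebra_simps)
    also have "\<dots> = - (c\<^sup>2 * ((1 - a * q ^ k) * (1 - b * q ^ k) * ?T' k))"
      by (simp only: phi21_reg_coeff_Suc_c[OF q])
    also have "\<dots> = - ?w k"
      unfolding phi21_reg_coeff_c[OF q, of a b c]
      by (simp add: algebra_simps power2_eq_square)
    finally show ?thesis .
  qed
  from power_series_relation[OF U W _ this] show ?thesis by (simp add: algebra_simps power2_eq_square)
qed

text \<open>The factor \<open>1 - a\<close> converts every coefficient at \<open>aq\<close> into one at \<open>a\<close>.\<close>

lemma phi21_reg_rel_a_inverse:
  assumes q: "norm q < 1" and z: "norm z < 1"
  shows "(1 - a) * ((a * c + a * q - c - a\<^sup>2 * q * z) * phi21_reg (a * q) b c q z
    + a * (a * b * q * z - c) * phi21_reg (a * q) b c q (z * q) + (c - a * q) * phi21_reg a b c q z) = 0"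
proof -
  let ?T = "phi21_reg_coeff a b c q" and ?T' = "phi21_reg_coeff (a * q) b c q"
  let ?u = "\<lambda>k. (1 - a) * ((a * c + a * q - c) * ?T' k - a * c * (q ^ k * ?T' k) + (c - a * q) * ?T k)"
  let ?w = "\<lambda>k. (1 - a) * (a\<^sup>2 * b * q * (q ^ k * ?T' k) - a\<^sup>2 * q * ?T' k)"
  note S = phi21_reg_sums[OF q z, of "a * q" b c] phi21_reg_dilate_sums(1)[OF q z, of "a * q" b c]
    phi21_reg_sums[OF q z, of a b c]
  have U: "(\<lambda>k. ?u k * z ^ k) sums ((1 - a) * ((a * c + a * q - c) * phi21_reg (a * q) b c q z
      - a * c * phi21_reg (a * q) b c q (z * q) + (c - a * q) * phi21_reg a b c q z))"
    using sums_mult[OF sums_add[OF sums_diff[OF sums_mult[OF S(1), of "a * c + a * q - c"]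
      sums_mult[OF S(2), of "a * c"]] sums_mult[OF S(3), of "c - a * q"]], of "1 - a"]
    by (rule back_subst[of "\<lambda>f. f sums _"]) (simp add: algebra_simps)
  have W: "(\<lambda>k. ?w k * z ^ k) sums ((1 - a) * (a\<^sup>2 * b * q * phi21_reg (a * q) b c q (z * q)
      - a\<^sup>2 * q * phi21_reg (a * q) b c q z))"
    using sums_mult[OF sums_diff[OF sums_mult[OF S(2), of "a\<^sup>2 * b * q"] sums_mult[OF S(1), of "a\<^sup>2 * q"]], of "1 - a"]
    by (rule back_subst[of "\<lambda>f. f sums _"]) (simp add: algebra_simps)
  have u: "?u k = a\<^sup>2 * (1 - q ^ k) * (q - c * q ^ k) * ?T k" for k
  proof -
    have "?u k = (a * c + a * q - c - a * c * q ^ k) * ((1 - a) * ?T' k) + (1 - a) * (c - a * q) * ?T k"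
      by (simp add: algebra_simps)
    also have "\<dots> = a\<^sup>2 * (1 - q ^ k) * (q - c * q ^ k) * ?T k"
      unfolding phi21_reg_coeff_a by (simp add: algebra_simps power2_eq_square)
    finally show ?thesis .
  qed
  have w: "?w k = - (a\<^sup>2 * q * ((1 - a * q ^ k) * (1 - b * q ^ k) * ?T k))" for k
  proof -
    have "?w k = (a\<^sup>2 * b * q * q ^ k - a\<^sup>2 * q) * ((1 - a) * ?T' k)" by (simp add: algebra_simps)
    also have "\<dots> = - (a\<^sup>2 * q * ((1 - a * q ^ k) * (1 - b * q ^ k) * ?T k))"
      unfolding phi21_reg_coeff_a by (simp add: algebra_simps)
    finally show ?thesis .
  qed
  have 0: "?u 0 = 0" unfolding u by simp
  have "?u (Suc k) = - ?w k" for k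
    unfolding u w phi21_reg_coeff_Suc[OF q, symmetric] by (simp add: algebra_simps)
  from power_series_relation[OF U W 0 this] show ?thesis by (simp add: algebra_simps power2_eq_square)
qed

section \<open>The meromorphic continuation\<close>

text \<open>The function \<open>(z;q)\<^sub>\<infinity> (c;q)\<^sub>\<infinity> (q;q)\<^sub>\<infinity> \<phi>\<close>, extended step by step to \<open>|z q\<^sup>n| < 1\<close>. The recurrence is
  the relation between \<open>\<phi>(z)\<close>, \<open>\<phi>(qz)\<close> and \<open>\<phi>(q\<^sup>2z)\<close> given by \<open>R\<^sub>z\<close>; the factor \<open>(z;q)\<^sub>\<infinity>\<close> absorbs the
  division by \<open>1 - z\<close>.\<close>

primrec phi21_cont :: "nat \<Rightarrow> qpoint \<Rightarrow> complex" where
  "phi21_cont 0 x = qpochhammer_inf (x $ Vz) (x $ Vq) *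
     phi21_reg (x $ Va) (x $ Vb) (x $ Vc) (x $ Vq) (x $ Vz)"
| "phi21_cont (Suc n) x =
     ((x $ Vc + x $ Vq) / x $ Vq - (x $ Va + x $ Vb) * x $ Vz) * phi21_cont n (shift_point (0, 0, 0, 1) x) -
     (x $ Vc / x $ Vq - x $ Va * x $ Vb * x $ Vz) * (1 - x $ Vz * x $ Vq) *
       phi21_cont n (shift_point (0, 0, 0, 2) x)"

definition zdisc :: "nat \<Rightarrow> qpoint set" where
  "zdisc n = {x \<in> qdomain. norm (x $ Vz * (x $ Vq) ^ n) < 1}"

lemma open_zdisc: "open (zdisc n)"
proof -
  have "zdisc n = qdomain \<inter> {x. norm (x $ Vz * (x $ Vq) ^ n) < 1}" by (auto simp: zdisc_def)
  moreover have "open \<dots>"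
    by (intro open_Int open_qdomain open_Collect_less continuous_intros continuous_on_component)
  ultimately show ?thesis by simp
qed

lemma zdisc_mono: "x \<in> zdisc m \<Longrightarrow> m \<le> n \<Longrightarrow> x \<in> zdisc n"
proof -
  assume x: "x \<in> zdisc m" and mn: "m \<le> n"
  have "norm (x $ Vq) ^ n \<le> norm (x $ Vq) ^ m"
    using x mn by (intro power_decreasing) (auto simp: zdisc_def qdomain_def)
  then have "norm (x $ Vz) * norm (x $ Vq) ^ n \<le> norm (x $ Vz) * norm (x $ Vq) ^ m"
    by (rule mult_left_mono) simp
  then show ?thesis using x by (simp add: zdisc_def norm_mult norm_power)
qed

lemma qdomain_in_zdisc:
  assumes "x \<in> qdomain"
  shows "\<exists>n. x \<in> zdisc n"
proof -
  have "(\<lambda>n. x $ Vz * (x $ Vq) ^ n) \<longlonglongrightarrow> x $ Vz * 0"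
    using assms by (intro tendsto_mult tendsto_const LIMSEQ_power_zero) (auto simp: qdomain_def)
  then have "\<forall>\<^sub>F n in sequentially. dist (x $ Vz * (x $ Vq) ^ n) 0 < 1"
    by (intro tendstoD) auto
  then obtain n where "dist (x $ Vz * (x $ Vq) ^ n) 0 < 1"
    by (auto simp: eventually_sequentially)
  then show ?thesis using assms by (auto simp: zdisc_def)
qed

lemma shift_in_zdisc:
  assumes "x \<in> zdisc (Suc n)"
  shows "shift_point (0, 0, 0, 1) x \<in> zdisc n" "shift_point (0, 0, 0, 2) x \<in> zdisc n"
proof -
  have x: "x \<in> qdomain" "norm (x $ Vz * (x $ Vq) ^ Suc n) < 1" using assms by (auto simp: zdisc_def)
  then show "shift_point (0, 0, 0, 1) x \<in> zdisc n"
    by (auto simp: zdisc_def shift_point_in_qdomain) (simp add: shift_point_def mult_ac)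
  have "norm (x $ Vz * (x $ Vq) ^ Suc (Suc n)) < 1"
    using zdisc_mono[OF assms, of "Suc (Suc n)"] by (simp add: zdisc_def)
  then show "shift_point (0, 0, 0, 2) x \<in> zdisc n"
    using x by (auto simp: zdisc_def shift_point_in_qdomain) (simp add: shift_point_def mult_ac power2_eq_square)
qed

lemma cholomorphic_on_shift:
  assumes "cholomorphic_on f U" "V \<subseteq> qdomain" "\<And>x. x \<in> V \<Longrightarrow> shift_point k x \<in> U"
  shows "cholomorphic_on (\<lambda>x. f (shift_point k x)) V"
  using assms
  by (intro cholomorphic_on_compose[of _ V f U] cholomorphic_on_subset[OF cholomorphic_on_shift_point]) auto

lemma cholomorphic_on_phi21_cont: "cholomorphic_on (phi21_cont n) (zdisc n)"
proof (induction n)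
  case 0
  have "norm (x $ Vq) < 1" "norm (x $ Vz) < 1" if "x \<in> zdisc 0" for x
    using that by (auto simp: zdisc_def qdomain_def)
  then show ?case
    unfolding phi21_cont.simps
    by (intro cholomorphic_intros cholomorphic_on_qpochhammer_inf cholomorphic_on_phi21_reg open_zdisc)
next
  case (Suc n)
  have "zdisc (Suc n) \<subseteq> qdomain" "\<And>x. x \<in> zdisc (Suc n) \<Longrightarrow> x $ Vq \<noteq> 0"
    by (auto simp: zdisc_def qdomain_def)
  then show ?case
    unfolding phi21_cont.simps
    by (intro cholomorphic_intros cholomorphic_on_divide cholomorphic_on_shift[OF Suc] shift_in_zdisc)
qed

text \<open>On \<open>|z| < 1\<close> the first extension agrees with the series by \<open>phi21_reg_rel_z\<close>; further out, two successive
  extensions agree because their recurrences have the same coefficients.\<close>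

lemma phi21_cont_Suc: "x \<in> zdisc n \<Longrightarrow> phi21_cont (Suc n) x = phi21_cont n x"
proof (induction n arbitrary: x)
  case 0
  define a b c q z where "a = x $ Va" and "b = x $ Vb" and "c = x $ Vc" and "q = x $ Vq" and "z = x $ Vz"
  note vars = this
  have q: "q \<noteq> 0" "norm q < 1" and z: "norm z < 1"
    using 0 by (auto simp: zdisc_def qdomain_def vars)
  define P where "P = qpochhammer_inf (z * q * q) q"
  have P: "qpochhammer_inf (z * q) q = (1 - z * q) * P" "qpochhammer_inf z q = (1 - z) * ((1 - z * q) * P)"
    using qpochhammer_inf_step[OF q(2), of z] qpochhammer_inf_step[OF q(2), of "z * q"] by (simp_all add: P_def)
  define \<alpha> \<beta> where "\<alpha> = (c + q) / q - (a + b) * z" and "\<beta> = c / q - a * b * z"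
  have "phi21_cont (Suc 0) x = \<alpha> * (qpochhammer_inf (z * q) q * phi21_reg a b c q (z * q)) -
    \<beta> * (1 - z * q) * (P * phi21_reg a b c q (z * q * q))"
    by (simp add: shift_point_def vars P_def \<alpha>_def \<beta>_def power2_eq_square mult.assoc)
  also have "\<dots> = (1 - z * q) * P * (\<alpha> * phi21_reg a b c q (z * q) - \<beta> * phi21_reg a b c q (z * q * q))"
    unfolding P by (simp add: algebra_simps)
  also have "\<alpha> * phi21_reg a b c q (z * q) - \<beta> * phi21_reg a b c q (z * q * q) = (1 - z) * phi21_reg a b c q z"
  proof -
    have "q * \<alpha> = c + q - (a + b) * q * z" "q * \<beta> = c - a * b * q * z"
      using q(1) by (simp_all add: \<alpha>_def \<beta>_def right_diff_distrib)
    then have "q * (\<alpha> * phi21_reg a b c q (z * q) - \<beta> * phi21_reg a b c q (z * q * q)) =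
        q * ((1 - z) * phi21_reg a b c q z)"
      using phi21_reg_rel_z[OF q(2) z, of a b c] by algebra
    then show ?thesis using q(1) by simp
  qed
  also have "(1 - z * q) * P * ((1 - z) * phi21_reg a b c q z) = phi21_cont 0 x"
    by (simp add: P flip: vars)
  finally show ?case .
next
  case (Suc n)
  show ?case
    using Suc.IH[OF shift_in_zdisc(1)[OF Suc.prems]] Suc.IH[OF shift_in_zdisc(2)[OF Suc.prems]]
    unfolding phi21_cont.simps(2)[of "Suc n" x] phi21_cont.simps(2)[of n x] by (simp only:)
qed

lemma phi21_cont_mono: "m \<le> n \<Longrightarrow> x \<in> zdisc m \<Longrightarrow> phi21_cont n x = phi21_cont m x"
proof (induction n rule: dec_induct)
  case (step n)
  then show ?case using phi21_cont_Suc[OF zdisc_mono[OF step.prems step.hyps(1)]] by simp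
qed simp

text \<open>Every point has \<open>|z q\<^sup>n| < 1\<close> for some \<open>n\<close>; the extensions agree where they overlap, so any such \<open>n\<close>
  gives the same value.\<close>

definition phi21_num :: "qpoint \<Rightarrow> complex" where
  "phi21_num x = phi21_cont (LEAST n. x \<in> zdisc n) x"

definition phi21_den :: "qpoint \<Rightarrow> complex" where
  "phi21_den x = qpochhammer_inf (x $ Vz) (x $ Vq) * (qpochhammer_inf (x $ Vc) (x $ Vq) *
     qpochhammer_inf (x $ Vq) (x $ Vq))"

lemma phi21_num_eq: "x \<in> zdisc n \<Longrightarrow> phi21_num x = phi21_cont n x"
  unfolding phi21_num_def by (rule phi21_cont_mono[symmetric]) (rule Least_le, assumption, rule LeastI)

lemma cholomorphic_on_phi21_num: "cholomorphic_on phi21_num qdomain"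
  unfolding cholomorphic_on_def
proof
  fix x assume "x \<in> qdomain"
  then obtain n where n: "x \<in> zdisc n" using qdomain_in_zdisc by blast
  have "cholomorphic_on phi21_num (zdisc n)"
    by (rule cholomorphic_on_cong_open[OF cholomorphic_on_phi21_cont open_zdisc phi21_num_eq])
  with n show "\<exists>f'. (phi21_num has_derivative f') (at x) \<and> (\<forall>t v. f' (t *s v) = t * f' v)"
    unfolding cholomorphic_on_def by blast
qed

lemma cholomorphic_on_phi21_den: "cholomorphic_on phi21_den qdomain"
  unfolding phi21_den_def
  by (intro cholomorphic_intros cholomorphic_on_qpochhammer_inf open_qdomain) (simp_all add: qdomain_def)

lemma mult_power_neq_1:
  fixes q :: complex
  assumes "norm q < 1" "norm c < 1"
  shows "c * q ^ k \<noteq> 1"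
proof -
  have "norm q ^ k \<le> 1" using assms by (intro power_le_one) auto
  then have "norm c * norm q ^ k \<le> norm c * 1" by (intro mult_left_mono) auto
  also have "\<dots> < 1" using assms by simp
  finally have "norm (c * q ^ k) < 1" by (simp add: norm_mult norm_power)
  then show ?thesis by (metis norm_one less_irrefl)
qed

text \<open>An open set of parameters at which the series converges and no denominator vanishes.\<close>

definition series_region :: "qpoint set" where
  "series_region = {x \<in> qdomain. norm (x $ Vz) < 1 \<and> norm (x $ Vc) < 1}"

lemma open_series_region: "open series_region"
proof -
  have "series_region = qdomain \<inter> {x. norm (x $ Vz) < 1} \<inter> {x. norm (x $ Vc) < 1}"
    by (auto simp: series_region_def)
  moreover have "open \<dots>"
    by (intro open_Int open_qdomain open_Collect_less continuous_intros continuous_on_component)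
  ultimately show ?thesis by simp
qed

lemma series_region_nonempty: "series_region \<noteq> {}"
proof -
  have "(\<chi> i. 1 / 2) \<in> series_region" by (simp add: series_region_def qdomain_def)
  then show ?thesis by blast
qed

lemma series_regionD:
  assumes "x \<in> series_region"
  shows "x \<in> qdomain" "norm (x $ Vz) < 1" "norm (x $ Vc) < 1" "norm (x $ Vq) < 1"
  using assms by (auto simp: series_region_def qdomain_def)

lemma phi21_den_nonzero:
  assumes "x \<in> qdomain" "norm (x $ Vz) < 1" "\<And>k. x $ Vc * (x $ Vq) ^ k \<noteq> 1"
  shows "phi21_den x \<noteq> 0"
proof -
  have "norm (x $ Vq) < 1" using assms by (simp add: qdomain_def)
  with assms(2,3) show ?thesis
    unfolding phi21_den_def by (simp add: qpochhammer_inf_nonzero mult_power_neq_1)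
qed

text \<open>If the denominator vanished on an open set, it would vanish on a dense open set by the identity theorem;
  but it has no zeros at all in \<open>series_region\<close>.\<close>

lemma nonvanishing_dense_phi21_den: "qdomain \<subseteq> closure {x \<in> qdomain. phi21_den x \<noteq> 0}"
  unfolding nonvanishing_dense_iff[OF open_qdomain]
proof (intro allI impI, rule ccontr)
  fix W :: "qpoint set" assume W: "open W" "W \<noteq> {}" "W \<subseteq> qdomain" and "\<not> (\<exists>x\<in>W. phi21_den x \<noteq> 0)"
  then have gen: "generically qdomain (\<lambda>x. phi21_den x = 0)"
    by (intro cmeromorphic_identity[OF open_qdomain connected_qdomain _ W]
        cholomorphic_imp_cmeromorphic_on open_qdomain cholomorphic_on_phi21_den) auto
  have sub: "series_region \<subseteq> qdomain" by (auto simp: series_region_def)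
  obtain V where "V \<noteq> {}" "V \<subseteq> series_region" "\<forall>x\<in>V. phi21_den x = 0"
    by (rule genericallyD[OF open_qdomain gen open_series_region series_region_nonempty sub])
  then obtain x where x: "x \<in> series_region" "phi21_den x = 0" by blast
  have "phi21_den x \<noteq> 0"
    using series_regionD[OF x(1)] by (intro phi21_den_nonzero mult_power_neq_1)
  with x show False by simp
qed

lemma phi21_num_series:
  assumes "x \<in> qdomain" "norm (x $ Vz) < 1" "\<And>k. x $ Vc * (x $ Vq) ^ k \<noteq> 1"
  shows "phi21_num x / phi21_den x = phi21_series (x $ Va) (x $ Vb) (x $ Vc) (x $ Vq) (x $ Vz)"
proof -
  have "x \<in> zdisc 0" using assms by (simp add: zdisc_def)
  then have "phi21_num x = phi21_den x * phi21_series (x $ Va) (x $ Vb) (x $ Vc) (x $ Vq) (x $ Vz)"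
    using phi21_reg_eq_series[OF _ assms(2,3)] assms(1)
    by (simp add: phi21_num_eq phi21_den_def qdomain_def)
  then show ?thesis using phi21_den_nonzero[OF assms] by simp
qed

lemma cmeromorphic_on_phi21: "cmeromorphic_on (\<lambda>x. phi21_num x / phi21_den x) qdomain"
  by (rule cmeromorphic_onI, rule local_fractionI[OF open_qdomain _ cholomorphic_on_phi21_num
        cholomorphic_on_phi21_den nonvanishing_dense_phi21_den]) auto

lemma phi21_eq: "phi21 = abs_mero (\<lambda>x. phi21_num x / phi21_den x)"
proof -
  have "continues_phi21 (abs_mero (\<lambda>x. phi21_num x / phi21_den x))"
    unfolding continues_phi21_def using cmeromorphic_on_phi21 phi21_num_series by blast
  then show ?thesis
    unfolding phi21_def using continues_phi21_unique by (intro the_equality)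
qed

section \<open>Values of meromorphic functions on open sets\<close>

text \<open>A meromorphic function is a class modulo equality on dense open sets and so has no values of its own. This
  relation says that it has a representative with prescribed values on \<open>V\<close>, which suffices to decide
  whether it is zero.\<close>

definition mero_agrees_on :: "mero \<Rightarrow> (qpoint \<Rightarrow> complex) \<Rightarrow> qpoint set \<Rightarrow> bool" where
  "mero_agrees_on F g V \<longleftrightarrow>
     (\<exists>f. cmeromorphic_on f qdomain \<and> F = abs_mero f \<and> (\<forall>x\<in>V. f x = g x))"

lemma mero_agrees_onI:
  "cmeromorphic_on f qdomain \<Longrightarrow> F = abs_mero f \<Longrightarrow> (\<And>x. x \<in> V \<Longrightarrow> f x = g x) \<Longrightarrow> mero_agrees_on F g V"
  unfolding mero_agrees_on_def by blast

lemma mero_agrees_on_const: "mero_agrees_on (mero_const k) (\<lambda>_. k) V"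
  by (rule mero_agrees_onI) (auto simp: mero_const_def cmeromorphic_on_const open_qdomain)

lemma mero_agrees_on_var: "mero_agrees_on (mero_var i) (\<lambda>x. x $ i) V"
  by (rule mero_agrees_onI)
     (auto simp: mero_var_def cholomorphic_imp_cmeromorphic_on open_qdomain cholomorphic_on_nth)

lemma mero_agrees_on_add:
  assumes "mero_agrees_on F f V" "mero_agrees_on G g V"
  shows "mero_agrees_on (F + G) (\<lambda>x. f x + g x) V"
proof -
  obtain f' g' where "cmeromorphic_on f' qdomain" "F = abs_mero f'" "\<forall>x\<in>V. f' x = f x"
    "cmeromorphic_on g' qdomain" "G = abs_mero g'" "\<forall>x\<in>V. g' x = g x"
    using assms unfolding mero_agrees_on_def by blast
  then show ?thesis
    by (intro mero_agrees_onI[of "\<lambda>x. f' x + g' x"] cmeromorphic_on_add open_qdomain)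
       (auto simp: plus_mero.abs_eq mero_rel_refl_iff)
qed

lemma mero_agrees_on_mult:
  assumes "mero_agrees_on F f V" "mero_agrees_on G g V"
  shows "mero_agrees_on (F * G) (\<lambda>x. f x * g x) V"
proof -
  obtain f' g' where "cmeromorphic_on f' qdomain" "F = abs_mero f'" "\<forall>x\<in>V. f' x = f x"
    "cmeromorphic_on g' qdomain" "G = abs_mero g'" "\<forall>x\<in>V. g' x = g x"
    using assms unfolding mero_agrees_on_def by blast
  then show ?thesis
    by (intro mero_agrees_onI[of "\<lambda>x. f' x * g' x"] cmeromorphic_on_mult open_qdomain)
       (auto simp: times_mero.abs_eq mero_rel_refl_iff)
qed

lemma mero_agrees_on_1: "mero_agrees_on 1 (\<lambda>_. 1) V"
  using mero_agrees_on_const[of 1] by (simp add: mero_const_simps)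

lemma mero_agrees_on_uminus: "mero_agrees_on F f V \<Longrightarrow> mero_agrees_on (- F) (\<lambda>x. - f x) V"
  using mero_agrees_on_mult[OF mero_agrees_on_const[of "-1"]] by (simp add: mero_const_simps)

lemma mero_agrees_on_diff:
  "mero_agrees_on F f V \<Longrightarrow> mero_agrees_on G g V \<Longrightarrow> mero_agrees_on (F - G) (\<lambda>x. f x - g x) V"
  using mero_agrees_on_add[OF _ mero_agrees_on_uminus] by simp

lemma mero_agrees_on_shift:
  assumes "mero_agrees_on F f W" "\<And>x. x \<in> V \<Longrightarrow> shift_point k x \<in> W"
  shows "mero_agrees_on (mero_shift k F) (\<lambda>x. f (shift_point k x)) V"
proof -
  obtain f' where "cmeromorphic_on f' qdomain" "F = abs_mero f'" "\<forall>x\<in>W. f' x = f x"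
    using assms unfolding mero_agrees_on_def by blast
  then show ?thesis
    using assms(2)
    by (intro mero_agrees_onI[of "\<lambda>x. f' (shift_point k x)"] cmeromorphic_on_shift)
       (auto simp: mero_shift.abs_eq mero_rel_refl_iff)
qed

lemma abs_mero_eq_iff:
  assumes "cmeromorphic_on f qdomain" "cmeromorphic_on g qdomain"
  shows "abs_mero f = abs_mero g \<longleftrightarrow> generically qdomain (\<lambda>x. f x = g x)"
  using Quotient3_rel[OF Quotient3_mero, of f g] assms by (auto simp: mero_rel_def generically_True)

lemma abs_mero_eq_0_iff:
  assumes "cmeromorphic_on f qdomain"
  shows "abs_mero f = 0 \<longleftrightarrow> generically qdomain (\<lambda>x. f x = 0)"
  unfolding zero_mero_def
  by (rule abs_mero_eq_iff[OF assms cmeromorphic_on_const[OF open_qdomain]])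

lemma mero_eq_0I:
  assumes "mero_agrees_on F g V" "open V" "V \<noteq> {}" "V \<subseteq> qdomain" "\<And>x. x \<in> V \<Longrightarrow> g x = 0"
  shows "F = 0"
proof -
  obtain f where f: "cmeromorphic_on f qdomain" "F = abs_mero f" "\<forall>x\<in>V. f x = g x"
    using assms(1) unfolding mero_agrees_on_def by blast
  then show ?thesis
    using cmeromorphic_identity[OF open_qdomain connected_qdomain f(1) assms(2-4)] assms(5)
    by (simp add: abs_mero_eq_0_iff)
qed

text \<open>A representative of zero is known to vanish on a dense open set; continuity of \<open>g\<close> gives the rest of \<open>V\<close>.\<close>

lemma mero_eq_0D:
  assumes "mero_agrees_on 0 g V" "open V" "V \<subseteq> qdomain" "continuous_on V g" "x \<in> V"
  shows "g x = 0"
proof (rule ccontr)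
  assume nz: "g x \<noteq> 0"
  obtain f where f: "cmeromorphic_on f qdomain" "0 = abs_mero f" "\<forall>x\<in>V. f x = g x"
    using assms(1) unfolding mero_agrees_on_def by blast
  have gen: "generically qdomain (\<lambda>x. f x = 0)"
    using abs_mero_eq_0_iff[OF f(1)] f(2) by simp
  have op: "open (V \<inter> g -` (- {0}))"
    using assms by (intro continuous_open_preimage) auto
  have ne: "V \<inter> g -` (- {0}) \<noteq> {}" using assms nz by auto
  obtain W where W: "W \<noteq> {}" "W \<subseteq> V \<inter> g -` (- {0})" "\<forall>x\<in>W. f x = 0"
    by (rule genericallyD[OF open_qdomain gen op ne]) (use assms in auto)
  then obtain y where y: "y \<in> W" by blast
  then have "y \<in> V" "g y \<noteq> 0" using W(2) by auto
  moreover have "f y = 0" using W(3) y by blast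
  ultimately show False using f(3) by auto
qed

section \<open>Contiguous relations\<close>

definition phi21_at :: "qpoint \<Rightarrow> complex" where
  "phi21_at x = phi21_series (x $ Va) (x $ Vb) (x $ Vc) (x $ Vq) (x $ Vz)"

lemma mero_agrees_on_phi21:
  assumes "V \<subseteq> series_region"
  shows "mero_agrees_on phi21 phi21_at V"
  unfolding phi21_at_def
proof (rule mero_agrees_onI[OF cmeromorphic_on_phi21 phi21_eq])
  fix x assume "x \<in> V"
  then have "x \<in> series_region" using assms by blast
  note h = series_regionD[OF this]
  show "phi21_num x / phi21_den x = phi21_series (x $ Va) (x $ Vb) (x $ Vc) (x $ Vq) (x $ Vz)"
    by (rule phi21_num_series[OF h(1,2) mult_power_neq_1[OF h(4,3)]])
qed

lemma mero_agrees_on_phi21_shift: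
  assumes "\<And>x. x \<in> V \<Longrightarrow> shift_point k x \<in> series_region"
  shows "mero_agrees_on (mero_shift k phi21) (\<lambda>x. phi21_at (shift_point k x)) V"
  by (rule mero_agrees_on_shift[OF mero_agrees_on_phi21[OF order_refl] assms])

lemma qdo_act_uminus: "qdo_act (- D) F = - qdo_act D F"
  using qdo_act_add_left[of D "- D" F] by (simp add: qdo_act_0 eq_neg_iff_add_eq_0 add.commute)

lemma qdo_act_diff: "qdo_act (D - E) F = qdo_act D F - qdo_act E F"
  using qdo_act_add_left[of D "- E" F] by (simp add: qdo_act_uminus)

lemma one_qdo_eq_monom: "1 = qdo_monom 1 0"
  by (simp add: one_qdo.abs_eq qdo_monom_def)

text \<open>The moduli are less than \<open>|q|\<close> instead of \<open>1\<close>, so that one inverse shift of each parameter stays within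
  the domain of convergence.\<close>

definition test_region :: "qpoint set" where
  "test_region = {x\<in>qdomain. norm (x $ Va) < norm (x $ Vq) \<and> norm (x $ Vb) < norm (x $ Vq) \<and>
     norm (x $ Vc) < norm (x $ Vq) \<and> norm (x $ Vz) < norm (x $ Vq)}"

lemma open_test_region: "open test_region"
proof -
  have "test_region = qdomain \<inter> {x. norm (x $ Va) < norm (x $ Vq)} \<inter> {x. norm (x $ Vb) < norm (x $ Vq)}
     \<inter> {x. norm (x $ Vc) < norm (x $ Vq)} \<inter> {x. norm (x $ Vz) < norm (x $ Vq)}"
    by (auto simp: test_region_def)
  moreover have "open \<dots>"
    by (intro open_Int open_qdomain open_Collect_less continuous_intros continuous_on_component)
  ultimately show ?thesis by simp
qed

lemma test_region_nonempty: "test_region \<noteq> {}"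
proof -
  have "(\<chi> i. if i = Vq then 1 / 2 else 1 / 4) \<in> test_region"
    by (simp add: test_region_def qdomain_def)
  then show ?thesis by blast
qed

lemma shift_in_unit_disc:
  fixes q :: complex
  assumes "q \<noteq> 0" "norm q < 1" "norm y < norm q" "k \<ge> -1"
  shows "norm (y * q powi k) < 1"
proof -
  have "norm q powi k \<le> norm q powi (-1)"
    using assms by (intro power_int_decreasing) auto
  then have "norm y * norm q powi k \<le> norm y * norm q powi (-1)" by (rule mult_left_mono) simp
  also have "\<dots> < 1" using assms by (simp add: field_simps)
  finally show ?thesis by (simp add: norm_mult norm_power_int)
qed

lemma annihilates_phi21I:
  assumes "mero_agrees_on (qdo_act D phi21) g test_region" "\<And>x. x \<in> test_region \<Longrightarrow> g x = 0"
  shows "D \<in> annihilator phi21"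
  unfolding annihilator_def
  using mero_eq_0I[OF assms(1) open_test_region test_region_nonempty _ assms(2)]
  by (auto simp: test_region_def)

text \<open>The relations for \<open>phi21_reg\<close> become relations for the series itself on dividing by the infinite products
  \<open>(c;q)\<^sub>\<infinity>\<close> and \<open>(q;q)\<^sub>\<infinity>\<close>, which do not vanish for \<open>|c| < 1\<close>.\<close>

context
  fixes a b c q z :: complex
  assumes q: "q \<noteq> 0" "norm q < 1" and c: "norm c < 1" and z: "norm z < 1"
begin

lemma phi21_reg_eq:
  assumes "norm c' < 1" "norm z' < 1"
  shows "phi21_reg a' b' c' q z' = qpochhammer_inf c' q * qpochhammer_inf q q * phi21_series a' b' c' q z'"
  by (rule phi21_reg_eq_series[OF q(2) assms(2) mult_power_neq_1[OF q(2) assms(1)]])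

lemma norm_times_q: "norm y < 1 \<Longrightarrow> norm (y * q) < 1"
  using q mult_strict_mono'[of "norm y" 1 "norm q" 1] by (simp add: norm_mult)

lemma factor_nonzero: "qpochhammer_inf q q \<noteq> 0" "norm c' < 1 \<Longrightarrow> qpochhammer_inf c' q \<noteq> 0"
  by (simp_all add: qpochhammer_inf_nonzero mult_power_neq_1 q)

lemma phi21_rel_z:
  "q * (1 - z) * phi21_series a b c q z - (c + q - (a + b) * q * z) * phi21_series a b c q (z * q)
    + (c - a * b * q * z) * phi21_series a b c q (z * q * q) = 0" (is "?L = 0")
proof -
  have "qpochhammer_inf c q * qpochhammer_inf q q * ?L = 0"
    using phi21_reg_rel_z[OF q(2) z, of a b c]
    by (simp only: phi21_reg_eq[OF c] z norm_times_q) algebra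
  then show ?thesis using factor_nonzero c by simp
qed

lemma phi21_rel_a:
  "(1 - a) * phi21_series (a * q) b c q z - phi21_series a b c q z + a * phi21_series a b c q (z * q) = 0"
  (is "?L = 0")
proof -
  have "qpochhammer_inf c q * qpochhammer_inf q q * ?L = 0"
    using phi21_reg_rel_a[OF q(2) z, of a b c]
    by (simp only: phi21_reg_eq[OF c] z norm_times_q) algebra
  then show ?thesis using factor_nonzero c by simp
qed

lemma phi21_rel_a_inverse:
  assumes "norm a < 1"
  shows "(a * c + a * q - c - a\<^sup>2 * q * z) * phi21_series (a * q) b c q z
    + a * (a * b * q * z - c) * phi21_series (a * q) b c q (z * q) + (c - a * q) * phi21_series a b c q z = 0"
  (is "?L = 0")
proof -
  have "(1 - a) * (qpochhammer_inf c q * qpochhammer_inf q q * ?L) = 0"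
    using phi21_reg_rel_a_inverse[OF q(2) z, of a c b]
    by (simp only: phi21_reg_eq[OF c] z norm_times_q) algebra
  moreover have "a \<noteq> 1" using assms by auto
  ultimately show ?thesis using factor_nonzero c by simp
qed

lemma phi21_rel_c:
  "z * (c - b) * (c - a) * phi21_series a b (c * q) q z
    + (c - 1) * (c\<^sup>2 + a * b * z - (a + b) * c * z) * phi21_series a b c q z
    - (c - 1) * c * (c - a * b * z) * phi21_series a b c q (z * q) = 0" (is "?L = 0")
proof -
  have "qpochhammer_inf (c * q) q * qpochhammer_inf q q * ?L = 0"
    using phi21_reg_rel_c[OF q(2) z, of c b a] qpochhammer_inf_step[OF q(2), of c]
    by (simp only: phi21_reg_eq[OF c] phi21_reg_eq[OF norm_times_q[OF c]] z norm_times_q) algebra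
  then show ?thesis using factor_nonzero norm_times_q[OF c] by simp
qed

lemma phi21_rel_c_inverse:
  "phi21_series a b (c * q) q z - c * phi21_series a b (c * q) q (z * q)
    + (c - 1) * phi21_series a b c q z = 0" (is "?L = 0")
proof -
  have "qpochhammer_inf (c * q) q * qpochhammer_inf q q * ?L = 0"
    using phi21_reg_rel_c_inverse[OF q(2) z, of a b c] qpochhammer_inf_step[OF q(2), of c]
    by (simp only: phi21_reg_eq[OF c] phi21_reg_eq[OF norm_times_q[OF c]] z norm_times_q) algebra
  then show ?thesis using factor_nonzero norm_times_q[OF c] by simp
qed

end

lemma phi21_series_commute: "phi21_series a b c q z = phi21_series b a c q z"
  by (simp add: phi21_series_def mult.commute)

lemma shift_point_nth:
  "shift_point (ka, kb, kc, kz) x $ Va = x $ Va * (x $ Vq) powi ka"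
  "shift_point (ka, kb, kc, kz) x $ Vb = x $ Vb * (x $ Vq) powi kb"
  "shift_point (ka, kb, kc, kz) x $ Vc = x $ Vc * (x $ Vq) powi kc"
  "shift_point (ka, kb, kc, kz) x $ Vz = x $ Vz * (x $ Vq) powi kz"
  "shift_point k x $ Vq = x $ Vq"
  by (simp_all add: shift_point_def)

lemma test_region_shift:
  assumes "x \<in> test_region" "kz \<ge> -1" "kc \<ge> -1"
  shows "shift_point (ka, kb, kc, kz) x \<in> series_region"
  using assms shift_in_unit_disc[of "x $ Vq" "x $ Vz" kz] shift_in_unit_disc[of "x $ Vq" "x $ Vc" kc]
    shift_point_in_qdomain[of x "(ka, kb, kc, kz)"]
  by (simp add: test_region_def series_region_def shift_point_nth) (simp add: qdomain_def)

text \<open>Writing the parameters as multiples of \<open>q\<close> lets the relations for the inverse shifts be read off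
  from the point \<open>(a, b, c, z)\<close>, with only forward shifts.\<close>

lemma test_regionE:
  assumes "x \<in> test_region"
  obtains a b c q z where "x $ Va = a * q" "x $ Vb = b * q" "x $ Vc = c * q" "x $ Vq = q" "x $ Vz = z * q"
    "q \<noteq> 0" "norm q < 1" "norm a < 1" "norm b < 1" "norm c < 1" "norm z < 1"
    "norm (a * q) < 1" "norm (b * q) < 1" "norm (c * q) < 1" "norm (z * q) < 1"
proof (rule that[of "x $ Va / x $ Vq" "x $ Vq" "x $ Vb / x $ Vq" "x $ Vc / x $ Vq" "x $ Vz / x $ Vq"])
qed (use assms in \<open>auto simp: test_region_def qdomain_def norm_divide divide_simps\<close>)

lemma qdo_monom_add: "qdo_monom r k + qdo_monom s k = qdo_monom (r + s) k"
  by (simp add: qdo_monom_def plus_qdo.abs_eq single_add)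

lemma qdo_monom_uminus: "- qdo_monom r k = qdo_monom (- r) k"
  by (simp add: qdo_monom_def uminus_qdo.abs_eq single_uminus)

lemma qdo_monom_diff: "qdo_monom r k - qdo_monom s k = qdo_monom (r - s) k"
  using qdo_monom_add[of r k "- s"] by (simp flip: qdo_monom_uminus)

abbreviation "va \<equiv> ratfun_var Va"
abbreviation "vb \<equiv> ratfun_var Vb"
abbreviation "vc \<equiv> ratfun_var Vc"
abbreviation "vq \<equiv> ratfun_var Vq"
abbreviation "vz \<equiv> ratfun_var Vz"

lemmas qdo_monom_collect = qdo_monom_add qdo_monom_uminus qdo_monom_diff qdo_monom_mult
  one_qdo_eq_monom power2_eq_square ratfun_shift_simps add_0 add_0_right mult_1_right

text \<open>The operators as sums of monomials \<open>r M\<close> with \<open>M\<close> in the group, the form in which both their action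
  and the reduction modulo them are read off.\<close>

lemma P_a_monoms: "P_a = qdo_monom (1 - va) (1, 0, 0, 0) - qdo_monom 1 0 + qdo_monom va (0, 0, 0, 1)"
  by (simp only: P_a_def qdo_monom_collect)

lemma P_b_monoms: "P_b = qdo_monom (1 - vb) (0, 1, 0, 0) - qdo_monom 1 0 + qdo_monom vb (0, 0, 0, 1)"
  by (simp only: P_b_def qdo_monom_collect)

lemma P_c_monoms: "P_c = qdo_monom (vz * (vc - vb) * (vc - va)) (0, 0, 1, 0)
    + qdo_monom ((vc - 1) * (vc\<^sup>2 + va * vb * vz - (va + vb) * vc * vz)) 0
    - qdo_monom ((vc - 1) * vc * (vc - va * vb * vz)) (0, 0, 0, 1)"
  by (simp only: P_c_def qdo_monom_collect)

lemma Q_a_monoms: "Q_a = qdo_monom (- vc * vq + va * vc + va * vq - va\<^sup>2 * vz) 0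
    + qdo_monom (va * (va * vb * vz - vc)) (0, 0, 0, 1) + qdo_monom (vq * (vc - va)) (-1, 0, 0, 0)"
  by (simp only: Q_a_def qdo_monom_collect)

lemma Q_b_monoms: "Q_b = qdo_monom (- vc * vq + vb * vc + vb * vq - vb\<^sup>2 * vz) 0
    + qdo_monom (vb * (va * vb * vz - vc)) (0, 0, 0, 1) + qdo_monom (vq * (vc - vb)) (0, -1, 0, 0)"
  by (simp only: Q_b_def qdo_monom_collect)

lemma Q_c_monoms: "Q_c = qdo_monom (- vq) 0 + qdo_monom vc (0, 0, 0, 1) + qdo_monom (vq - vc) (0, 0, -1, 0)"
  by (simp only: Q_c_def qdo_monom_collect)

lemma R_z_monoms: "R_z = qdo_monom (- (vc + vq - va * vz - vb * vz)) 0 + qdo_monom (vq - vz) (0, 0, 0, -1)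
    + qdo_monom (vc - va * vb * vz) (0, 0, 0, 1)"
  by (simp only: R_z_def qdo_monom_collect)

lemma mero_of_ratfun_diff: "mero_of_ratfun (r - s) = mero_of_ratfun r - mero_of_ratfun s"
  by (simp only: minus_ratfun_def minus_mero_def plus_ratfun.rep_eq uminus_ratfun.rep_eq)

lemmas ratfun_rep_simps = mero_of_ratfun_diff plus_ratfun.rep_eq times_ratfun.rep_eq uminus_ratfun.rep_eq
  one_ratfun.rep_eq ratfun_var.rep_eq power2_eq_square

lemma mero_agrees_on_qdo_act_monom:
  assumes "mero_agrees_on (mero_of_ratfun r) g V" "V \<subseteq> test_region" "kz \<ge> -1" "kc \<ge> -1"
  shows "mero_agrees_on (qdo_act (qdo_monom r (ka, kb, kc, kz)) phi21)
    (\<lambda>x. g x * phi21_at (shift_point (ka, kb, kc, kz) x)) V"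
  unfolding qdo_act_monom
  by (intro mero_agrees_on_mult assms mero_agrees_on_phi21_shift test_region_shift) (use assms in auto)

lemma mero_agrees_on_qdo_act_monom_0:
  assumes "mero_agrees_on (mero_of_ratfun r) g V" "V \<subseteq> test_region"
  shows "mero_agrees_on (qdo_act (qdo_monom r 0) phi21) (\<lambda>x. g x * phi21_at x) V"
  using mero_agrees_on_qdo_act_monom[OF assms, of 0 0 0 0] by (simp flip: zero_prod_def)

lemmas qdo_agrees_intros = mero_agrees_on_add mero_agrees_on_diff mero_agrees_on_mult
  mero_agrees_on_uminus mero_agrees_on_1 mero_agrees_on_var
  mero_agrees_on_qdo_act_monom mero_agrees_on_qdo_act_monom_0 order_refl

lemma P_a_annihilates: "P_a \<in> annihilator phi21"
proof (rule annihilates_phi21I)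
  show "mero_agrees_on (qdo_act P_a phi21) (\<lambda>x. (1 - x $ Va) * phi21_at (shift_point (1, 0, 0, 0) x)
      - 1 * phi21_at x + x $ Va * phi21_at (shift_point (0, 0, 0, 1) x)) test_region"
    unfolding P_a_monoms qdo_act_add_left qdo_act_diff
    by (intro qdo_agrees_intros; simp only: ratfun_rep_simps; intro qdo_agrees_intros)
next
  fix x assume "x \<in> test_region"
  then show "(1 - x $ Va) * phi21_at (shift_point (1, 0, 0, 0) x)
      - 1 * phi21_at x + x $ Va * phi21_at (shift_point (0, 0, 0, 1) x) = 0"
  proof (rule test_regionE)
    fix a b c q z assume h: "x $ Va = a * q" "x $ Vb = b * q" "x $ Vc = c * q" "x $ Vq = q" "x $ Vz = z * q"
      and q: "q \<noteq> 0" "norm q < 1" and n: "norm (c * q) < 1" "norm (z * q) < 1"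
    then show ?thesis
      using phi21_rel_a[OF q n, of "a * q" "b * q"] by (simp add: phi21_at_def shift_point_nth h)
  qed
qed

lemma P_b_annihilates: "P_b \<in> annihilator phi21"
proof (rule annihilates_phi21I)
  show "mero_agrees_on (qdo_act P_b phi21) (\<lambda>x. (1 - x $ Vb) * phi21_at (shift_point (0, 1, 0, 0) x)
      - 1 * phi21_at x + x $ Vb * phi21_at (shift_point (0, 0, 0, 1) x)) test_region"
    unfolding P_b_monoms qdo_act_add_left qdo_act_diff
    by (intro qdo_agrees_intros; simp only: ratfun_rep_simps; intro qdo_agrees_intros)
next
  fix x assume "x \<in> test_region"
  then show "(1 - x $ Vb) * phi21_at (shift_point (0, 1, 0, 0) x)
      - 1 * phi21_at x + x $ Vb * phi21_at (shift_point (0, 0, 0, 1) x) = 0"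
  proof (rule test_regionE)
    fix a b c q z assume h: "x $ Va = a * q" "x $ Vb = b * q" "x $ Vc = c * q" "x $ Vq = q" "x $ Vz = z * q"
      and q: "q \<noteq> 0" "norm q < 1" and n: "norm (c * q) < 1" "norm (z * q) < 1"
    then show ?thesis
      using phi21_rel_a[OF q n, of "b * q" "a * q"]
      by (simp add: phi21_at_def shift_point_nth h phi21_series_commute[of "a * q"])
  qed
qed

lemma P_c_annihilates: "P_c \<in> annihilator phi21"
proof (rule annihilates_phi21I)
  show "mero_agrees_on (qdo_act P_c phi21) (\<lambda>x.
        x $ Vz * (x $ Vc - x $ Vb) * (x $ Vc - x $ Va) * phi21_at (shift_point (0, 0, 1, 0) x)
      + (x $ Vc - 1) * (x $ Vc * x $ Vc + x $ Va * x $ Vb * x $ Vz - (x $ Va + x $ Vb) * x $ Vc * x $ Vz) * phi21_at x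
      - (x $ Vc - 1) * x $ Vc * (x $ Vc - x $ Va * x $ Vb * x $ Vz) * phi21_at (shift_point (0, 0, 0, 1) x)) test_region"
    unfolding P_c_monoms qdo_act_add_left qdo_act_diff
    by (intro qdo_agrees_intros; simp only: ratfun_rep_simps; intro qdo_agrees_intros)
next
  fix x assume "x \<in> test_region"
  then show "x $ Vz * (x $ Vc - x $ Vb) * (x $ Vc - x $ Va) * phi21_at (shift_point (0, 0, 1, 0) x)
      + (x $ Vc - 1) * (x $ Vc * x $ Vc + x $ Va * x $ Vb * x $ Vz - (x $ Va + x $ Vb) * x $ Vc * x $ Vz) * phi21_at x
      - (x $ Vc - 1) * x $ Vc * (x $ Vc - x $ Va * x $ Vb * x $ Vz) * phi21_at (shift_point (0, 0, 0, 1) x) = 0"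
  proof (rule test_regionE)
    fix a b c q z assume h: "x $ Va = a * q" "x $ Vb = b * q" "x $ Vc = c * q" "x $ Vq = q" "x $ Vz = z * q"
      and q: "q \<noteq> 0" "norm q < 1" and n: "norm (c * q) < 1" "norm (z * q) < 1"
    then show ?thesis
      using phi21_rel_c[OF q n, of "b * q" "a * q"]
      by (simp add: phi21_at_def shift_point_nth h power2_eq_square del: mult_eq_0_iff)
  qed
qed

lemma Q_a_annihilates: "Q_a \<in> annihilator phi21"
proof (rule annihilates_phi21I)
  show "mero_agrees_on (qdo_act Q_a phi21) (\<lambda>x.
        (- x $ Vc * x $ Vq + x $ Va * x $ Vc + x $ Va * x $ Vq - x $ Va * x $ Va * x $ Vz) * phi21_at x
      + x $ Va * (x $ Va * x $ Vb * x $ Vz - x $ Vc) * phi21_at (shift_point (0, 0, 0, 1) x)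
      + x $ Vq * (x $ Vc - x $ Va) * phi21_at (shift_point (-1, 0, 0, 0) x)) test_region"
    unfolding Q_a_monoms qdo_act_add_left qdo_act_diff
    by (intro qdo_agrees_intros; simp only: ratfun_rep_simps; intro qdo_agrees_intros)
next
  fix x assume "x \<in> test_region"
  then show "(- x $ Vc * x $ Vq + x $ Va * x $ Vc + x $ Va * x $ Vq - x $ Va * x $ Va * x $ Vz) * phi21_at x
      + x $ Va * (x $ Va * x $ Vb * x $ Vz - x $ Vc) * phi21_at (shift_point (0, 0, 0, 1) x)
      + x $ Vq * (x $ Vc - x $ Va) * phi21_at (shift_point (-1, 0, 0, 0) x) = 0"
  proof (rule test_regionE)
    fix a b c q z assume h: "x $ Va = a * q" "x $ Vb = b * q" "x $ Vc = c * q" "x $ Vq = q" "x $ Vz = z * q"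
      and q: "q \<noteq> 0" "norm q < 1" and n: "norm (c * q) < 1" "norm (z * q) < 1" and a: "norm a < 1"
    have "q * q powi -1 = 1" using q by (simp add: power_int_minus)
    then show ?thesis
      using phi21_rel_a_inverse[OF q n a, of "b * q"]
      unfolding phi21_at_def shift_point_nth h mult.assoc[of _ q "q powi -1"]
      by simp algebra
  qed
qed

lemma Q_b_annihilates: "Q_b \<in> annihilator phi21"
proof (rule annihilates_phi21I)
  show "mero_agrees_on (qdo_act Q_b phi21) (\<lambda>x.
        (- x $ Vc * x $ Vq + x $ Vb * x $ Vc + x $ Vb * x $ Vq - x $ Vb * x $ Vb * x $ Vz) * phi21_at x
      + x $ Vb * (x $ Va * x $ Vb * x $ Vz - x $ Vc) * phi21_at (shift_point (0, 0, 0, 1) x)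
      + x $ Vq * (x $ Vc - x $ Vb) * phi21_at (shift_point (0, -1, 0, 0) x)) test_region"
    unfolding Q_b_monoms qdo_act_add_left qdo_act_diff
    by (intro qdo_agrees_intros; simp only: ratfun_rep_simps; intro qdo_agrees_intros)
next
  fix x assume "x \<in> test_region"
  then show "(- x $ Vc * x $ Vq + x $ Vb * x $ Vc + x $ Vb * x $ Vq - x $ Vb * x $ Vb * x $ Vz) * phi21_at x
      + x $ Vb * (x $ Va * x $ Vb * x $ Vz - x $ Vc) * phi21_at (shift_point (0, 0, 0, 1) x)
      + x $ Vq * (x $ Vc - x $ Vb) * phi21_at (shift_point (0, -1, 0, 0) x) = 0"
  proof (rule test_regionE)
    fix a b c q z assume h: "x $ Va = a * q" "x $ Vb = b * q" "x $ Vc = c * q" "x $ Vq = q" "x $ Vz = z * q"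
      and q: "q \<noteq> 0" "norm q < 1" and n: "norm (c * q) < 1" "norm (z * q) < 1" and b: "norm b < 1"
    have "q * q powi -1 = 1" using q by (simp add: power_int_minus)
    then show ?thesis
      using phi21_rel_a_inverse[OF q n b, of "a * q"]
      unfolding phi21_at_def shift_point_nth h mult.assoc[of _ q "q powi -1"]
      by (simp add: phi21_series_commute[of "a * q"]) algebra
  qed
qed

lemma Q_c_annihilates: "Q_c \<in> annihilator phi21"
proof (rule annihilates_phi21I)
  show "mero_agrees_on (qdo_act Q_c phi21) (\<lambda>x. - x $ Vq * phi21_at x
      + x $ Vc * phi21_at (shift_point (0, 0, 0, 1) x)
      + (x $ Vq - x $ Vc) * phi21_at (shift_point (0, 0, -1, 0) x)) test_region"
    unfolding Q_c_monoms qdo_act_add_left qdo_act_diff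
    by (intro qdo_agrees_intros; simp only: ratfun_rep_simps; intro qdo_agrees_intros)
next
  fix x assume "x \<in> test_region"
  then show "- x $ Vq * phi21_at x
      + x $ Vc * phi21_at (shift_point (0, 0, 0, 1) x)
      + (x $ Vq - x $ Vc) * phi21_at (shift_point (0, 0, -1, 0) x) = 0"
  proof (rule test_regionE)
    fix a b c q z assume h: "x $ Va = a * q" "x $ Vb = b * q" "x $ Vc = c * q" "x $ Vq = q" "x $ Vz = z * q"
      and q: "q \<noteq> 0" "norm q < 1" and n: "norm c < 1" "norm (z * q) < 1"
    have "q * q powi -1 = 1" using q by (simp add: power_int_minus)
    then show ?thesis
      using phi21_rel_c_inverse[OF q n, of "a * q" "b * q"]
      unfolding phi21_at_def shift_point_nth h mult.assoc[of _ q "q powi -1"]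
      by simp algebra
  qed
qed

lemma R_z_annihilates: "R_z \<in> annihilator phi21"
proof (rule annihilates_phi21I)
  show "mero_agrees_on (qdo_act R_z phi21) (\<lambda>x.
      - (x $ Vc + x $ Vq - x $ Va * x $ Vz - x $ Vb * x $ Vz) * phi21_at x
      + (x $ Vq - x $ Vz) * phi21_at (shift_point (0, 0, 0, -1) x)
      + (x $ Vc - x $ Va * x $ Vb * x $ Vz) * phi21_at (shift_point (0, 0, 0, 1) x)) test_region"
    unfolding R_z_monoms qdo_act_add_left qdo_act_diff
    by (intro qdo_agrees_intros; simp only: ratfun_rep_simps; intro qdo_agrees_intros)
next
  fix x assume "x \<in> test_region"
  then show "- (x $ Vc + x $ Vq - x $ Va * x $ Vz - x $ Vb * x $ Vz) * phi21_at x
      + (x $ Vq - x $ Vz) * phi21_at (shift_point (0, 0, 0, -1) x)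
      + (x $ Vc - x $ Va * x $ Vb * x $ Vz) * phi21_at (shift_point (0, 0, 0, 1) x) = 0"
  proof (rule test_regionE)
    fix a b c q z assume h: "x $ Va = a * q" "x $ Vb = b * q" "x $ Vc = c * q" "x $ Vq = q" "x $ Vz = z * q"
      and q: "q \<noteq> 0" "norm q < 1" and n: "norm (c * q) < 1" "norm z < 1"
    have "q * q powi -1 = 1" using q by (simp add: power_int_minus)
    then show ?thesis
      using phi21_rel_z[OF q n, of "a * q" "b * q"]
      unfolding phi21_at_def shift_point_nth h mult.assoc[of _ q "q powi -1"]
      by simp algebra
  qed
qed

section \<open>Reduction modulo the seven operators\<close>

lemma mero_of_ratfun_eq_0_iff: "mero_of_ratfun r = 0 \<longleftrightarrow> r = 0"
  by (simp flip: mero_of_ratfun_inject add: zero_ratfun.rep_eq)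

lemma ratfun_nonzeroI:
  assumes "mero_agrees_on (mero_of_ratfun r) g qdomain" "continuous_on qdomain g" "x \<in> qdomain" "g x \<noteq> 0"
  shows "r \<noteq> 0"
proof
  assume "r = 0"
  then have "mero_agrees_on 0 g qdomain" using assms(1) by (simp add: zero_ratfun.rep_eq)
  then have "g x = 0" by (rule mero_eq_0D[OF _ open_qdomain order_refl assms(2,3)])
  with assms(4) show False by simp
qed

lemma ratfun_shift_eq_0_iff: "ratfun_shift k r = 0 \<longleftrightarrow> r = 0"
proof
  assume "ratfun_shift k r = 0"
  then have "ratfun_shift (- k) (ratfun_shift k r) = 0" by (simp only: ratfun_shift_simps)
  then show "r = 0" by simp
qed simp

text \<open>The coefficients by which the reduction divides. A rational function that agrees with a given continuous
  function on the whole domain is nonzero if that function is nonzero at a single point.\<close>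

lemma leading_coeff_nonzero:
  "1 - va \<noteq> 0" "1 - vb \<noteq> 0" "vz * (vc - vb) * (vc - va) \<noteq> 0" "vq * (vc - va) \<noteq> 0" "vq * (vc - vb) \<noteq> 0"
  "vq - vc \<noteq> 0" "vq - vz \<noteq> 0" "vc - va * vb * vz \<noteq> 0"
proof -
  \<comment> \<open>A point of the domain at which none of the eight expressions vanishes.\<close>
  let ?x = "\<chi> i. case i of Va \<Rightarrow> 2 | Vb \<Rightarrow> 3 | Vc \<Rightarrow> 5 | Vq \<Rightarrow> 1 / 2 | Vz \<Rightarrow> 7 :: complex"
  have x: "?x \<in> qdomain" by (simp add: qdomain_def)
  note agree = mero_agrees_on_diff mero_agrees_on_mult mero_agrees_on_1 mero_agrees_on_var
    continuous_on_diff continuous_on_mult continuous_on_const continuous_on_component continuous_on_id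
  show "1 - va \<noteq> 0"
    by (rule ratfun_nonzeroI[of _ "\<lambda>x. 1 - x $ Va", OF _ _ x]; (simp only: ratfun_rep_simps)?; (intro agree)?; simp)
  show "1 - vb \<noteq> 0"
    by (rule ratfun_nonzeroI[of _ "\<lambda>x. 1 - x $ Vb", OF _ _ x]; (simp only: ratfun_rep_simps)?; (intro agree)?; simp)
  show "vz * (vc - vb) * (vc - va) \<noteq> 0"
    by (rule ratfun_nonzeroI[of _ "\<lambda>x. x $ Vz * (x $ Vc - x $ Vb) * (x $ Vc - x $ Va)", OF _ _ x];
        (simp only: ratfun_rep_simps)?; (intro agree)?; simp)
  show "vq * (vc - va) \<noteq> 0"
    by (rule ratfun_nonzeroI[of _ "\<lambda>x. x $ Vq * (x $ Vc - x $ Va)", OF _ _ x];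
        (simp only: ratfun_rep_simps)?; (intro agree)?; simp)
  show "vq * (vc - vb) \<noteq> 0"
    by (rule ratfun_nonzeroI[of _ "\<lambda>x. x $ Vq * (x $ Vc - x $ Vb)", OF _ _ x];
        (simp only: ratfun_rep_simps)?; (intro agree)?; simp)
  show "vq - vc \<noteq> 0"
    by (rule ratfun_nonzeroI[of _ "\<lambda>x. x $ Vq - x $ Vc", OF _ _ x];
        (simp only: ratfun_rep_simps)?; (intro agree)?; simp)
  show "vq - vz \<noteq> 0"
    by (rule ratfun_nonzeroI[of _ "\<lambda>x. x $ Vq - x $ Vz", OF _ _ x];
        (simp only: ratfun_rep_simps)?; (intro agree)?; simp)
  show "vc - va * vb * vz \<noteq> 0"
    by (rule ratfun_nonzeroI[of _ "\<lambda>x. x $ Vc - x $ Va * x $ Vb * x $ Vz", OF _ _ x];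
        (simp only: ratfun_rep_simps)?; (intro agree)?; simp)
qed

lemma left_ideal_closed:
  assumes "left_ideal J"
  shows "0 \<in> J" "x \<in> J \<Longrightarrow> y \<in> J \<Longrightarrow> x + y \<in> J" "x \<in> J \<Longrightarrow> r * x \<in> J"
    "x \<in> J \<Longrightarrow> - x \<in> J" "x \<in> J \<Longrightarrow> y \<in> J \<Longrightarrow> x - y \<in> J"
proof -
  show add: "x \<in> J \<Longrightarrow> y \<in> J \<Longrightarrow> x + y \<in> J" and mult: "x \<in> J \<Longrightarrow> r * x \<in> J" and "0 \<in> J" for x y r
    using assms by (auto simp: left_ideal_def)
  show minus: "- x \<in> J" if "x \<in> J" for x using mult[OF that, of "-1"] by simp
  show "x \<in> J \<Longrightarrow> y \<in> J \<Longrightarrow> x - y \<in> J" using add[of x "- y"] minus[of y] by simp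
qed

abbreviation shift_z :: qshift where "shift_z \<equiv> (0, 0, 0, 1)"

definition first_order_mod :: "qdo set \<Rightarrow> qdo set" where
  "first_order_mod J = {D. \<exists>r s. D - (qdo_monom r 0 + qdo_monom s shift_z) \<in> J}"

lemma first_order_modI: "D - (qdo_monom r 0 + qdo_monom s shift_z) \<in> J \<Longrightarrow> D \<in> first_order_mod J"
  unfolding first_order_mod_def by blast

lemma qdo_monom_0: "qdo_monom 0 k = 0"
  by (simp add: qdo_monom_def zero_qdo.abs_eq)

context
  fixes J :: "qdo set"
  assumes J: "left_ideal J"
begin

lemma first_order_mod_add:
  assumes "D \<in> first_order_mod J" "E \<in> first_order_mod J"
  shows "D + E \<in> first_order_mod J"
proof -
  obtain r s r' s' where "D - (qdo_monom r 0 + qdo_monom s shift_z) \<in> J"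
      "E - (qdo_monom r' 0 + qdo_monom s' shift_z) \<in> J"
    using assms unfolding first_order_mod_def by blast
  from left_ideal_closed(2)[OF J this] show ?thesis
    by (intro first_order_modI[of _ "r + r'" "s + s'"]) (simp add: algebra_simps flip: qdo_monom_add)
qed

lemma first_order_mod_scale:
  assumes "D \<in> first_order_mod J"
  shows "qdo_monom t 0 * D \<in> first_order_mod J"
proof -
  obtain r s where "D - (qdo_monom r 0 + qdo_monom s shift_z) \<in> J"
    using assms unfolding first_order_mod_def by blast
  from left_ideal_closed(3)[OF J this, of "qdo_monom t 0"] show ?thesis
    by (intro first_order_modI[of _ "t * r" "t * s"]) (simp add: algebra_simps qdo_monom_mult)
qed

lemma first_order_mod_ideal: "D \<in> J \<Longrightarrow> D \<in> first_order_mod J"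
  by (rule first_order_modI[of _ 0 0]) (simp add: qdo_monom_0)

definition reducible :: "qshift \<Rightarrow> bool" where
  "reducible k \<longleftrightarrow> (\<forall>t. qdo_monom t k \<in> first_order_mod J)"

lemma reducible_0: "reducible 0" and reducible_z: "reducible shift_z"
  unfolding reducible_def
  by (auto intro!: first_order_modI[of "qdo_monom t 0" t 0 for t] first_order_modI[of "qdo_monom t shift_z" 0 t for t]
      simp: qdo_monom_0 left_ideal_closed[OF J])

text \<open>An element of \<open>J\<close> can be solved for a monomial with nonzero coefficient.\<close>

lemma reducible_leading:
  assumes "qdo_monom r k + E \<in> J" "r \<noteq> 0" "E \<in> first_order_mod J"
  shows "reducible k"
  unfolding reducible_def
proof
  fix t
  have "qdo_monom (t / r) 0 * (qdo_monom r k + E) \<in> J" by (rule left_ideal_closed(3)[OF J assms(1)])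
  then have "qdo_monom t k + qdo_monom (t / r) 0 * E \<in> J"
    using assms(2) by (simp add: algebra_simps qdo_monom_mult)
  then have "(qdo_monom t k + qdo_monom (t / r) 0 * E) + qdo_monom (-1) 0 * (qdo_monom (t / r) 0 * E) \<in> first_order_mod J"
    by (intro first_order_mod_add first_order_mod_ideal first_order_mod_scale assms(3))
  moreover have "qdo_monom (-1) 0 = (-1 :: qdo)"
    by (simp add: one_qdo_eq_monom qdo_monom_uminus)
  ultimately show "qdo_monom t k \<in> first_order_mod J" by simp
qed

lemma reducible_monom: "reducible k \<Longrightarrow> qdo_monom t k \<in> first_order_mod J"
  by (simp add: reducible_def)

text \<open>Multiplying \<open>M\<^sub>l \<equiv> r + s Z\<close> on the left by \<open>M\<^sub>k\<close> leaves \<open>M\<^sub>k\<close> and \<open>M\<^sub>k Z\<close> with shifted coefficients,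
  which have to be reduced in turn.\<close>

lemma reducible_add:
  assumes "reducible k" "reducible (k + shift_z)" "reducible l"
  shows "reducible (k + l)"
  unfolding reducible_def
proof
  fix t
  obtain r s where "qdo_monom 1 l - (qdo_monom r 0 + qdo_monom s shift_z) \<in> J"
    using reducible_monom[OF assms(3)] unfolding first_order_mod_def by blast
  from left_ideal_closed(3)[OF J this, of "qdo_monom t k"]
  have "qdo_monom t (k + l) - (qdo_monom (t * ratfun_shift k r) k + qdo_monom (t * ratfun_shift k s) (k + shift_z)) \<in> J"
    by (simp add: algebra_simps qdo_monom_mult)
  then have "(qdo_monom t (k + l) - (qdo_monom (t * ratfun_shift k r) k + qdo_monom (t * ratfun_shift k s) (k + shift_z)))
     + (qdo_monom (t * ratfun_shift k r) k + qdo_monom (t * ratfun_shift k s) (k + shift_z)) \<in> first_order_mod J"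
    by (intro first_order_mod_add first_order_mod_ideal reducible_monom assms)
  then show "qdo_monom t (k + l) \<in> first_order_mod J" by simp
qed

text \<open>The crucial element is \<open>Z R\<^sub>z\<close>, which reduces \<open>Z\<^sup>2\<close>: it makes reducibility stable under \<open>Z\<close>, so that
  the second premise of \<open>reducible_add\<close> follows from the first. It then suffices to reduce the eight generators
  of the group: \<open>Z\<close> is a remainder itself, and each of the others is the leading monomial of one operator.\<close>

lemma all_reducible:
  assumes gens: "{P_a, P_b, P_c, Q_a, Q_b, Q_c, R_z} \<subseteq> J"
  shows "reducible (ka, kb, kc, kz)"
proof -
  note low = first_order_mod_add reducible_monom[OF reducible_0] reducible_monom[OF reducible_z]
  have 2: "reducible (shift_z + shift_z)"
  proof (rule reducible_leading)
    have "qdo_monom 1 shift_z * R_z \<in> J" using gens by (intro left_ideal_closed(3)[OF J]) auto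
    then show "qdo_monom (ratfun_shift shift_z (vc - va * vb * vz)) (shift_z + shift_z) +
       (qdo_monom (ratfun_shift shift_z (- (vc + vq - va * vz - vb * vz))) shift_z +
        qdo_monom (ratfun_shift shift_z (vq - vz)) 0) \<in> J"
      unfolding R_z_monoms distrib_left qdo_monom_mult by (simp add: ac_simps zero_prod_def)
    show "ratfun_shift shift_z (vc - va * vb * vz) \<noteq> 0"
      unfolding ratfun_shift_eq_0_iff by (rule leading_coeff_nonzero)
  qed (intro low)
  have neg: "reducible (0, 0, 0, -1)"
  proof (rule reducible_leading)
    show "qdo_monom (vq - vz) (0, 0, 0, -1) + (qdo_monom (- (vc + vq - va * vz - vb * vz)) 0 +
        qdo_monom (vc - va * vb * vz) shift_z) \<in> J"
      using gens by (simp add: R_z_monoms ac_simps)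
  qed (intro low leading_coeff_nonzero)+
  have zp: "reducible (shift_z + l)" if "reducible l" for l
    by (rule reducible_add[OF reducible_z 2 that])
  have zm: "reducible ((0, 0, 0, -1) + l)" if "reducible l" for l
    using reducible_add[OF neg _ that] reducible_0 by (simp add: zero_prod_def)
  have step: "reducible (k + l)" if "reducible k" "reducible l" for k l
    using reducible_add[OF that(1) _ that(2)] zp[OF that(1)] by (simp add: add.commute)
  have a: "reducible (1, 0, 0, 0)"
  proof (rule reducible_leading)
    show "qdo_monom (1 - va) (1, 0, 0, 0) + (qdo_monom (- 1) 0 + qdo_monom va shift_z) \<in> J"
      using gens by (simp add: P_a_monoms algebra_simps flip: qdo_monom_uminus)
  qed (intro low leading_coeff_nonzero)+
  have b: "reducible (0, 1, 0, 0)"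
  proof (rule reducible_leading)
    show "qdo_monom (1 - vb) (0, 1, 0, 0) + (qdo_monom (- 1) 0 + qdo_monom vb shift_z) \<in> J"
      using gens by (simp add: P_b_monoms algebra_simps flip: qdo_monom_uminus)
  qed (intro low leading_coeff_nonzero)+
  have c: "reducible (0, 0, 1, 0)"
  proof (rule reducible_leading)
    show "qdo_monom (vz * (vc - vb) * (vc - va)) (0, 0, 1, 0) +
       (qdo_monom ((vc - 1) * (vc\<^sup>2 + va * vb * vz - (va + vb) * vc * vz)) 0
        + qdo_monom (- ((vc - 1) * vc * (vc - va * vb * vz))) shift_z) \<in> J"
      using gens unfolding qdo_monom_uminus[symmetric] by (simp add: P_c_monoms add_diff_eq)
  qed (intro low leading_coeff_nonzero)+
  have a': "reducible (-1, 0, 0, 0)"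
  proof (rule reducible_leading)
    show "qdo_monom (vq * (vc - va)) (-1, 0, 0, 0) +
       (qdo_monom (- vc * vq + va * vc + va * vq - va\<^sup>2 * vz) 0
        + qdo_monom (va * (va * vb * vz - vc)) shift_z) \<in> J"
      using gens by (simp add: Q_a_monoms add.assoc add.commute)
  qed (intro low leading_coeff_nonzero)+
  have b': "reducible (0, -1, 0, 0)"
  proof (rule reducible_leading)
    show "qdo_monom (vq * (vc - vb)) (0, -1, 0, 0) +
       (qdo_monom (- vc * vq + vb * vc + vb * vq - vb\<^sup>2 * vz) 0
        + qdo_monom (vb * (va * vb * vz - vc)) shift_z) \<in> J"
      using gens by (simp add: Q_b_monoms add.assoc add.commute)
  qed (intro low leading_coeff_nonzero)+
  have c': "reducible (0, 0, -1, 0)"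
  proof (rule reducible_leading)
    show "qdo_monom (vq - vc) (0, 0, -1, 0) + (qdo_monom (- vq) 0 + qdo_monom vc shift_z) \<in> J"
      using gens by (simp add: Q_c_monoms add.assoc add.commute)
  qed (intro low leading_coeff_nonzero)+
  have 1: "reducible (i, 0, 0, 0)" for i
  proof (induction i rule: int_induct[where k = 0])
    case base show ?case using reducible_0 by (simp add: zero_prod_def)
  next
    case (step1 i) then show ?case using step[OF _ a] by fastforce
  next
    case (step2 i) then show ?case using step[OF _ a'] by fastforce
  qed
  have 2: "reducible (0, i, 0, 0)" for i
  proof (induction i rule: int_induct[where k = 0])
    case base show ?case using reducible_0 by (simp add: zero_prod_def)
  next
    case (step1 i) then show ?case using step[OF _ b] by fastforce
  next
    case (step2 i) then show ?case using step[OF _ b'] by fastforce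
  qed
  have 3: "reducible (0, 0, i, 0)" for i
  proof (induction i rule: int_induct[where k = 0])
    case base show ?case using reducible_0 by (simp add: zero_prod_def)
  next
    case (step1 i) then show ?case using step[OF _ c] by fastforce
  next
    case (step2 i) then show ?case using step[OF _ c'] by fastforce
  qed
  have 4: "reducible (0, 0, 0, i)" for i
  proof (induction i rule: int_induct[where k = 0])
    case base show ?case using reducible_0 by (simp add: zero_prod_def)
  next
    case (step1 i) then show ?case using step[OF _ reducible_z] by fastforce
  next
    case (step2 i) then show ?case using step[OF _ neg] by fastforce
  qed
  have "reducible ((ka, 0, 0, 0) + ((0, kb, 0, 0) + ((0, 0, kc, 0) + (0, 0, 0, kz))))"
    by (intro step 1 2 3 4)
  then show ?thesis by simp
qed

lemma first_order_mod_eq_UNIV: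
  assumes "{P_a, P_b, P_c, Q_a, Q_b, Q_c, R_z} \<subseteq> J"
  shows "D \<in> first_order_mod J"
proof (induction D rule: qdo_additive_induct)
  case zero show ?case by (rule first_order_mod_ideal[OF left_ideal_closed(1)[OF J]])
next
  case (monom r k)
  obtain ka kb kc kz where k: "k = (ka, kb, kc, kz)" by (cases k) auto
  show ?case unfolding k by (rule reducible_monom[OF all_reducible[OF assms]])
qed (rule first_order_mod_add)

end

section \<open>Independence over the rational functions\<close>

text \<open>Polynomials in the five coordinates as functions; they represent the numerators and denominators of the
  rational functions and, unlike meromorphic functions, have values everywhere.\<close>

inductive_set polyfun :: "(qpoint \<Rightarrow> complex) set" where
  const: "(\<lambda>_. k) \<in> polyfun"
| var: "(\<lambda>x. x $ i) \<in> polyfun"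
| add: "f \<in> polyfun \<Longrightarrow> g \<in> polyfun \<Longrightarrow> (\<lambda>x. f x + g x) \<in> polyfun"
| mult: "f \<in> polyfun \<Longrightarrow> g \<in> polyfun \<Longrightarrow> (\<lambda>x. f x * g x) \<in> polyfun"

lemma cholomorphic_on_polyfun: "f \<in> polyfun \<Longrightarrow> cholomorphic_on f U"
  by (induction rule: polyfun.induct) (auto intro: cholomorphic_intros)

lemma mero_rel_polyfun: "f \<in> polyfun \<Longrightarrow> mero_rel f f"
  by (simp add: mero_rel_refl_iff cholomorphic_imp_cmeromorphic_on open_qdomain cholomorphic_on_polyfun)

lemma abs_mero_add: "f \<in> polyfun \<Longrightarrow> g \<in> polyfun \<Longrightarrow> abs_mero (\<lambda>x. f x + g x) = abs_mero f + abs_mero g"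
  by (simp add: plus_mero.abs_eq mero_rel_polyfun)

lemma abs_mero_mult: "f \<in> polyfun \<Longrightarrow> g \<in> polyfun \<Longrightarrow> abs_mero (\<lambda>x. f x * g x) = abs_mero f * abs_mero g"
  by (simp add: times_mero.abs_eq mero_rel_polyfun)

lemma mero_agrees_on_polyfun: "f \<in> polyfun \<Longrightarrow> mero_agrees_on (abs_mero f) f V"
  using mero_rel_polyfun by (intro mero_agrees_onI[of f]) (auto simp: mero_rel_refl_iff)

lemma rational_function_fraction:
  assumes "F \<in> rational_functions"
  shows "\<exists>p\<in>polyfun. \<exists>s\<in>polyfun. abs_mero s \<noteq> 0 \<and> F * abs_mero s = abs_mero p"
  using assms
proof (induction rule: rational_functions.induct)
  case (const k)
  have "abs_mero (\<lambda>_. 1) = 1" by (simp add: one_mero_def)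
  then show ?case
    by (intro bexI[of _ "\<lambda>_. k"] bexI[of _ "\<lambda>_. 1"] polyfun.const) (simp add: mero_const_def)
next
  case (var i)
  have "abs_mero (\<lambda>_. 1) = 1" by (simp add: one_mero_def)
  then show ?case
    by (intro bexI[of _ "\<lambda>x. x $ i"] bexI[of _ "\<lambda>_. 1"] polyfun.const polyfun.var) (simp add: mero_var_def)
next
  case (add F G)
  then obtain p s p' s' where h: "p \<in> polyfun" "s \<in> polyfun" "abs_mero s \<noteq> 0" "F * abs_mero s = abs_mero p"
    "p' \<in> polyfun" "s' \<in> polyfun" "abs_mero s' \<noteq> 0" "G * abs_mero s' = abs_mero p'" by blast
  have "(F + G) * (abs_mero s * abs_mero s') = abs_mero p * abs_mero s' + abs_mero p' * abs_mero s"
    by (simp flip: h(4,8) add: algebra_simps)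
  then show ?case using h
    by (intro bexI[of _ "\<lambda>x. p x * s' x + p' x * s x"] bexI[of _ "\<lambda>x. s x * s' x"] polyfun.add polyfun.mult h)
       (simp add: abs_mero_add abs_mero_mult polyfun.mult)
next
  case (mult F G)
  then obtain p s p' s' where h: "p \<in> polyfun" "s \<in> polyfun" "abs_mero s \<noteq> 0" "F * abs_mero s = abs_mero p"
    "p' \<in> polyfun" "s' \<in> polyfun" "abs_mero s' \<noteq> 0" "G * abs_mero s' = abs_mero p'" by blast
  have "(F * G) * (abs_mero s * abs_mero s') = abs_mero p * abs_mero p'"
    by (simp flip: h(4,8) add: algebra_simps)
  then show ?case using h
    by (intro bexI[of _ "\<lambda>x. p x * p' x"] bexI[of _ "\<lambda>x. s x * s' x"] polyfun.mult h)
       (simp add: abs_mero_mult)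
next
  case (inverse F)
  then obtain p s where h: "p \<in> polyfun" "s \<in> polyfun" "abs_mero s \<noteq> 0" "F * abs_mero s = abs_mero p" by blast
  show ?case
  proof (cases "F = 0")
    case True
    have "abs_mero (\<lambda>_. 0) = 0" by (simp add: zero_mero_def)
    with True h show ?thesis by (intro bexI[of _ "\<lambda>_. 0"] bexI[of _ s] polyfun.const) auto
  next
    case False
    then show ?thesis using h
      by (intro bexI[of _ s] bexI[of _ p]) (auto simp flip: h(4))
  qed
qed

definition qpt :: "complex \<Rightarrow> complex \<Rightarrow> complex \<Rightarrow> complex \<Rightarrow> complex \<Rightarrow> qpoint" where
  "qpt a b c q z = (\<chi> i. case i of Va \<Rightarrow> a | Vb \<Rightarrow> b | Vc \<Rightarrow> c | Vq \<Rightarrow> q | Vz \<Rightarrow> z)"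

lemma qpt_nth [simp]: "qpt a b c q z $ Va = a" "qpt a b c q z $ Vb = b" "qpt a b c q z $ Vc = c"
  "qpt a b c q z $ Vq = q" "qpt a b c q z $ Vz = z"
  by (simp_all add: qpt_def)

lemma qpt_eta: "x = qpt (x $ Va) (x $ Vb) (x $ Vc) (x $ Vq) (x $ Vz)"
proof -
  have "x $ i = qpt (x $ Va) (x $ Vb) (x $ Vc) (x $ Vq) (x $ Vz) $ i" for i by (cases i) simp_all
  then show ?thesis unfolding vec_eq_iff by blast
qed

text \<open>For fixed \<open>a\<close>, \<open>b\<close>, \<open>q\<close> a polynomial in \<open>c\<close> and \<open>z\<close>. The outer variable of \<open>P\<close> is \<open>z\<close>, since the
  coefficients of the powers of \<open>z\<close> have to be compared as polynomials in \<open>c\<close>.\<close>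

lemma polyfun_as_poly:
  assumes "f \<in> polyfun"
  shows "\<exists>P :: complex poly poly. \<forall>c z. f (qpt a b c q z) = poly (poly P [:z:]) c"
  using assms
proof (induction rule: polyfun.induct)
  case (const k)
  show ?case by (rule exI[of _ "[:[:k:]:]"]) simp
next
  case (var i)
  show ?case
  proof (cases i)
    case Va then show ?thesis by (intro exI[of _ "[:[:a:]:]"]) simp
  next
    case Vb then show ?thesis by (intro exI[of _ "[:[:b:]:]"]) simp
  next
    case Vc then show ?thesis by (intro exI[of _ "[:[:0, 1:]:]"]) simp
  next
    case Vq then show ?thesis by (intro exI[of _ "[:[:q:]:]"]) simp
  next
    case Vz then show ?thesis by (intro exI[of _ "[:0, 1:]"]) simp
  qed
next
  case (add f g)
  then obtain P Q :: "complex poly poly" where "\<forall>c z. f (qpt a b c q z) = poly (poly P [:z:]) c"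
    "\<forall>c z. g (qpt a b c q z) = poly (poly Q [:z:]) c" by blast
  then show ?case by (intro exI[of _ "P + Q"]) simp
next
  case (mult f g)
  then obtain P Q :: "complex poly poly" where "\<forall>c z. f (qpt a b c q z) = poly (poly P [:z:]) c"
    "\<forall>c z. g (qpt a b c q z) = poly (poly Q [:z:]) c" by blast
  then show ?case by (intro exI[of _ "P * Q"]) simp
qed

lemma poly_poly_swap: "poly (poly P [:z:]) c = poly (map_poly (\<lambda>u. poly u c) P) z"
  by (induction P) (simp_all add: map_poly_pCons)

definition phi21_coeff :: "complex \<Rightarrow> complex \<Rightarrow> complex \<Rightarrow> complex \<Rightarrow> nat \<Rightarrow> complex" where
  "phi21_coeff a b c q k =
     qpochhammer a q k * qpochhammer b q k / (qpochhammer q q k * qpochhammer c q k)"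

lemma qpochhammer_nonzero:
  assumes "norm q < 1" "norm x < 1"
  shows "qpochhammer x q k \<noteq> 0"
proof -
  have "1 - x * q ^ j \<noteq> 0" for j using mult_power_neq_1[OF assms, of j] by simp
  then show ?thesis by (simp add: qpochhammer_def)
qed

lemma summable_phi21_coeff:
  assumes "norm q < 1" "norm c < 1" "norm z < 1"
  shows "summable (\<lambda>k. phi21_coeff a b c q k * z ^ k)"
proof -
  have nz: "qpochhammer_inf c q \<noteq> 0" "qpochhammer_inf q q \<noteq> 0"
    using assms by (simp_all add: qpochhammer_inf_nonzero mult_power_neq_1)
  have "phi21_coeff a b c q k = phi21_reg_coeff a b c q k / (qpochhammer_inf c q * qpochhammer_inf q q)" for k
    using nz qpochhammer_inf_split[OF assms(1), of c k] qpochhammer_inf_split[OF assms(1), of q k]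
    by (simp add: phi21_coeff_def phi21_reg_coeff_def)
  then show ?thesis
    using sums_summable[OF sums_divide[OF phi21_reg_sums[OF assms(1,3)]]] by simp
qed

lemma phi21_fps:
  assumes "norm q < 1" "norm c < 1"
  shows "fps_conv_radius (Abs_fps (phi21_coeff a b c q)) \<ge> 1"
    and "fps_conv_radius (Abs_fps (\<lambda>k. q ^ k * phi21_coeff a b c q k)) \<ge> 1"
    and "eval_fps (Abs_fps (phi21_coeff a b c q)) z = phi21_series a b c q z"
    and "eval_fps (Abs_fps (\<lambda>k. q ^ k * phi21_coeff a b c q k)) z = phi21_series a b c q (z * q)"
proof -
  show "fps_conv_radius (Abs_fps (phi21_coeff a b c q)) \<ge> 1"
    unfolding fps_conv_radius_def fps_nth_Abs_fps
  proof (rule conv_radius_geI_ex')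
    fix r :: real assume "0 < r" "ereal r < 1"
    then show "summable (\<lambda>n. phi21_coeff a b c q n * of_real r ^ n)"
      by (intro summable_phi21_coeff assms) auto
  qed
  show "fps_conv_radius (Abs_fps (\<lambda>k. q ^ k * phi21_coeff a b c q k)) \<ge> 1"
    unfolding fps_conv_radius_def fps_nth_Abs_fps
  proof (rule conv_radius_geI_ex')
    fix r :: real assume r: "0 < r" "ereal r < 1"
    then have "norm (of_real r * q) < 1"
      using assms mult_strict_mono'[of r 1 "norm q" 1] by (simp add: norm_mult)
    then show "summable (\<lambda>n. q ^ n * phi21_coeff a b c q n * of_real r ^ n)"
      using summable_phi21_coeff[OF assms, of "of_real r * q" a b] by (simp add: power_mult_distrib mult_ac)
  qed
qed (simp_all add: eval_fps_def phi21_series_def phi21_coeff_def power_mult_distrib mult_ac)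

text \<open>Multiplication by the variable gives a power series that vanishes at the origin as well, hence on a full
  neighbourhood of it.\<close>

lemma fps_eq_0I:
  fixes f :: "complex fps"
  assumes r: "fps_conv_radius f \<ge> 1" and 0: "\<And>z. z \<noteq> 0 \<Longrightarrow> norm z < 1 \<Longrightarrow> eval_fps f z = 0"
  shows "f = 0"
proof -
  have ev: "eval_fps (fps_X * f) z = 0" if "norm z < 1" for z
  proof -
    have "ereal (norm z) < fps_conv_radius f" using that r by (metis ereal_less(3) less_le_trans)
    then show ?thesis using 0[of z] that by (cases "z = 0") (simp_all add: eval_fps_mult)
  qed
  have "fps_X * f = 0"
  proof (rule eval_fps_eqD)
    have "(0 :: ereal) < 1" by simp
    also have "1 \<le> fps_conv_radius f" by (rule r)
    also have "\<dots> \<le> fps_conv_radius (fps_X * f)"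
      using fps_conv_radius_mult[of fps_X f] by simp
    finally show "fps_conv_radius (fps_X * f) > 0" .
    have "\<forall>\<^sub>F z in nhds 0. z \<in> ball (0 :: complex) 1" by (rule eventually_nhds_in_open) auto
    then show "\<forall>\<^sub>F z in nhds 0. eval_fps (fps_X * f) z = eval_fps 0 z"
      by eventually_elim (simp add: ev)
  qed simp
  then show ?thesis by simp
qed

lemma infinite_small_complex: "infinite {c :: complex. 0 < norm c \<and> norm c < 1}"
proof
  assume fin: "finite {c :: complex. 0 < norm c \<and> norm c < 1}"
  have "inj (\<lambda>n. of_real (1 / (real n + 2)) :: complex)" by (auto intro!: injI)
  moreover have "range (\<lambda>n. of_real (1 / (real n + 2)) :: complex) \<subseteq> {c. 0 < norm c \<and> norm c < 1}"
    by (auto simp: norm_divide simp flip: of_real_add)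
  ultimately show False using fin finite_subset finite_imageD infinite_UNIV_nat by blast
qed

lemma poly_eq_0_infinite:
  fixes p :: "complex poly"
  assumes "infinite A" "\<And>x. x \<in> A \<Longrightarrow> poly p x = 0"
  shows "p = 0"
  using poly_roots_finite[of p] finite_subset[of A "{x. poly p x = 0}"] assms by blast

lemma infinite_inverse_powers:
  fixes q :: complex
  assumes "q \<noteq> 0" "norm q < 1"
  shows "infinite (range (\<lambda>k. inverse q ^ k))"
proof -
  have "inj (\<lambda>k. inverse q ^ k)"
  proof (rule injI)
    fix m n assume "inverse q ^ m = inverse q ^ n"
    then have "norm q ^ m = norm q ^ n" by (metis inverse_inverse_eq norm_power power_inverse)
    then show "m = n" using assms by (simp add: power_inject_exp' )
  qed
  then show ?thesis using finite_imageD infinite_UNIV_nat by blast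
qed

text \<open>Compare the coefficients of \<open>z\<^bsup>i+k\<^esup>\<close>, multiply by \<open>(c;q)\<^sub>k\<close> to obtain a polynomial in \<open>c\<close>, and evaluate at
  \<open>c = q\<^bsup>1-k\<^esup>\<close>. This point lies outside the disc \<open>|c| < 1\<close> of the hypothesis when \<open>k \<ge> 1\<close>; it becomes
  accessible because a polynomial identity on the disc holds everywhere.\<close>

lemma no_polynomial_relation:
  fixes P S :: "complex poly poly"
  assumes q: "q \<noteq> 0" "norm q < 1" and ab: "norm a < 1" "norm b < 1"
    and rel: "\<And>c z. c \<noteq> 0 \<Longrightarrow> norm c < 1 \<Longrightarrow> z \<noteq> 0 \<Longrightarrow> norm z < 1 \<Longrightarrow>
      poly (poly P [:z:]) c * phi21_series a b c q z + poly (poly S [:z:]) c * phi21_series a b c q (z * q) = 0"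
  shows "P = 0 \<and> S = 0"
proof -
  have coeffs: "(\<Sum>m=0..n. phi21_coeff a b c q m * (poly (coeff P (n - m) + smult (q ^ m) (coeff S (n - m))) c)) = 0"
    if c: "c \<noteq> 0" "norm c < 1" for c n
  proof -
    let ?p = "fps_of_poly (map_poly (\<lambda>u. poly u c) P)" and ?s = "fps_of_poly (map_poly (\<lambda>u. poly u c) S)"
    let ?f = "Abs_fps (phi21_coeff a b c q)" and ?g = "Abs_fps (\<lambda>k. q ^ k * phi21_coeff a b c q k)"
    note fps = phi21_fps[OF q(2) c(2), of a b]
    have r: "fps_conv_radius (?f * ?p) \<ge> 1" "fps_conv_radius (?g * ?s) \<ge> 1"
      using fps fps_conv_radius_mult[of ?f ?p] fps_conv_radius_mult[of ?g ?s] by (auto intro: order_trans)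
    have "?f * ?p + ?g * ?s = 0"
    proof (rule fps_eq_0I)
      show "fps_conv_radius (?f * ?p + ?g * ?s) \<ge> 1"
        by (rule order_trans[OF min.boundedI[OF r] fps_conv_radius_add])
      fix z :: complex assume z: "z \<noteq> 0" "norm z < 1"
      then have z1: "ereal (norm z) < 1" by simp
      have "eval_fps (?f * ?p + ?g * ?s) z = phi21_series a b c q z * poly (poly P [:z:]) c +
         phi21_series a b c q (z * q) * poly (poly S [:z:]) c"
        using less_le_trans[OF z1 r(1)] less_le_trans[OF z1 r(2)] less_le_trans[OF z1 fps(1)] less_le_trans[OF z1 fps(2)]
        by (simp add: eval_fps_add eval_fps_mult fps poly_poly_swap)
      then show "eval_fps (?f * ?p + ?g * ?s) z = 0" using rel[OF c z] by (simp add: mult.commute)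
    qed
    then have "fps_nth (?f * ?p + ?g * ?s) n = 0" by simp
    then show ?thesis
      unfolding fps_add_nth fps_mult_nth sum.distrib[symmetric]
      by (simp add: coeff_map_poly distrib_left mult_ac)
  qed
  define N where "N k = qpochhammer a q k * qpochhammer b q k / qpochhammer q q k" for k
  have N: "N k \<noteq> 0" for k using ab q by (simp add: N_def qpochhammer_nonzero)
  have "coeff P i = 0 \<and> coeff S i = 0" for i
  proof (induction i rule: less_induct)
    case (less i)
    \<comment> \<open>\<open>(c;q)\<^sub>k\<close> times the coefficient of \<open>z\<^bsup>i+k\<^esup>\<close>; only \<open>m \<le> k\<close> contributes, by the induction hypothesis.\<close>
    define \<theta> where "\<theta> k = (\<Sum>m=0..k. (\<Prod>l\<in>{m..<k}. [:1, - (q ^ l):]) *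
      smult (N m) (coeff P (i + k - m) + smult (q ^ m) (coeff S (i + k - m))))" for k
    have \<theta>0: "\<theta> k = 0" for k
    proof (rule poly_eq_0_infinite[OF infinite_small_complex])
      fix c :: complex assume "c \<in> {c. 0 < norm c \<and> norm c < 1}"
      then have c: "c \<noteq> 0" "norm c < 1" by auto
      have t: "qpochhammer c q k * phi21_coeff a b c q m = (\<Prod>l\<in>{m..<k}. 1 - c * q ^ l) * N m" if "m \<le> k" for m
      proof -
        have "qpochhammer c q k = qpochhammer c q m * (\<Prod>l\<in>{m..<k}. 1 - c * q ^ l)"
          using that unfolding qpochhammer_def by (simp add: lessThan_atLeast0 prod.atLeastLessThan_concat)
        then show ?thesis
          using qpochhammer_nonzero[OF q(2) c(2), of m] by (simp add: phi21_coeff_def N_def)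
      qed
      have "poly (\<theta> k) c = (\<Sum>m=0..k. qpochhammer c q k * phi21_coeff a b c q m *
          poly (coeff P (i + k - m) + smult (q ^ m) (coeff S (i + k - m))) c)"
        unfolding \<theta>_def poly_sum by (rule sum.cong) (auto simp: t poly_prod mult_ac)
      also have "\<dots> = qpochhammer c q k * (\<Sum>m=0..k. phi21_coeff a b c q m *
          poly (coeff P (i + k - m) + smult (q ^ m) (coeff S (i + k - m))) c)"
        by (simp only: sum_distrib_left mult.assoc)
      also have "(\<Sum>m=0..k. phi21_coeff a b c q m *
          poly (coeff P (i + k - m) + smult (q ^ m) (coeff S (i + k - m))) c) =
        (\<Sum>m=0..i+k. phi21_coeff a b c q m *
          poly (coeff P (i + k - m) + smult (q ^ m) (coeff S (i + k - m))) c)"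
        by (rule sum.mono_neutral_left) (auto simp: less.IH)
      also have "\<dots> = 0" by (rule coeffs[OF c])
      finally show "poly (\<theta> k) c = 0" by simp
    qed
    have PS: "coeff P i + coeff S i = 0"
      using \<theta>0[of 0] N[of 0] by (simp add: \<theta>_def)
    have "coeff S i = 0"
    proof (rule poly_eq_0_infinite[OF infinite_inverse_powers[OF q]])
      fix c assume "c \<in> range (\<lambda>k. inverse q ^ k)"
      then obtain k where k: "c = inverse q ^ k" by auto
      have ck: "c * q ^ k = 1" using q by (simp add: k flip: power_mult_distrib)
      \<comment> \<open>At this \<open>c\<close> the factor with index \<open>k\<close> is zero and kills every summand except the last.\<close>
      have "poly (\<theta> (Suc k)) c = (\<Sum>m=0..Suc k. (\<Prod>l\<in>{m..<Suc k}. 1 - c * q ^ l) *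
         (N m * poly (coeff P (i + Suc k - m) + smult (q ^ m) (coeff S (i + Suc k - m))) c))"
        unfolding \<theta>_def poly_sum by (rule sum.cong) (auto simp: poly_prod simp del: prod.op_ivl_Suc)
      also have "\<dots> = (\<Sum>m\<in>{Suc k}. (\<Prod>l\<in>{m..<Suc k}. 1 - c * q ^ l) *
         (N m * poly (coeff P (i + Suc k - m) + smult (q ^ m) (coeff S (i + Suc k - m))) c))"
      proof (rule sum.mono_neutral_right)
        show "\<forall>m\<in>{0..Suc k} - {Suc k}. (\<Prod>l\<in>{m..<Suc k}. 1 - c * q ^ l) *
          (N m * poly (coeff P (i + Suc k - m) + smult (q ^ m) (coeff S (i + Suc k - m))) c) = 0"
        proof
          fix m assume "m \<in> {0..Suc k} - {Suc k}"
          then have "k \<in> {m..<Suc k}" by auto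
          then have "(\<Prod>l\<in>{m..<Suc k}. 1 - c * q ^ l) = 0"
            using ck by (intro prod_zero) auto
          then show "(\<Prod>l\<in>{m..<Suc k}. 1 - c * q ^ l) *
            (N m * poly (coeff P (i + Suc k - m) + smult (q ^ m) (coeff S (i + Suc k - m))) c) = 0" by simp
        qed
      qed auto
      finally have "poly (coeff P i) c + q ^ Suc k * poly (coeff S i) c = 0"
        using \<theta>0[of "Suc k"] N[of "Suc k"] by simp
      moreover have "poly (coeff P i) c + poly (coeff S i) c = 0"
        using PS by (metis poly_add poly_0)
      moreover have "(1 - q ^ Suc k) * poly (coeff S i) c = (poly (coeff P i) c + poly (coeff S i) c) -
          (poly (coeff P i) c + q ^ Suc k * poly (coeff S i) c)"
        by (simp only: left_diff_distrib) simp
      ultimately have "(1 - q ^ Suc k) * poly (coeff S i) c = 0" by simp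
      moreover have "1 - q ^ Suc k \<noteq> 0" using mult_power_neq_1[OF q(2) q(2), of k] by simp
      ultimately show "poly (coeff S i) c = 0" by (metis mult_eq_0_iff)
    qed
    with PS show ?case by simp
  qed
  then show ?thesis by (auto intro: poly_eqI)
qed

lemma cholomorphic_on_phi21_at: "cholomorphic_on phi21_at series_region"
proof -
  note h = series_regionD(2,3,4)
  have nz: "qpochhammer_inf (x $ Vc) (x $ Vq) * qpochhammer_inf (x $ Vq) (x $ Vq) \<noteq> 0"
    if "x \<in> series_region" for x
    using h[OF that] by (simp add: qpochhammer_inf_nonzero mult_power_neq_1)
  have "cholomorphic_on (\<lambda>x. phi21_reg (x $ Va) (x $ Vb) (x $ Vc) (x $ Vq) (x $ Vz) /
     (qpochhammer_inf (x $ Vc) (x $ Vq) * qpochhammer_inf (x $ Vq) (x $ Vq))) series_region"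
    by (intro cholomorphic_on_divide cholomorphic_on_phi21_reg cholomorphic_intros
        cholomorphic_on_qpochhammer_inf open_series_region h nz)
  then show ?thesis
  proof (rule cholomorphic_on_cong_open[OF _ open_series_region])
    fix x assume x: "x \<in> series_region"
    note h = h[OF x]
    from nz[OF x] show "phi21_at x = phi21_reg (x $ Va) (x $ Vb) (x $ Vc) (x $ Vq) (x $ Vz) /
     (qpochhammer_inf (x $ Vc) (x $ Vq) * qpochhammer_inf (x $ Vq) (x $ Vq))"
      using phi21_reg_eq_series[OF h(3,1) mult_power_neq_1[OF h(3,2)]] by (simp add: phi21_at_def)
  qed
qed

text \<open>The relation holds pointwise on \<open>series_region\<close> by continuity. Fixing \<open>a\<close>, \<open>b\<close>, \<open>q\<close> with \<open>|a|, |b| < 1\<close>,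
  so that no \<open>(a;q)\<^sub>k\<close> or \<open>(b;q)\<^sub>k\<close> vanishes, leaves a relation with polynomials in \<open>c\<close> and \<open>z\<close>.\<close>

lemma polyfun_independent:
  assumes p: "p \<in> polyfun" and s: "s \<in> polyfun"
    and rel: "abs_mero p * phi21 + abs_mero s * mero_shift shift_z phi21 = 0"
  shows "abs_mero p = 0 \<and> abs_mero s = 0"
proof -
  have shift: "shift_point shift_z x \<in> series_region" if "x \<in> series_region" for x
  proof -
    have "norm (x $ Vz * x $ Vq) < 1"
      using series_regionD[OF that] mult_strict_mono'[of "norm (x $ Vz)" 1 "norm (x $ Vq)" 1]
      by (simp add: norm_mult)
    then show ?thesis
      using that shift_point_in_qdomain[of x shift_z] by (simp add: series_region_def shift_point_nth)
  qed
  have "mero_agrees_on 0 (\<lambda>x. p x * phi21_at x + s x * phi21_at (shift_point shift_z x)) series_region"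
    unfolding rel[symmetric]
    by (intro mero_agrees_on_add mero_agrees_on_mult mero_agrees_on_phi21 mero_agrees_on_phi21_shift
        mero_agrees_on_polyfun p s shift order_refl)
  moreover have "continuous_on series_region (\<lambda>x. p x * phi21_at x + s x * phi21_at (shift_point shift_z x))"
    by (intro cholomorphic_on_imp_continuous_on cholomorphic_intros cholomorphic_on_polyfun p s
        cholomorphic_on_phi21_at cholomorphic_on_shift[OF cholomorphic_on_phi21_at] shift)
       (auto simp: series_region_def)
  ultimately have zero: "p x * phi21_at x + s x * phi21_at (shift_point shift_z x) = 0"
    if "x \<in> series_region" for x
    using mero_eq_0D[OF _ open_series_region _ _ that] by (auto simp: series_region_def)
  let ?W = "{x\<in>qdomain. norm (x $ Va) < 1 \<and> norm (x $ Vb) < 1}"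
  have vanish: "p x = 0 \<and> s x = 0" if x: "x \<in> ?W" for x
  proof -
    define a b q where "a = x $ Va" and "b = x $ Vb" and "q = x $ Vq"
    have h: "a \<noteq> 0" "b \<noteq> 0" "q \<noteq> 0" "norm q < 1" "norm a < 1" "norm b < 1"
      using x by (auto simp: qdomain_def a_def b_def q_def)
    obtain P :: "complex poly poly" where P: "\<And>c z. p (qpt a b c q z) = poly (poly P [:z:]) c"
      using polyfun_as_poly[OF p, of a b q] by blast
    obtain S :: "complex poly poly" where S: "\<And>c z. s (qpt a b c q z) = poly (poly S [:z:]) c"
      using polyfun_as_poly[OF s, of a b q] by blast
    have "P = 0 \<and> S = 0"
    proof (rule no_polynomial_relation[OF h(3-6)])
      fix c z :: complex assume "c \<noteq> 0" "norm c < 1" "z \<noteq> 0" "norm z < 1"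
      then have "qpt a b c q z \<in> series_region" using h by (simp add: series_region_def qdomain_def)
      from zero[OF this]
      show "poly (poly P [:z:]) c * phi21_series a b c q z + poly (poly S [:z:]) c * phi21_series a b c q (z * q) = 0"
        by (simp add: P S phi21_at_def shift_point_nth)
    qed
    then have "p (qpt a b c q z) = 0 \<and> s (qpt a b c q z) = 0" for c z by (simp add: P S)
    from this[of "x $ Vc" "x $ Vz"] show ?thesis unfolding a_def b_def q_def qpt_eta[symmetric] .
  qed
  have "?W = qdomain \<inter> {x. norm (x $ Va) < 1} \<inter> {x. norm (x $ Vb) < 1}" by auto
  moreover have "open \<dots>"
    by (intro open_Int open_qdomain open_Collect_less continuous_intros continuous_on_component)
  ultimately have W: "open ?W" by simp
  have "(\<chi> i. 1 / 2) \<in> ?W" by (simp add: qdomain_def)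
  then have ne: "?W \<noteq> {}" by blast
  show ?thesis
    using mero_eq_0I[OF mero_agrees_on_polyfun[OF p] W ne] mero_eq_0I[OF mero_agrees_on_polyfun[OF s] W ne] vanish
    by auto
qed

lemma phi21_independent:
  assumes "qdo_monom r 0 + qdo_monom s shift_z \<in> annihilator phi21"
  shows "r = 0 \<and> s = 0"
proof -
  obtain p d where p: "p \<in> polyfun" "d \<in> polyfun" "abs_mero d \<noteq> 0" "mero_of_ratfun r * abs_mero d = abs_mero p"
    using rational_function_fraction[OF mero_of_ratfun] by blast
  obtain p' d' where p': "p' \<in> polyfun" "d' \<in> polyfun" "abs_mero d' \<noteq> 0"
      "mero_of_ratfun s * abs_mero d' = abs_mero p'"
    using rational_function_fraction[OF mero_of_ratfun] by blast
  have 0: "mero_of_ratfun r * phi21 + mero_of_ratfun s * mero_shift shift_z phi21 = 0"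
    using assms by (simp add: annihilator_def qdo_act_add_left qdo_act_monom)
  have "abs_mero (\<lambda>x. p x * d' x) * phi21 + abs_mero (\<lambda>x. p' x * d x) * mero_shift shift_z phi21 =
     (mero_of_ratfun r * phi21 + mero_of_ratfun s * mero_shift shift_z phi21) * (abs_mero d * abs_mero d')"
    by (simp add: abs_mero_mult p(1,2) p'(1,2) algebra_simps flip: p(4) p'(4))
  also have "\<dots> = 0" unfolding 0 by simp
  finally have "abs_mero (\<lambda>x. p x * d' x) = 0 \<and> abs_mero (\<lambda>x. p' x * d x) = 0"
    by (intro polyfun_independent polyfun.mult p p')
  then have "abs_mero p = 0" "abs_mero p' = 0"
    using p p' by (auto simp: abs_mero_mult)
  then show ?thesis
    using p(3,4) p'(3,4) by (auto simp: mero_of_ratfun_eq_0_iff)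
qed

section \<open>The annihilator\<close>

theorem corollary2p5:
  shows "annihilator phi21 = left_ideal hull {P_a, P_b, P_c, Q_a, Q_b, Q_c, R_z}"
proof
  let ?G = "{P_a, P_b, P_c, Q_a, Q_b, Q_c, R_z}"
  let ?J = "left_ideal hull ?G"
  have sub: "?J \<subseteq> annihilator phi21"
    by (rule hull_minimal)
       (auto simp: left_ideal_annihilator P_a_annihilates P_b_annihilates P_c_annihilates Q_a_annihilates
         Q_b_annihilates Q_c_annihilates R_z_annihilates)
  then show "?J \<subseteq> annihilator phi21" .
  show "annihilator phi21 \<subseteq> ?J"
  proof
    fix D assume D: "D \<in> annihilator phi21"
    have "D \<in> first_order_mod ?J"
      by (rule first_order_mod_eq_UNIV[OF left_ideal_hull hull_subset])
    then obtain r s where rs: "D - (qdo_monom r 0 + qdo_monom s shift_z) \<in> ?J"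
      unfolding first_order_mod_def by auto
    have "D - (D - (qdo_monom r 0 + qdo_monom s shift_z)) \<in> annihilator phi21"
      by (rule left_ideal_closed(5)[OF left_ideal_annihilator D subsetD[OF sub rs]])
    then have "qdo_monom r 0 + qdo_monom s shift_z \<in> annihilator phi21"
      by (simp only: diff_diff_eq2 add_diff_cancel_left')
    then have "r = 0 \<and> s = 0" by (rule phi21_independent)
    with rs show "D \<in> ?J" by (simp add: qdo_monom_0)
  qed
qed

end
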